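(* Let $\mathbb{F}=\mathbb{R}$ or $\mathbb{C}$. Let $P(\lambda)=\sum_{i=0}^dP_i\lambda^i\in\mathbb{F}[\lambda]^{m\times n}$ be nonzero and let $$\mathcal{L}(\lambda)=\begin{bmatrix}\lambda M_1+M_0 & L_\eta(\lambda)^T\otimes I_m\\ L_\varepsilon(\lambda)\otimes I_n & 0\end{bmatrix}$$ be an $(\varepsilon,n,\eta,m)$-block Kronecker pencil with $d=\varepsilon+\eta+1$ such that $P(\lambda)=(\Lambda_\eta(\lambda)^T\otimes I_m)(\lambda M_1+M_0)(\Lambda_\varepsilon(\lambda)\otimes I_n)$. If $\Delta\mathcal{L}(\lambda)$ is any pencil with the same size as $\mathcal{L}(\lambda)$ and such that $$\|\Delta\mathcal{L}(\lambda)\|_F<(\sqrt2-1)^2\,\frac{1}{d^{5/2}}\,\frac{1}{1+\|\lambda M_1+M_0\|_F},$$ then $\mathcal{L}(\lambda)+\Delta\mathcal{L}(\lambda)$ is a strong linearization of a matrix polynomial $P(\lambda)+\Delta P(\lambda)$ with grade $d$ and such that $$\frac{\|\Delta P(\lambda)\|_F}{\|P(\lambda)\|_F}\le14\,d^{5/2}\,\frac{\|\mathcal{L}(\lambda)\|_F}{\|P(\lambda)\|_F}\,\bigl(1+\|\lambda M_1+M_0\|_F+\|\lambda M_1+M_0\|_F^2\bigr)\,\frac{\|\Delta\mathcal{L}(\lambda)\|_F}{\|\mathcal{L}(\lambda)\|_F}.$$ In addition, the right minimal indices of $\mathcal{L}(\lambda)+\Delta\mathcal{L}(\lambda)$ are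 those of $P(\lambda)+\Delta P(\lambda)$ shifted by $\varepsilon$, and the left minimal indices of $\mathcal{L}(\lambda)+\Delta\mathcal{L}(\lambda)$ are those of $P(\lambda)+\Delta P(\lambda)$ shifted by $\eta$.
   Context: $L_k(\lambda)\in\mathbb{F}[\lambda]^{k\times(k+1)}$ is the pencil with $-1$ in positions $(i,i)$, $\lambda$ in positions $(i,i+1)$, $i=1,\dots,k$, and zeros elsewhere; $\Lambda_k(\lambda)^T=[\lambda^k\ \cdots\ \lambda\ 1]$. $\otimes$ is the Kronecker product. An $(\varepsilon,n,\eta,m)$-block Kronecker pencil is a pencil of the displayed form with $\lambda M_1+M_0$ an arbitrary pencil of size $(\eta+1)m\times(\varepsilon+1)n$; $\varepsilon,\eta\ge0$ are integers, and if $\varepsilon=0$ (resp. $\eta=0$) the second block row (resp. second block column) is absent. For a matrix polynomial $R(\lambda)=\sum_iR_i\lambda^i$, $\|R(\lambda)\|_F:=\sqrt{\sum_i\|R_i\|_F^2}$, with $\|R_i\|_F$ the Frobenius norm of the constant matrix $R_i$. A matrix polynomial $P(\lambda)$ has grade $d$ if it is written $\sum_{i=0}^dP_i\lambda^i$ (possibly $P_d=0$). $\mathrm{rev}_dP(\lambda):=\lambda^dP(\lambda^{-1})$. A pencil (grade $1$ matrix polynomial) $\mathcal{L}(\lambda)$ is a linearization of $P(\lambda)$ of grade $d$ if for some $s\ge0$ there are unimodular matrix polynomials (nonzero constant determinant) $U(\lambda),V(\lambda)$ with $U(\lambda)\mathcal{L}(\lambda)V(\lambda)=\mathrm{diag}(I_s,P(\lambda))$;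 it is a strong linearization if moreover $\mathrm{rev}_1\mathcal{L}(\lambda)$ is a linearization of $\mathrm{rev}_dP(\lambda)$. Right (resp. left) minimal indices of an $m\times n$ matrix polynomial $P$: the ordered list of degrees of the vectors in any polynomial basis, of least total degree among polynomial bases, of $\{x\in\mathbb{F}(\lambda)^{n\times1}:Px=0\}$ (resp. $\{y^T\in\mathbb{F}(\lambda)^{1\times m}:y^TP=0\}$). "The right (left) minimal indices of $A$ are those of $B$ shifted by $k$" means: if $\alpha_1\le\cdots\le\alpha_p$ are the right (left) minimal indices of $B$, then $\alpha_1+k\le\cdots\le\alpha_p+k$ are the right (left) minimal indices of $A$. *)

theory Defs
  imports
    "HOL-Analysis.Euclidean_Space"
    "HOL-Computational_Algebra.Polynomial_Factorial"
    "Jordan_Normal_Form.Matrix_Kernel"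
    "Jordan_Normal_Form.Determinant"
begin

text \<open>The scalar field is \<open>\<real>\<close> or \<open>\<complex>\<close>: either every element is a real multiple of \<open>1\<close>, or there is
  a square root of \<open>-1\<close> which together with \<open>1\<close> spans the field over the reals. Since the norm
  of a \<^class>\<open>real_normed_field\<close> is multiplicative, it is then the usual absolute value.\<close>

class real_or_complex = real_normed_field + euclidean_space +
  assumes real_or_complex:
    "(\<forall>z. \<exists>a. z = a *\<^sub>R 1) \<or> (\<exists>i. i * i = - 1 \<and> (\<forall>z. \<exists>a b. z = a *\<^sub>R 1 + b *\<^sub>R i))"

instance real :: real_or_complex
  by standard auto

instance complex :: real_or_complex
proof
  have "\<exists>a b. z = a *\<^sub>R 1 + b *\<^sub>R \<i>" for z :: complex
    by (rule exI[of _ "Re z"], rule exI[of _ "Im z"]) (simp add: complex_eq_iff)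
  then show "(\<forall>z::complex. \<exists>a. z = a *\<^sub>R 1) \<or>
      (\<exists>i::complex. i * i = - 1 \<and> (\<forall>z. \<exists>a b. z = a *\<^sub>R 1 + b *\<^sub>R i))"
    by (intro disjI2 exI[of _ \<i>]) auto
qed

definition mat_degree :: "'a::zero poly mat \<Rightarrow> nat" where
  "mat_degree R = Max (insert 0 (degree ` elements_mat R))"

definition has_grade :: "nat \<Rightarrow> 'a::zero poly mat \<Rightarrow> bool" where
  "has_grade d R \<longleftrightarrow> (\<forall>p \<in> elements_mat R. degree p \<le> d)"

definition coeff_mat :: "'a::zero poly mat \<Rightarrow> nat \<Rightarrow> 'a mat" where
  "coeff_mat R k = map_mat (\<lambda>p. coeff p k) R"

definition frob_norm :: "'a::real_normed_vector mat \<Rightarrow> real" where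
  "frob_norm A = sqrt (\<Sum>i<dim_row A. \<Sum>j<dim_col A. (norm (A $$ (i, j)))\<^sup>2)"

definition frob_norm_poly :: "'a::real_normed_vector poly mat \<Rightarrow> real" where
  "frob_norm_poly R = sqrt (\<Sum>k\<le>mat_degree R. (frob_norm (coeff_mat R k))\<^sup>2)"

text \<open>For \<open>degree p \<le> d\<close> this is \<open>\<lambda>\<^sup>d p(\<lambda>\<^sup>-\<^sup>1)\<close>. The library's \<^const>\<open>reflect_poly\<close> always
  reverses with respect to the degree, not with respect to a prescribed grade.\<close>

definition rev_poly :: "nat \<Rightarrow> 'a::comm_monoid_add poly \<Rightarrow> 'a poly" where
  "rev_poly d p = (\<Sum>k\<le>d. monom (coeff p k) (d - k))"

definition rev_mat :: "nat \<Rightarrow> 'a::comm_monoid_add poly mat \<Rightarrow> 'a poly mat" where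
  "rev_mat d R = map_mat (rev_poly d) R"

definition pencil :: "'a::comm_monoid_add mat \<Rightarrow> 'a mat \<Rightarrow> 'a poly mat" where
  "pencil M1 M0 = map_mat (\<lambda>a. monom a 1) M1 + map_mat (\<lambda>a. [:a:]) M0"

definition kron :: "'a::times mat \<Rightarrow> 'a mat \<Rightarrow> 'a mat" (infixl \<open>\<otimes>\<^sub>m\<close> 75) where
  "A \<otimes>\<^sub>m B = mat (dim_row A * dim_row B) (dim_col A * dim_col B)
     (\<lambda>(i, j). A $$ (i div dim_row B, j div dim_col B) * B $$ (i mod dim_row B, j mod dim_col B))"

definition L_pencil :: "nat \<Rightarrow> 'a::comm_ring_1 poly mat" where
  "L_pencil k = mat k (k + 1) (\<lambda>(i, j). if j = i then - 1 else if j = i + 1 then monom 1 1 else 0)"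

definition Lambda_col :: "nat \<Rightarrow> 'a::comm_ring_1 poly mat" where
  "Lambda_col k = mat (k + 1) 1 (\<lambda>(i, j). monom 1 (k - i))"

text \<open>For \<open>\<epsilon> = 0\<close> (\<open>\<eta> = 0\<close>) the second block row (column) has zero rows (columns), i.e. is absent.\<close>

definition block_kronecker_pencil ::
    "nat \<Rightarrow> nat \<Rightarrow> nat \<Rightarrow> nat \<Rightarrow> 'a::comm_ring_1 mat \<Rightarrow> 'a mat \<Rightarrow> 'a poly mat" where
  "block_kronecker_pencil \<epsilon> n \<eta> m M1 M0 =
     four_block_mat (pencil M1 M0)               ((L_pencil \<eta>)\<^sup>T \<otimes>\<^sub>m 1\<^sub>m m)
                    (L_pencil \<epsilon> \<otimes>\<^sub>m 1\<^sub>m n)      (0\<^sub>m (\<epsilon> * n) (\<eta> * m))"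

definition unimodular :: "nat \<Rightarrow> 'a::field poly mat \<Rightarrow> bool" where
  "unimodular k U \<longleftrightarrow> U \<in> carrier_mat k k \<and> (\<exists>c. c \<noteq> 0 \<and> det U = [:c:])"

definition linearization :: "'a::field poly mat \<Rightarrow> 'a poly mat \<Rightarrow> bool" where
  "linearization L P \<longleftrightarrow> has_grade 1 L \<and>
     (\<exists>s U V. unimodular (dim_row L) U \<and> unimodular (dim_col L) V \<and>
        U * L * V = four_block_mat (1\<^sub>m s) (0\<^sub>m s (dim_col P)) (0\<^sub>m (dim_row P) s) P)"

definition strong_linearization :: "nat \<Rightarrow> 'a::field poly mat \<Rightarrow> 'a poly mat \<Rightarrow> bool" where
  "strong_linearization d L P \<longleftrightarrow>
     has_grade d P \<and> linearization L P \<and> linearization (rev_mat 1 L) (rev_mat d P)"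

definition vec_degree :: "'a::zero poly vec \<Rightarrow> nat" where
  "vec_degree v = Max (insert 0 (degree ` set\<^sub>v v))"

definition null_poly_basis :: "'a::field poly mat \<Rightarrow> 'a poly vec set \<Rightarrow> bool" where
  "null_poly_basis P B \<longleftrightarrow> finite B \<and>
     vectorspace.basis class_ring
       ((module_vec TYPE('a poly fract) (dim_col P))
          \<lparr>carrier := mat_kernel (map_mat to_fract P)\<rparr>)
       (map_vec to_fract ` B)"

definition minimal_basis :: "'a::field poly mat \<Rightarrow> 'a poly vec set \<Rightarrow> bool" where
  "minimal_basis P B \<longleftrightarrow> null_poly_basis P B \<and>
     (\<forall>C. null_poly_basis P C \<longrightarrow> (\<Sum>v\<in>B. vec_degree v) \<le> (\<Sum>v\<in>C. vec_degree v))"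

text \<open>Minimal bases exist and all have the same degrees, so the minimal indices are well defined.\<close>

lemma clear_denominators:
  fixes v :: "'a::field poly fract vec"
  shows "\<exists>c w. c \<noteq> 0 \<and> map_vec to_fract w = c \<cdot>\<^sub>v v"
proof -
  have "\<forall>i. \<exists>a b. b \<noteq> 0 \<and> v $ i = Fract a b"
    by (metis Fract_cases)
  then obtain a b where ab: "\<And>i. b i \<noteq> 0" "\<And>i. v $ i = Fract (a i) (b i)"
    by metis
  define c where "c = (\<Prod>j<dim_vec v. b j)"
  define w where "w = vec (dim_vec v) (\<lambda>i. a i * (\<Prod>j\<in>{..<dim_vec v} - {i}. b j))"
  have "to_fract (a i * (\<Prod>j\<in>{..<dim_vec v} - {i}. b j)) = to_fract c * v $ i" if "i < dim_vec v" for i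
  proof -
    have "c = b i * (\<Prod>j\<in>{..<dim_vec v} - {i}. b j)"
      unfolding c_def using that by (simp add: prod.remove)
    then show ?thesis using ab(1)[of i] by (simp add: ab(2) to_fract_def eq_fract mult_ac)
  qed
  moreover have "to_fract c \<noteq> 0" using ab(1) by (simp add: c_def)
  ultimately show ?thesis
    by (intro exI[of _ "to_fract c"] exI[of _ w]) (auto simp: w_def)
qed

lemma null_poly_basis_exists:
  fixes P :: "'a::field poly mat"
  shows "\<exists>B. null_poly_basis P B"
proof -
  define A where "A = map_mat to_fract P"
  have A: "A \<in> carrier_mat (dim_row P) (dim_col P)" by (simp add: A_def)
  interpret K: kernel "dim_row P" "dim_col P" A by (unfold_locales) (rule A)
  obtain S where S: "finite S" "K.basis S" using kernel_basis_exists[OF A] by auto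
  obtain c :: "'a poly fract vec \<Rightarrow> 'a poly fract" and w where cw: "\<And>v. c v \<noteq> 0" "\<And>v. map_vec to_fract (w v) = c v \<cdot>\<^sub>v v"
    using clear_denominators[where ?'a = 'a] by metis
  define T where "T = (\<lambda>v. c v \<cdot>\<^sub>v v) ` S"
  have SK: "S \<subseteq> mat_kernel A" "K.lin_indpt S" "K.span S = mat_kernel A" 
    using S(2) unfolding K.Ker.basis_def by auto
  have TK: "T \<subseteq> mat_kernel A" using SK(1) mat_kernel_smult[OF A] by (auto simp: T_def)
  have "S \<subseteq> K.span T"
  proof
    fix v assume v: "v \<in> S"
    have "c v \<cdot>\<^sub>v v \<in> K.span T" using K.Ker.in_own_span[OF TK] v by (auto simp: T_def)
    from submodule.smult_closed[OF K.Ker.span_is_submodule[OF TK] _ this, of "inverse (c v)"]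
    show "v \<in> K.span T" using cw(1)[of v] by (simp add: smult_smult_assoc)
  qed
  then have "K.span S \<subseteq> K.span T" using K.Ker.span_is_subset by (metis K.Ker.span_is_submodule TK)
  then have span: "K.span T = mat_kernel A"
    using SK(3) K.Ker.span_is_subset2[OF TK] by auto
  have fT: "finite T" using S(1) by (simp add: T_def)
  have "card T \<le> card S" using S(1) by (simp add: T_def card_image_le)
  then have "K.basis T"
    using K.Ker.dim_gen_is_basis[OF fT] TK span K.Ker.dim_basis[OF S] by auto
  moreover have "T = map_vec to_fract ` w ` S" by (auto simp: T_def cw(2) image_image)
  ultimately have "null_poly_basis P (w ` S)"
    using S(1) by (simp add: null_poly_basis_def A_def)
  then show ?thesis ..
qed

lemma minimal_basis_exists: "\<exists>B. minimal_basis P B"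
proof -
  obtain B where "null_poly_basis P B" using null_poly_basis_exists by blast
  from ex_has_least_nat[of "null_poly_basis P" B "\<lambda>B. \<Sum>v\<in>B. vec_degree v", OF this]
  show ?thesis by (auto simp: minimal_basis_def)
qed

lemma (in vectorspace) basis_exchange:
  assumes B: "finite B" "basis B" and S: "S \<subseteq> B" and c: "c \<in> carrier V" "c \<notin> span S" "c \<notin> B"
  shows "\<exists>b \<in> B - S. basis (insert c (B - {b}))"
proof -
  have BV: "B \<subseteq> carrier V" "lin_indpt B" "span B = carrier V"
    using B(2) by (auto simp: basis_def)
  have step: "lin_indpt (insert x A) \<longleftrightarrow> x \<notin> span A"
    if "A \<subseteq> carrier V" "lin_indpt A" "x \<in> carrier V" "x \<notin> A" for x A
    using lin_dep_iff_in_span[OF that] by simp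
  define F where "F = {E. S \<subseteq> E \<and> E \<subseteq> B \<and> lin_indpt (insert c E)}"
  have "lin_indpt S" using BV(2) S subset_li_is_li by blast
  then have "S \<in> F" using step[of S c] S BV c by (auto simp: F_def)
  moreover have "finite F" using B(1) by (auto simp: F_def intro: finite_subset[of _ "Pow B"])
  ultimately obtain E where E: "E \<in> F" "\<And>E'. E' \<in> F \<Longrightarrow> E \<subseteq> E' \<Longrightarrow> E' = E"
    using finite_has_maximal2[of F S] by metis
  have SE: "S \<subseteq> E" "E \<subseteq> B" and li: "lin_indpt (insert c E)" using E(1) by (auto simp: F_def)
  have cE: "insert c E \<subseteq> carrier V" "finite (insert c E)" using SE BV c B(1) finite_subset by auto
  have "b \<in> span (insert c E)" if b: "b \<in> B" for b
  proof (cases "b \<in> E")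
    case True
    then show ?thesis using in_own_span[OF cE(1)] by auto
  next
    case False
    then have "insert b E \<notin> F" using E(2)[of "insert b E"] by auto
    then have "lin_dep (insert b (insert c E))" using b SE by (auto simp: F_def insert_commute)
    then show ?thesis using step[OF cE(1) li, of b] b BV False c by auto
  qed
  then have "span B \<subseteq> span (insert c E)"
    using span_is_subset[OF _ span_is_submodule[OF cE(1)]] by blast
  then have bas: "basis (insert c E)"
    using BV(3) cE(1) li span_is_subset2[OF cE(1)] by (auto simp: basis_def)
  have fE: "finite E" using cE by simp
  have "card (insert c E) = card B" using dim_basis[OF cE(2) bas] dim_basis[OF B] by simp
  moreover have "c \<notin> E" using SE c by auto
  ultimately have "card B = Suc (card E)" using fE by simp
  then have "card (B - E) = 1" using SE fE by (simp add: card_Diff_subset)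
  then obtain b where b: "B - E = {b}" by (auto simp: card_1_singleton_iff)
  then have "E = B - {b}" using SE by auto
  then show ?thesis using b SE bas by auto
qed

lemma minimal_basis_card_le:
  fixes P :: "'a::field poly mat"
  assumes B: "minimal_basis P B" and C: "minimal_basis P C"
  shows "card {v \<in> C. vec_degree v \<le> k} \<le> card {v \<in> B. vec_degree v \<le> k}"
proof (rule ccontr)
  assume less: "\<not> ?thesis"
  define A where "A = map_mat to_fract P"
  have A: "A \<in> carrier_mat (dim_row P) (dim_col P)" by (simp add: A_def)
  interpret K: kernel "dim_row P" "dim_col P" A by (unfold_locales) (rule A)
  let ?f = "map_vec to_fract :: 'a poly vec \<Rightarrow> 'a poly fract vec"
  have inj: "inj ?f"
  proof (rule injI)
    fix v w assume "?f v = ?f w"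
    then show "v = w" by (metis eq_vecI index_map_vec to_fract_eq_iff)
  qed
  have npb: "null_poly_basis P X \<longleftrightarrow> finite X \<and> K.basis (?f ` X)" for X
    by (simp add: null_poly_basis_def A_def)
  have Bb: "finite B" "K.basis (?f ` B)" and Cb: "finite C" "K.basis (?f ` C)"
    using B C by (auto simp: minimal_basis_def npb)
  let ?B = "{v \<in> B. vec_degree v \<le> k}" and ?C = "{v \<in> C. vec_degree v \<le> k}"
  have BK: "?f ` ?B \<subseteq> mat_kernel A" using Bb(2) by (auto simp: K.Ker.basis_def)
  have CK: "?f ` C \<subseteq> mat_kernel A" using Cb(2) by (auto simp: K.Ker.basis_def)
  have "K.lin_indpt (?f ` ?C)"
    using Cb(2) K.Ker.subset_li_is_li[of "?f ` C" "?f ` ?C"] by (auto simp: K.Ker.basis_def)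
  moreover have "card (?f ` ?B) < card (?f ` ?C)"
    using less by (simp add: card_image inj_on_subset[OF inj])
  ultimately have "\<not> ?f ` ?C \<subseteq> K.span (?f ` ?B)"
    using K.Ker.replacement[of "?f ` ?C" "?f ` ?B"] Bb(1) Cb(1) BK by fastforce
  then obtain c where c: "c \<in> C" "vec_degree c \<le> k" "?f c \<notin> K.span (?f ` ?B)" by auto
  have "c \<notin> B" using c K.Ker.in_own_span[OF BK] by auto
  then have cfB: "?f c \<notin> ?f ` B" using inj by (auto dest: injD)
  obtain b where b: "b \<in> ?f ` B - ?f ` ?B" "K.basis (insert (?f c) (?f ` B - {b}))"
    using K.Ker.basis_exchange[OF _ Bb(2) _ _ c(3) cfB] Bb(1) c(1) CK by auto
  from b(1) obtain b' where b0: "b' \<in> B" "b = ?f b'" by blast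
  have "b' \<notin> ?B" using b(1) unfolding b0(2) by blast
  then have b': "b' \<in> B" "vec_degree b' > k" "b = ?f b'" using b0 by auto
  have "insert (?f c) (?f ` B - {b}) = ?f ` insert c (B - {b'})"
    using inj b' by (auto simp: image_set_diff)
  then have "null_poly_basis P (insert c (B - {b'}))" using b(2) Bb(1) by (simp add: npb)
  then have "(\<Sum>v\<in>B. vec_degree v) \<le> (\<Sum>v\<in>insert c (B - {b'}). vec_degree v)"
    using B by (simp add: minimal_basis_def)
  also have "\<dots> = vec_degree c + (\<Sum>v\<in>B - {b'}. vec_degree v)" using \<open>c \<notin> B\<close> Bb(1) by simp
  also have "\<dots> < vec_degree b' + (\<Sum>v\<in>B - {b'}. vec_degree v)" using c(2) b'(2) by simp
  also have "\<dots> = (\<Sum>v\<in>B. vec_degree v)" using b'(1) Bb(1) by (simp add: sum.remove)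
  finally show False by simp
qed

lemma minimal_basis_degrees_unique:
  fixes P :: "'a::field poly mat"
  assumes B: "minimal_basis P B" and C: "minimal_basis P C"
  shows "image_mset vec_degree (mset_set B) = image_mset vec_degree (mset_set C)"
proof (rule multiset_eqI)
  fix k
  have fin: "finite B" "finite C" using B C by (auto simp: minimal_basis_def null_poly_basis_def)
  have le: "card {v \<in> B. vec_degree v \<le> j} = card {v \<in> C. vec_degree v \<le> j}" for j
    using minimal_basis_card_le[OF B C] minimal_basis_card_le[OF C B] by (simp add: antisym)
  have cnt: "count (image_mset vec_degree (mset_set X)) k = card {v \<in> X. vec_degree v = k}"
    if "finite X" for X :: "'a poly vec set"
    using that by (simp add: count_image_mset_eq_card_vimage)
  have eq: "card {v \<in> X. vec_degree v = k} = card {v \<in> X. vec_degree v \<le> k} -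
      (if k = 0 then 0 else card {v \<in> X. vec_degree v \<le> k - 1})"
    if "finite X" for X :: "'a poly vec set"
  proof (cases k)
    case (Suc l)
    have "{v \<in> X. vec_degree v = k} = {v \<in> X. vec_degree v \<le> k} - {v \<in> X. vec_degree v \<le> l}"
      using Suc by auto
    moreover have "{v \<in> X. vec_degree v \<le> l} \<subseteq> {v \<in> X. vec_degree v \<le> k}" using Suc by auto
    ultimately show ?thesis using that Suc by (simp add: card_Diff_subset)
  qed simp
  show "count (image_mset vec_degree (mset_set B)) k = count (image_mset vec_degree (mset_set C)) k"
    by (simp add: cnt fin eq le)
qed

definition right_minimal_indices :: "'a::field poly mat \<Rightarrow> nat list" where
  "right_minimal_indices P =
     (THE \<alpha>. \<exists>B. minimal_basis P B \<and>
        \<alpha> = sorted_list_of_multiset (image_mset vec_degree (mset_set B)))"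

lemma right_minimal_indices_eq:
  assumes "minimal_basis P B"
  shows "right_minimal_indices P = sorted_list_of_multiset (image_mset vec_degree (mset_set B))"
  unfolding right_minimal_indices_def
proof (rule the_equality)
  fix \<alpha> assume "\<exists>C. minimal_basis P C \<and>
    \<alpha> = sorted_list_of_multiset (image_mset vec_degree (mset_set C))"
  then show "\<alpha> = sorted_list_of_multiset (image_mset vec_degree (mset_set B))"
    using minimal_basis_degrees_unique[OF assms] by auto
qed (use assms in blast)

text \<open>\<open>y\<^sup>T P = 0\<close> is \<open>P\<^sup>T y = 0\<close>.\<close>

definition left_minimal_indices :: "'a::field poly mat \<Rightarrow> nat list" where
  "left_minimal_indices P = right_minimal_indices P\<^sup>T"

end

theory Submission
  imports Defs "HOL-Analysis.Convex" "HOL-Analysis.L2_Norm"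
begin

text \<open>
  Strict equivalence by constant invertible matrices close to the identity brings the perturbed pencil
  back to an exact block Kronecker pencil, so no perturbed dual minimal bases are needed. First a
  Riccati-type equation is solved to annihilate the \<open>(2,2)\<close> block; then the perturbed off-diagonal
  blocks \<open>L\<^sub>k \<otimes> I + \<Delta>\<close> are written as \<open>(I + Z) (L\<^sub>k \<otimes> I) (I + Y)\<^sup>-\<^sup>1\<close>, which is possible since the orbit
  of \<open>L\<^sub>k \<otimes> I\<close> is open. Both equations have an explicit right inverse for their linear part, given by
  telescoping sums along block (anti)diagonals, and are solved by the contraction principle. The new
  \<open>(1,1)\<close> block \<open>M'\<close> is close to \<open>M\<close>, and \<open>P + \<Delta>P = (\<Lambda>\<^sub>\<eta>\<^sup>T \<otimes> I) M' (\<Lambda>\<^sub>\<epsilon> \<otimes> I)\<close>.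

  For an exact block Kronecker pencil explicit unimodular transformations to \<open>diag(I, P + \<Delta>P)\<close> exist,
  and \<open>w \<mapsto> (\<Lambda>\<^sub>\<epsilon> w, *)\<close> maps the null space of \<open>P + \<Delta>P\<close> bijectively onto that of the pencil, raising
  degrees by \<open>\<epsilon>\<close>; left minimal indices follow by transposition.
\<close>

section \<open>Constant matrices, grades and norms\<close>

text \<open>Each nonlinear equation is solved for the value \<open>K\<close> of its linear part, not
  for the unknown matrices: the explicit right inverse turns \<open>K\<close> into the matrices, and
  the equation becomes a fixed point problem in the space of pencils. Both linear systems are
  underdetermined, and choosing one right inverse settles that freedom. Comparing coefficients gives
  one-step recurrences, so the right inverse sums at most \<open>min \<epsilon> \<eta>\<close>
  (respectively \<open>k\<close>) shifted copies of each coefficient matrix; its norm is at most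
  \<open>sqrt 2\<close> times that number and grows only linearly in \<open>d\<close>. The exponent
  5/2 splits accordingly: one factor \<open>d\<close> bounds the growth of the off-diagonal
  perturbation while the (2,2) block is removed, one is the norm of the second right inverse, and
  the square root comes from multiplying by the two \<open>\<Lambda>\<close>. All smallness
  conditions are checked against 43/250, a rational upper bound of \<open>(sqrt 2 - 1)^2\<close>.
  Constant transformations serve every conclusion at once: they commute with reversal and preserve
  degrees of vectors, which unimodular ones need not do.\<close>

definition const_mat :: "'a::zero mat \<Rightarrow> 'a poly mat" where
  "const_mat A = map_mat (\<lambda>a. [:a:]) A"

lemma const_mat_dim [simp]:
  "dim_row (const_mat A) = dim_row A" "dim_col (const_mat A) = dim_col A"
  by (simp_all add: const_mat_def)

lemma const_mat_carrier [simp]: "const_mat A \<in> carrier_mat r c \<longleftrightarrow> A \<in> carrier_mat r c"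
  unfolding carrier_mat_def by simp

lemma const_mat_index [simp]:
  "i < dim_row A \<Longrightarrow> j < dim_col A \<Longrightarrow> const_mat A $$ (i, j) = [:A $$ (i, j):]"
  by (simp add: const_mat_def)

lemma const_mat_zero [simp]: "const_mat (0\<^sub>m r c) = 0\<^sub>m r c"
  by (intro eq_matI) auto

lemma const_mat_one [simp]: "const_mat (1\<^sub>m r :: 'a::comm_semiring_1 mat) = 1\<^sub>m r"
  by (intro eq_matI) (auto simp: one_pCons)

lemma const_mat_add:
  "A \<in> carrier_mat r c \<Longrightarrow> B \<in> carrier_mat r c \<Longrightarrow> const_mat (A + B) = const_mat A + const_mat B"
  by (intro eq_matI) auto

lemma const_mat_minus:
  fixes A B :: "'a::ab_group_add mat"
  shows "A \<in> carrier_mat r c \<Longrightarrow> B \<in> carrier_mat r c \<Longrightarrow> const_mat (A - B) = const_mat A - const_mat B"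
  by (intro eq_matI) auto

lemma const_mat_transpose: "const_mat A\<^sup>T = (const_mat A)\<^sup>T"
  by (intro eq_matI) auto

lemma sum_const_poly: "(\<Sum>x\<in>S. [:f x:]) = [:\<Sum>x\<in>S. f x:]"
  by (induction S rule: infinite_finite_induct) auto

lemma const_mat_mult:
  fixes A B :: "'a::comm_semiring_0 mat"
  assumes "A \<in> carrier_mat r l" "B \<in> carrier_mat l c"
  shows "const_mat (A * B) = const_mat A * const_mat B"
  using assms by (intro eq_matI) (auto simp: scalar_prod_def sum_const_poly mult_ac)

lemma const_mat_four_block:
  assumes "A \<in> carrier_mat r1 c1" "B \<in> carrier_mat r1 c2" "C \<in> carrier_mat r2 c1" "D \<in> carrier_mat r2 c2"
  shows "const_mat (four_block_mat A B C D) =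
    four_block_mat (const_mat A) (const_mat B) (const_mat C) (const_mat D)"
  unfolding const_mat_def by (rule map_four_block_mat[OF assms])

lemma has_grade_iff:
  "has_grade d R \<longleftrightarrow> (\<forall>i<dim_row R. \<forall>j<dim_col R. degree (R $$ (i, j)) \<le> d)"
  by (auto simp: has_grade_def elements_mat_def)

lemma has_grade_coeff:
  assumes "has_grade d R" "i < dim_row R" "j < dim_col R" "d < k"
  shows "coeff (R $$ (i, j)) k = 0"
proof -
  have "degree (R $$ (i, j)) < k"
    using assms by (auto simp: has_grade_iff intro: order.strict_trans1)
  then show ?thesis by (rule coeff_eq_0)
qed

lemma has_grade_add:
  fixes R S :: "'a::ab_group_add poly mat"
  assumes "R \<in> carrier_mat r c" "S \<in> carrier_mat r c" "has_grade d R" "has_grade d S"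
  shows "has_grade d (R + S)"
  using assms by (auto simp: has_grade_iff intro: degree_add_le)

lemma has_grade_uminus [simp]:
  fixes R :: "'a::ab_group_add poly mat"
  shows "has_grade d (- R) \<longleftrightarrow> has_grade d R"
  by (auto simp: has_grade_iff)

lemma has_grade_minus:
  fixes R S :: "'a::ab_group_add poly mat"
  assumes "R \<in> carrier_mat r c" "S \<in> carrier_mat r c" "has_grade d R" "has_grade d S"
  shows "has_grade d (R - S)"
  using assms by (auto simp: has_grade_iff intro: degree_diff_le)

lemma has_grade_transpose [simp]: "has_grade d R\<^sup>T \<longleftrightarrow> has_grade d R"
  by (auto simp: has_grade_iff)

lemma has_grade_zero [simp]: "has_grade d (0\<^sub>m r c)"
  by (auto simp: has_grade_iff)

lemma has_grade_const [simp]: "has_grade d (const_mat A)"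
  by (auto simp: has_grade_iff)

lemma has_grade_mult:
  fixes R S :: "'a::comm_semiring_0 poly mat"
  assumes "R \<in> carrier_mat r l" "S \<in> carrier_mat l c" "has_grade a R" "has_grade b S"
  shows "has_grade (a + b) (R * S)"
  unfolding has_grade_iff
proof (intro allI impI)
  fix i j assume "i < dim_row (R * S)" "j < dim_col (R * S)"
  then have ij: "i < r" "j < c" using assms by auto
  have "degree (R $$ (i, k) * S $$ (k, j)) \<le> a + b" if "k < l" for k
  proof -
    have "degree (R $$ (i, k)) \<le> a" "degree (S $$ (k, j)) \<le> b"
      using assms ij that by (auto simp: has_grade_iff)
    then show ?thesis using degree_mult_le[of "R $$ (i, k)" "S $$ (k, j)"] by simp
  qed
  then show "degree ((R * S) $$ (i, j)) \<le> a + b"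
    using assms ij by (auto simp: scalar_prod_def intro!: degree_sum_le)
qed

lemma has_grade_const_mult:
  fixes R :: "'a::comm_semiring_0 poly mat"
  assumes "A \<in> carrier_mat r l" "R \<in> carrier_mat l c" "has_grade d R"
  shows "has_grade d (const_mat A * R)"
  using has_grade_mult[of "const_mat A" r l R c 0 d] assms by simp

lemma has_grade_mult_const:
  fixes R :: "'a::comm_semiring_0 poly mat"
  assumes "R \<in> carrier_mat r l" "A \<in> carrier_mat l c" "has_grade d R"
  shows "has_grade d (R * const_mat A)"
  using has_grade_mult[of R r l "const_mat A" c d 0] assms by simp

lemma has_grade_four_block:
  assumes "A \<in> carrier_mat r1 c1" "B \<in> carrier_mat r1 c2" "C \<in> carrier_mat r2 c1" "D \<in> carrier_mat r2 c2"
  shows "has_grade d (four_block_mat A B C D) \<longleftrightarrow>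
    has_grade d A \<and> has_grade d B \<and> has_grade d C \<and> has_grade d D" (is "?l = ?r")
proof
  assume l: ?l
  have ix: "degree (four_block_mat A B C D $$ (i, j)) \<le> d" if "i < r1 + r2" "j < c1 + c2" for i j
    using l that assms by (auto simp: has_grade_iff)
  have "degree (A $$ (i, j)) \<le> d" if "i < r1" "j < c1" for i j
    using ix[of i j] that assms by auto
  moreover have "degree (B $$ (i, j)) \<le> d" if "i < r1" "j < c2" for i j
    using ix[of i "c1 + j"] that assms by auto
  moreover have "degree (C $$ (i, j)) \<le> d" if "i < r2" "j < c1" for i j
    using ix[of "r1 + i" j] that assms by auto
  moreover have "degree (D $$ (i, j)) \<le> d" if "i < r2" "j < c2" for i j
    using ix[of "r1 + i" "c1 + j"] that assms by auto
  ultimately show ?r using assms by (auto simp: has_grade_iff)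
next
  assume ?r
  then show ?l using assms by (auto simp: has_grade_iff)
qed

section \<open>Frobenius norms of constant matrices and of matrix polynomials\<close>

lemma frob_norm_eq_L2:
  assumes "A \<in> carrier_mat r c"
  shows "frob_norm A = L2_set (\<lambda>p. norm (A $$ p)) ({..<r} \<times> {..<c})"
  using assms by (simp add: frob_norm_def L2_set_def sum.cartesian_product split_def)

lemma frob_norm_nonneg [simp]: "0 \<le> frob_norm A"
  by (simp add: frob_norm_def sum_nonneg)

lemma frob_norm_triangle:
  assumes "A \<in> carrier_mat r c" "B \<in> carrier_mat r c"
  shows "frob_norm (A + B) \<le> frob_norm A + frob_norm B"
proof -
  have "frob_norm (A + B) = L2_set (\<lambda>p. norm (A $$ p + B $$ p)) ({..<r} \<times> {..<c})"
    using assms by (subst frob_norm_eq_L2[of _ r c]) (auto intro!: L2_set_cong)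
  also have "\<dots> \<le> L2_set (\<lambda>p. norm (A $$ p) + norm (B $$ p)) ({..<r} \<times> {..<c})"
    by (intro L2_set_mono norm_triangle_ineq norm_ge_zero)
  also have "\<dots> \<le> frob_norm A + frob_norm B"
    using L2_set_triangle_ineq assms by (simp add: frob_norm_eq_L2[of _ r c])
  finally show ?thesis .
qed

lemma frob_norm_uminus [simp]: "frob_norm (- A) = frob_norm A"
  by (simp add: frob_norm_def)

lemma frob_norm_transpose [simp]: "frob_norm A\<^sup>T = frob_norm A"
proof -
  have "(\<Sum>i<dim_col A. \<Sum>j<dim_row A. (norm (A $$ (j, i)))\<^sup>2) = (\<Sum>j<dim_row A. \<Sum>i<dim_col A. (norm (A $$ (j, i)))\<^sup>2)"
    by (rule sum.swap)
  then show ?thesis by (simp add: frob_norm_def)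
qed

lemma frob_norm_zero [simp]: "frob_norm (0\<^sub>m r c) = 0"
  by (simp add: frob_norm_def)

text \<open>Cauchy-Schwarz bounds the square of each entry of the product by a row sum of
  \<open>A\<close> times a column sum of \<open>B\<close>; summed over all entries, this double sum
  factorizes.\<close>

lemma frob_norm_mult:
  fixes A B :: "'a::real_normed_field mat"
  assumes A: "A \<in> carrier_mat r l" and B: "B \<in> carrier_mat l c"
  shows "frob_norm (A * B) \<le> frob_norm A * frob_norm B"
proof -
  have e: "(norm ((A * B) $$ (i, j)))\<^sup>2 \<le> (\<Sum>k<l. (norm (A $$ (i, k)))\<^sup>2) * (\<Sum>k<l. (norm (B $$ (k, j)))\<^sup>2)"
    if "i < r" "j < c" for i j
  proof -
    have "norm ((A * B) $$ (i, j)) \<le> (\<Sum>k<l. norm (A $$ (i, k)) * norm (B $$ (k, j)))"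
      using that A B norm_sum[of "\<lambda>k. A $$ (i, k) * B $$ (k, j)" "{..<l}"]
      by (simp add: scalar_prod_def norm_mult atLeast0LessThan)
    then have "(norm ((A * B) $$ (i, j)))\<^sup>2 \<le> (\<Sum>k<l. norm (A $$ (i, k)) * norm (B $$ (k, j)))\<^sup>2"
      by (intro power_mono) auto
    also have "\<dots> \<le> (\<Sum>k<l. (norm (A $$ (i, k)))\<^sup>2) * (\<Sum>k<l. (norm (B $$ (k, j)))\<^sup>2)"
      by (rule Cauchy_Schwarz_ineq_sum)
    finally show ?thesis .
  qed
  have "(\<Sum>i<r. \<Sum>j<c. (norm ((A * B) $$ (i, j)))\<^sup>2)
      \<le> (\<Sum>i<r. \<Sum>j<c. (\<Sum>k<l. (norm (A $$ (i, k)))\<^sup>2) * (\<Sum>k<l. (norm (B $$ (k, j)))\<^sup>2))"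
    by (intro sum_mono e) auto
  also have "\<dots> = (\<Sum>i<r. \<Sum>k<l. (norm (A $$ (i, k)))\<^sup>2) * (\<Sum>j<c. \<Sum>k<l. (norm (B $$ (k, j)))\<^sup>2)"
    by (rule sum_product[symmetric])
  also have "(\<Sum>j<c. \<Sum>k<l. (norm (B $$ (k, j)))\<^sup>2) = (\<Sum>k<l. \<Sum>j<c. (norm (B $$ (k, j)))\<^sup>2)"
    by (rule sum.swap)
  finally have "frob_norm (A * B) \<le> sqrt ((\<Sum>i<r. \<Sum>k<l. (norm (A $$ (i, k)))\<^sup>2) * (\<Sum>k<l. \<Sum>j<c. (norm (B $$ (k, j)))\<^sup>2))"
    using A B by (auto simp: frob_norm_def)
  then show ?thesis using A B by (auto simp: frob_norm_def real_sqrt_mult)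
qed

lemma coeff_mat_dim [simp]:
  "dim_row (coeff_mat R k) = dim_row R" "dim_col (coeff_mat R k) = dim_col R"
  by (simp_all add: coeff_mat_def)

lemma coeff_mat_carrier [simp]: "coeff_mat R k \<in> carrier_mat r c \<longleftrightarrow> R \<in> carrier_mat r c"
  unfolding carrier_mat_def by simp

lemma coeff_mat_index [simp]:
  "i < dim_row R \<Longrightarrow> j < dim_col R \<Longrightarrow> coeff_mat R k $$ (i, j) = coeff (R $$ (i, j)) k"
  by (simp add: coeff_mat_def)

lemma has_grade_mat_degree: "has_grade (mat_degree R) R"
proof -
  have "finite (elements_mat R)" by (simp add: elements_mat_def)
  then show ?thesis by (auto simp: has_grade_def mat_degree_def)
qed

lemma mat_degree_le:
  assumes "has_grade d R"
  shows "mat_degree R \<le> d"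
proof -
  have "finite (elements_mat R)" by (simp add: elements_mat_def)
  then show ?thesis using assms by (auto simp: has_grade_def mat_degree_def)
qed

text \<open>Coefficients beyond \<open>mat_degree\<close> vanish, so the sum may run up to any
  grade. Norms of several matrix polynomials of different degrees can thus be compared over one
  index range.\<close>

lemma frob_norm_poly_eq_L2:
  assumes "has_grade d R"
  shows "frob_norm_poly R = L2_set (\<lambda>k. frob_norm (coeff_mat R k)) {..d}"
proof -
  have "coeff_mat R k = 0\<^sub>m (dim_row R) (dim_col R)" if "k > mat_degree R" for k
    using has_grade_mat_degree[of R] that by (intro eq_matI) (auto simp: has_grade_coeff)
  then have "(\<Sum>k\<le>mat_degree R. (frob_norm (coeff_mat R k))\<^sup>2) = (\<Sum>k\<le>d. (frob_norm (coeff_mat R k))\<^sup>2)"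
    using mat_degree_le[OF assms] by (intro sum.mono_neutral_left) auto
  then show ?thesis by (simp add: frob_norm_poly_def L2_set_def)
qed

lemma frob_norm_poly_nonneg [simp]: "0 \<le> frob_norm_poly R"
  by (simp add: frob_norm_poly_def sum_nonneg)

lemma frob_norm_poly_const [simp]: "frob_norm_poly (const_mat A) = frob_norm A"
proof -
  have "coeff_mat (const_mat A) 0 = A" by (intro eq_matI) auto
  then show ?thesis by (subst frob_norm_poly_eq_L2[of 0]) (auto simp: L2_set_def)
qed

lemma frob_norm_poly_pos:
  assumes "R \<in> carrier_mat r c" "R \<noteq> 0\<^sub>m r c"
  shows "0 < frob_norm_poly R"
proof (rule ccontr)
  assume "\<not> ?thesis"
  then have "L2_set (\<lambda>k. frob_norm (coeff_mat R k)) {..mat_degree R} = 0"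
    using frob_norm_poly_nonneg[of R] frob_norm_poly_eq_L2[OF has_grade_mat_degree, of R] by linarith
  then have *: "frob_norm (coeff_mat R k) = 0" if "k \<le> mat_degree R" for k
    using that by (simp add: L2_set_eq_0_iff)
  have "coeff (R $$ (i, j)) k = 0" if "i < r" "j < c" for i j k
  proof (cases "k \<le> mat_degree R")
    case True
    have "L2_set (\<lambda>p. norm (coeff_mat R k $$ p)) ({..<r} \<times> {..<c}) = 0"
      using *[OF True] assms by (simp add: frob_norm_eq_L2[of _ r c])
    then show ?thesis using that assms by (auto simp: L2_set_eq_0_iff)
  next
    case False
    then show ?thesis using has_grade_coeff[OF has_grade_mat_degree[of R]] that assms by auto
  qed
  then have "R = 0\<^sub>m r c" using assms by (intro eq_matI) (auto simp: poly_eq_iff)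
  then show False using assms by simp
qed

lemma frob_norm_poly_uminus [simp]:
  fixes R :: "'a::real_normed_vector poly mat"
  shows "frob_norm_poly (- R) = frob_norm_poly R"
proof -
  have "coeff_mat (- R) k = - coeff_mat R k" for k by (intro eq_matI) auto
  then show ?thesis
    by (simp add: frob_norm_poly_eq_L2[of "mat_degree R"] has_grade_mat_degree)
qed

lemma frob_norm_poly_transpose [simp]: "frob_norm_poly R\<^sup>T = frob_norm_poly R"
proof -
  have "coeff_mat R\<^sup>T k = (coeff_mat R k)\<^sup>T" for k by (intro eq_matI) auto
  then show ?thesis
    by (simp add: frob_norm_poly_eq_L2[of "mat_degree R"] has_grade_mat_degree)
qed

lemma has_grade_mono: "has_grade d R \<Longrightarrow> d \<le> e \<Longrightarrow> has_grade e R"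
  by (auto simp: has_grade_def)

lemma frob_norm_poly_triangle:
  fixes R S :: "'a::real_normed_vector poly mat"
  assumes "R \<in> carrier_mat r c" "S \<in> carrier_mat r c"
  shows "frob_norm_poly (R + S) \<le> frob_norm_poly R + frob_norm_poly S"
proof -
  define d where "d = max (mat_degree R) (mat_degree S)"
  have d: "has_grade d R" "has_grade d S"
    by (auto simp: d_def intro: has_grade_mono[OF has_grade_mat_degree])
  have c: "coeff_mat (R + S) k = coeff_mat R k + coeff_mat S k" for k
    using assms by (intro eq_matI) auto
  have "frob_norm_poly (R + S) = L2_set (\<lambda>k. frob_norm (coeff_mat R k + coeff_mat S k)) {..d}"
    using d assms by (simp add: frob_norm_poly_eq_L2[of d] has_grade_add[of R r c S] c)
  also have "\<dots> \<le> L2_set (\<lambda>k. frob_norm (coeff_mat R k) + frob_norm (coeff_mat S k)) {..d}"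
    using assms by (intro L2_set_mono frob_norm_triangle[of _ r c]) auto
  also have "\<dots> \<le> frob_norm_poly R + frob_norm_poly S"
    using d L2_set_triangle_ineq by (simp add: frob_norm_poly_eq_L2[of d])
  finally show ?thesis .
qed

lemma frob_norm_poly_triangle_minus:
  fixes R S :: "'a::real_normed_vector poly mat"
  assumes "R \<in> carrier_mat r c" "S \<in> carrier_mat r c"
  shows "frob_norm_poly (R - S) \<le> frob_norm_poly R + frob_norm_poly S"
proof -
  have "R - S = R + - S" using assms by (intro eq_matI) auto
  then show ?thesis using frob_norm_poly_triangle[of R r c "- S"] assms by simp
qed

lemma frob_norm_poly_const_mult:
  fixes R :: "'a::real_normed_field poly mat"
  assumes A: "A \<in> carrier_mat r l" and R: "R \<in> carrier_mat l c"
  shows "frob_norm_poly (const_mat A * R) \<le> frob_norm A * frob_norm_poly R"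
proof -
  define d where "d = mat_degree R"
  have d: "has_grade d R" by (simp add: d_def has_grade_mat_degree)
  have c: "coeff_mat (const_mat A * R) k = A * coeff_mat R k" for k
    using assms by (intro eq_matI) (auto simp: scalar_prod_def coeff_sum)
  have "frob_norm_poly (const_mat A * R) = L2_set (\<lambda>k. frob_norm (A * coeff_mat R k)) {..d}"
    using has_grade_const_mult[OF A R d] by (simp add: frob_norm_poly_eq_L2[of d] c)
  also have "\<dots> \<le> L2_set (\<lambda>k. frob_norm A * frob_norm (coeff_mat R k)) {..d}"
    using assms by (intro L2_set_mono frob_norm_mult) auto
  also have "\<dots> = frob_norm A * frob_norm_poly R"
    using d by (simp add: frob_norm_poly_eq_L2[of d] L2_set_right_distrib)
  finally show ?thesis .
qed

lemma frob_norm_poly_mult_const: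
  fixes R :: "'a::real_normed_field poly mat"
  assumes R: "R \<in> carrier_mat r l" and A: "A \<in> carrier_mat l c"
  shows "frob_norm_poly (R * const_mat A) \<le> frob_norm_poly R * frob_norm A"
proof -
  have "(R * const_mat A)\<^sup>T = const_mat A\<^sup>T * R\<^sup>T"
    using transpose_mult[OF R, of "const_mat A" c] A by (simp add: const_mat_transpose)
  then have "frob_norm_poly (R * const_mat A) = frob_norm_poly (const_mat A\<^sup>T * R\<^sup>T)"
    using frob_norm_poly_transpose[of "R * const_mat A"] by simp
  then show ?thesis using frob_norm_poly_const_mult[of "A\<^sup>T" c l "R\<^sup>T" r] R A
    by (simp add: mult.commute)
qed

lemma sq_frob_norm_poly_eq_sum:
  assumes "R \<in> carrier_mat r c" "has_grade d R"
  shows "(frob_norm_poly R)\<^sup>2 = (\<Sum>k\<le>d. \<Sum>i<r. \<Sum>j<c. (norm (coeff (R $$ (i, j)) k))\<^sup>2)"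
proof -
  have "(frob_norm_poly R)\<^sup>2 = (\<Sum>k\<le>d. (frob_norm (coeff_mat R k))\<^sup>2)"
    using assms by (simp add: frob_norm_poly_eq_L2[of d] L2_set_def sum_nonneg)
  moreover have "(frob_norm (coeff_mat R k))\<^sup>2 = (\<Sum>i<r. \<Sum>j<c. (norm (coeff (R $$ (i, j)) k))\<^sup>2)" for k
  proof -
    have "(frob_norm (coeff_mat R k))\<^sup>2 = (\<Sum>i<r. \<Sum>j<c. (norm (coeff_mat R k $$ (i, j)))\<^sup>2)"
      using assms(1) by (simp add: frob_norm_def sum_nonneg)
    also have "\<dots> = (\<Sum>i<r. \<Sum>j<c. (norm (coeff (R $$ (i, j)) k))\<^sup>2)"
      using assms(1) by (intro sum.cong refl) simp
    finally show ?thesis .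
  qed
  ultimately show ?thesis by simp
qed

lemma frob_norm_poly_four_block:
  assumes "A \<in> carrier_mat r1 c1" "B \<in> carrier_mat r1 c2" "C \<in> carrier_mat r2 c1" "D \<in> carrier_mat r2 c2"
  shows "(frob_norm_poly (four_block_mat A B C D))\<^sup>2 =
    (frob_norm_poly A)\<^sup>2 + (frob_norm_poly B)\<^sup>2 + (frob_norm_poly C)\<^sup>2 + (frob_norm_poly D)\<^sup>2"
proof -
  define F where "F = four_block_mat A B C D"
  define d where "d = mat_degree F"
  have F: "F \<in> carrier_mat (r1 + r2) (c1 + c2)" unfolding F_def using assms by auto
  have d: "has_grade d F" by (simp add: d_def has_grade_mat_degree)
  then have d': "has_grade d A" "has_grade d B" "has_grade d C" "has_grade d D"
    using has_grade_four_block[OF assms] by (auto simp: F_def)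
  have split: "(\<Sum>i<a + b. f i) = (\<Sum>i<a. f i) + (\<Sum>i<b. f (a + i))" for f :: "nat \<Rightarrow> real" and a b
    by (induction b) (simp_all add: add.assoc)
  let ?s = "\<lambda>k p. (norm (coeff (F $$ p) k))\<^sup>2"
  have "(frob_norm_poly F)\<^sup>2 = (\<Sum>k\<le>d. \<Sum>i<r1. \<Sum>j<c1. ?s k (i, j)) + (\<Sum>k\<le>d. \<Sum>i<r1. \<Sum>j<c2. ?s k (i, c1 + j))
     + (\<Sum>k\<le>d. \<Sum>i<r2. \<Sum>j<c1. ?s k (r1 + i, j)) + (\<Sum>k\<le>d. \<Sum>i<r2. \<Sum>j<c2. ?s k (r1 + i, c1 + j))"
    unfolding sq_frob_norm_poly_eq_sum[OF F d] split sum.distrib by (simp only: add.assoc)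
  also have "(\<Sum>k\<le>d. \<Sum>i<r1. \<Sum>j<c1. ?s k (i, j)) = (frob_norm_poly A)\<^sup>2"
    unfolding sq_frob_norm_poly_eq_sum[OF assms(1) d'(1)] using assms
    by (intro sum.cong refl) (simp add: F_def)
  also have "(\<Sum>k\<le>d. \<Sum>i<r1. \<Sum>j<c2. ?s k (i, c1 + j)) = (frob_norm_poly B)\<^sup>2"
    unfolding sq_frob_norm_poly_eq_sum[OF assms(2) d'(2)] using assms
    by (intro sum.cong refl) (simp add: F_def)
  also have "(\<Sum>k\<le>d. \<Sum>i<r2. \<Sum>j<c1. ?s k (r1 + i, j)) = (frob_norm_poly C)\<^sup>2"
    unfolding sq_frob_norm_poly_eq_sum[OF assms(3) d'(3)] using assms
    by (intro sum.cong refl) (simp add: F_def)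
  also have "(\<Sum>k\<le>d. \<Sum>i<r2. \<Sum>j<c2. ?s k (r1 + i, c1 + j)) = (frob_norm_poly D)\<^sup>2"
    unfolding sq_frob_norm_poly_eq_sum[OF assms(4) d'(4)] using assms
    by (intro sum.cong refl) (simp add: F_def)
  finally show ?thesis by (simp add: F_def)
qed

lemma frob_norm_poly_four_block_le:
  assumes "A \<in> carrier_mat r1 c1" "B \<in> carrier_mat r1 c2" "C \<in> carrier_mat r2 c1" "D \<in> carrier_mat r2 c2"
  defines "f \<equiv> frob_norm_poly (four_block_mat A B C D)"
  shows "frob_norm_poly A \<le> f" "frob_norm_poly B \<le> f" "frob_norm_poly C \<le> f" "frob_norm_poly D \<le> f"
proof -
  have "x \<le> f" if "x\<^sup>2 \<le> f\<^sup>2" for x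
    using power2_le_imp_le[OF that] by (simp add: f_def)
  then show "frob_norm_poly A \<le> f" "frob_norm_poly B \<le> f" "frob_norm_poly C \<le> f" "frob_norm_poly D \<le> f"
    using frob_norm_poly_four_block[OF assms(1-4)] unfolding f_def by auto
qed

text \<open>Together with \<open>frob_norm_poly_le_sum\<close> this makes norm convergence and
  coefficientwise convergence equivalent for fixed size and grade, which is how completeness enters
  \<open>pencil_fixed_point\<close>.\<close>

lemma norm_coeff_le_frob_norm_poly:
  assumes R: "R \<in> carrier_mat r c" and ij: "i < r" "j < c"
  shows "norm (coeff (R $$ (i, j)) k) \<le> frob_norm_poly R"
proof -
  define d where "d = max k (mat_degree R)"
  have d: "has_grade d R" by (auto simp: d_def intro: has_grade_mono[OF has_grade_mat_degree])
  have "(norm (coeff (R $$ (i, j)) k))\<^sup>2 \<le> (\<Sum>j<c. (norm (coeff (R $$ (i, j)) k))\<^sup>2)"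
    using ij by (intro member_le_sum) auto
  also have "\<dots> \<le> (\<Sum>i<r. \<Sum>j<c. (norm (coeff (R $$ (i, j)) k))\<^sup>2)"
    using ij by (intro member_le_sum[of i _ "\<lambda>i. \<Sum>j<c. (norm (coeff (R $$ (i, j)) k))\<^sup>2"]) (auto simp: sum_nonneg)
  also have "\<dots> \<le> (\<Sum>k\<le>d. \<Sum>i<r. \<Sum>j<c. (norm (coeff (R $$ (i, j)) k))\<^sup>2)"
    by (intro member_le_sum[of k _ "\<lambda>k. \<Sum>i<r. \<Sum>j<c. (norm (coeff (R $$ (i, j)) k))\<^sup>2"])
      (auto simp: sum_nonneg d_def)
  also have "\<dots> = (frob_norm_poly R)\<^sup>2" by (rule sq_frob_norm_poly_eq_sum[OF R d, symmetric])
  finally show ?thesis by (rule power2_le_imp_le) simp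
qed

lemma frob_norm_poly_le_sum:
  assumes R: "R \<in> carrier_mat r c" and d: "has_grade d R"
  shows "frob_norm_poly R \<le> (\<Sum>k\<le>d. \<Sum>p\<in>{..<r} \<times> {..<c}. norm (coeff (R $$ p) k))"
proof -
  have "frob_norm_poly R = L2_set (\<lambda>k. frob_norm (coeff_mat R k)) {..d}"
    by (rule frob_norm_poly_eq_L2[OF d])
  also have "\<dots> \<le> (\<Sum>k\<le>d. frob_norm (coeff_mat R k))" by (rule L2_set_le_sum) simp
  also have "\<dots> \<le> (\<Sum>k\<le>d. \<Sum>p\<in>{..<r} \<times> {..<c}. norm (coeff (R $$ p) k))"
  proof (intro sum_mono)
    fix k
    have "frob_norm (coeff_mat R k) = L2_set (\<lambda>p. norm (coeff_mat R k $$ p)) ({..<r} \<times> {..<c})"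
      using R by (intro frob_norm_eq_L2) simp
    also have "\<dots> \<le> (\<Sum>p\<in>{..<r} \<times> {..<c}. norm (coeff_mat R k $$ p))" by (rule L2_set_le_sum) simp
    also have "\<dots> = (\<Sum>p\<in>{..<r} \<times> {..<c}. norm (coeff (R $$ p) k))"
      using R by (intro sum.cong refl) auto
    finally show "frob_norm (coeff_mat R k) \<le> (\<Sum>p\<in>{..<r} \<times> {..<c}. norm (coeff (R $$ p) k))" .
  qed
  finally show ?thesis .
qed

section \<open>The contraction principle for pencils\<close>

text \<open>Reduced to the real coordinates with respect to \<open>Basis\<close>: in each of them
  the telescoping series of the steps is dominated by a geometric series.\<close>

lemma convergent_of_geometric_steps:
  fixes a :: "nat \<Rightarrow> 'a::euclidean_space"
  assumes "\<And>k. norm (a (Suc k) - a k) \<le> q ^ k * D" "0 \<le> q" "q < 1"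
  shows "convergent a"
proof -
  have *: "summable (\<lambda>k. q ^ k * D)" using assms by (intro summable_mult2 summable_geometric) simp
  have "\<exists>l. (\<lambda>n. a n \<bullet> b) \<longlonglongrightarrow> l" if b: "b \<in> Basis" for b
  proof -
    have "norm (a (Suc k) \<bullet> b - a k \<bullet> b) \<le> q ^ k * D" for k
      using Basis_le_norm[OF b, of "a (Suc k) - a k"] assms(1)[of k] by (simp add: inner_diff_left)
    then have "summable (\<lambda>k. a (Suc k) \<bullet> b - a k \<bullet> b)" by (rule summable_comparison_test'[OF *, of 0])
    then have "(\<lambda>n. \<Sum>k<n. a (Suc k) \<bullet> b - a k \<bullet> b) \<longlonglongrightarrow> (\<Sum>k. a (Suc k) \<bullet> b - a k \<bullet> b)"
      by (rule summable_LIMSEQ)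
    then have "(\<lambda>n. a n \<bullet> b - a 0 \<bullet> b) \<longlonglongrightarrow> (\<Sum>k. a (Suc k) \<bullet> b - a k \<bullet> b)"
      by (simp add: sum_lessThan_telescope[of "\<lambda>k. a k \<bullet> b"])
    then have "(\<lambda>n. a n \<bullet> b - a 0 \<bullet> b + a 0 \<bullet> b) \<longlonglongrightarrow> (\<Sum>k. a (Suc k) \<bullet> b - a k \<bullet> b) + a 0 \<bullet> b"
      by (intro tendsto_add tendsto_const)
    then show ?thesis by auto
  qed
  then obtain l where l: "(\<lambda>n. a n \<bullet> b) \<longlonglongrightarrow> l b" if "b \<in> Basis" for b by metis
  have "(\<lambda>n. \<Sum>b\<in>Basis. (a n \<bullet> b) *\<^sub>R b) \<longlonglongrightarrow> (\<Sum>b\<in>Basis. l b *\<^sub>R b)"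
    by (intro tendsto_sum tendsto_scaleR tendsto_const l)
  then show ?thesis by (auto simp: convergent_def euclidean_representation)
qed

text \<open>Banach's argument on a closed ball of pencils of fixed size. The Picard iterates from
  zero have geometrically decreasing steps, hence each of their finitely many coefficients
  converges, and the coefficientwise limit is also a limit in norm.\<close>

lemma pencil_fixed_point:
  fixes \<Phi> :: "'a::euclidean_space poly mat \<Rightarrow> 'a poly mat"
    and r c :: nat and \<rho> q :: real
  defines "S \<equiv> {R \<in> carrier_mat r c. has_grade 1 R \<and> frob_norm_poly R \<le> \<rho>}"
  assumes maps: "\<And>R. R \<in> S \<Longrightarrow> \<Phi> R \<in> S"
    and lip: "\<And>R R'. R \<in> S \<Longrightarrow> R' \<in> S \<Longrightarrow> frob_norm_poly (\<Phi> R - \<Phi> R') \<le> q * frob_norm_poly (R - R')"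
    and q: "0 \<le> q" "q < 1" and \<rho>: "0 \<le> \<rho>"
  shows "\<exists>R \<in> S. \<Phi> R = R"
proof -
  define X where "X k = (\<Phi> ^^ k) (0\<^sub>m r c)" for k
  have X: "X k \<in> S" for k
  proof (induction k)
    case 0
    have "frob_norm_poly (0\<^sub>m r c :: 'a poly mat) = 0"
      using frob_norm_poly_const[of "0\<^sub>m r c :: 'a mat"] by simp
    then show ?case using \<rho> by (auto simp: X_def S_def)
  next
    case (Suc k)
    then show ?case using maps by (simp add: X_def)
  qed
  have Xc: "X k \<in> carrier_mat r c" "has_grade 1 (X k)" for k using X by (auto simp: S_def)
  define D where "D = frob_norm_poly (X 1 - X 0)"
  have step: "frob_norm_poly (X (Suc k) - X k) \<le> q ^ k * D" for k
  proof (induction k)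
    case (Suc k)
    have "frob_norm_poly (X (Suc (Suc k)) - X (Suc k)) \<le> q * frob_norm_poly (X (Suc k) - X k)"
      using lip[OF X X, of "Suc k" k] by (simp add: X_def)
    also have "\<dots> \<le> q * (q ^ k * D)" using Suc q by (intro mult_left_mono) auto
    finally show ?case by simp
  qed (simp add: D_def)
  have "convergent (\<lambda>k. coeff (X k $$ (i, j)) e)" if "i < r" "j < c" for i j e
  proof (rule convergent_of_geometric_steps[OF _ q])
    fix k
    have "coeff (X (Suc k) $$ (i, j)) e - coeff (X k $$ (i, j)) e = coeff ((X (Suc k) - X k) $$ (i, j)) e"
      using Xc(1)[of k] Xc(1)[of "Suc k"] that by simp
    also have "norm \<dots> \<le> frob_norm_poly (X (Suc k) - X k)"
      using Xc(1)[of k] that by (intro norm_coeff_le_frob_norm_poly[of _ r c]) auto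
    finally show "norm (coeff (X (Suc k) $$ (i, j)) e - coeff (X k $$ (i, j)) e) \<le> q ^ k * D"
      using step[of k] by simp
  qed
  then have "\<exists>l. (\<lambda>k. coeff (X k $$ (i, j)) e) \<longlonglongrightarrow> l" if "i < r" "j < c" for i j e
    using that by (auto simp: convergent_def)
  then obtain l where l: "(\<lambda>k. coeff (X k $$ (i, j)) e) \<longlonglongrightarrow> l i j e" if "i < r" "j < c" for i j e
    by metis
  \<comment> \<open>The iterates have grade 1, so the limits of the coefficients 0 and 1 determine
    the whole limit.\<close>
  define R where "R = mat r c (\<lambda>(i, j). [:l i j 0, l i j 1:])"
  have R: "R \<in> carrier_mat r c" "has_grade 1 R" by (auto simp: R_def has_grade_iff)
  have "(\<lambda>k. \<Sum>e\<le>1. \<Sum>p\<in>{..<r} \<times> {..<c}. norm (coeff ((X k - R) $$ p) e)) \<longlonglongrightarrow>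
      (\<Sum>e\<le>(1::nat). \<Sum>p\<in>{..<r} \<times> {..<c}. norm (0::'a))"
  proof (intro tendsto_sum tendsto_norm)
    fix e :: nat and p assume e: "e \<in> {..1}" and "p \<in> {..<r} \<times> {..<c}"
    then obtain i j where p: "p = (i, j)" "i < r" "j < c" by auto
    have "e = 0 \<or> e = 1" using e by auto
    then have "coeff (R $$ (i, j)) e = l i j e" using p by (auto simp: R_def)
    then have "(\<lambda>k. coeff ((X k - R) $$ p) e) = (\<lambda>k. coeff (X k $$ (i, j)) e - l i j e)"
      using p R Xc by auto
    then show "(\<lambda>k. coeff ((X k - R) $$ p) e) \<longlonglongrightarrow> 0"
      using l[OF p(2,3), of e] by (simp add: LIM_zero)
  qed
  then have lim0: "(\<lambda>k. \<Sum>e\<le>1. \<Sum>p\<in>{..<r} \<times> {..<c}. norm (coeff ((X k - R) $$ p) e)) \<longlonglongrightarrow> 0" by simp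
  have lim: "(\<lambda>k. frob_norm_poly (X k - R)) \<longlonglongrightarrow> 0"
  proof (rule real_tendsto_sandwich[OF _ _ tendsto_const lim0])
    show "\<forall>\<^sub>F k in sequentially. frob_norm_poly (X k - R) \<le>
      (\<Sum>e\<le>1. \<Sum>p\<in>{..<r} \<times> {..<c}. norm (coeff ((X k - R) $$ p) e))"
      using R Xc by (intro always_eventually allI frob_norm_poly_le_sum has_grade_minus[of _ r c]) auto
  qed simp
  have "frob_norm_poly R \<le> \<rho> + frob_norm_poly (X k - R)" for k
  proof -
    have "R = X k - (X k - R)" using R Xc(1)[of k] by (intro eq_matI) auto
    then have "frob_norm_poly R \<le> frob_norm_poly (X k) + frob_norm_poly (X k - R)"
      using frob_norm_poly_triangle_minus[of "X k" r c "X k - R"] Xc(1)[of k]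
        minus_carrier_mat[OF R(1), of "X k"] by auto
    then show ?thesis using X[of k] by (simp add: S_def)
  qed
  then have "frob_norm_poly R \<le> \<rho> + 0"
    by (intro LIMSEQ_le_const[OF tendsto_add[OF tendsto_const lim]]) blast
  then have RS: "R \<in> S" using R by (simp add: S_def)
  then have \<Phi>R: "\<Phi> R \<in> carrier_mat r c" using maps by (simp add: S_def)
  \<comment> \<open>The left-hand side does not depend on \<open>k\<close>, while the right-hand
    side tends to 0.\<close>
  have "frob_norm_poly (\<Phi> R - R) \<le> q * frob_norm_poly (X k - R) + frob_norm_poly (X (Suc k) - R)" for k
  proof -
    have "\<Phi> R - R = (X (Suc k) - R) - (X (Suc k) - \<Phi> R)"
      using \<Phi>R R Xc(1)[of "Suc k"] by (intro eq_matI) auto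
    then have "frob_norm_poly (\<Phi> R - R) \<le> frob_norm_poly (X (Suc k) - R) + frob_norm_poly (X (Suc k) - \<Phi> R)"
      using frob_norm_poly_triangle_minus[of "X (Suc k) - R" r c "X (Suc k) - \<Phi> R"]
        minus_carrier_mat[OF R(1), of "X (Suc k)"] minus_carrier_mat[OF \<Phi>R, of "X (Suc k)"] by auto
    moreover have "frob_norm_poly (X (Suc k) - \<Phi> R) \<le> q * frob_norm_poly (X k - R)"
      using lip[OF X RS, of k] by (simp add: X_def)
    ultimately show ?thesis by simp
  qed
  moreover have "(\<lambda>k. q * frob_norm_poly (X k - R) + frob_norm_poly (X (Suc k) - R)) \<longlonglongrightarrow> q * 0 + 0"
    by (intro tendsto_add tendsto_mult_left lim LIMSEQ_Suc[OF lim])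
  ultimately have "frob_norm_poly (\<Phi> R - R) \<le> q * 0 + 0"
    by (intro LIMSEQ_le_const[of "\<lambda>k. q * frob_norm_poly (X k - R) + frob_norm_poly (X (Suc k) - R)"]) auto
  then have "\<not> 0 < frob_norm_poly (\<Phi> R - R)" by simp
  then have z: "\<Phi> R - R = 0\<^sub>m r c"
    using frob_norm_poly_pos[of "\<Phi> R - R" r c] minus_carrier_mat[OF R(1), of "\<Phi> R"] by auto
  have "\<Phi> R = R"
  proof (rule eq_matI)
    fix i j assume "i < dim_row R" "j < dim_col R"
    then have "(\<Phi> R - R) $$ (i, j) = \<Phi> R $$ (i, j) - R $$ (i, j)" "i < r" "j < c" using R \<Phi>R by auto
    then show "\<Phi> R $$ (i, j) = R $$ (i, j)" using z by simp
  qed (use R \<Phi>R in auto)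
  then show ?thesis using RS by blast
qed

section \<open>Telescoping solutions of the linearized equations\<close>

text \<open>This is \<open>L_pencil k\<close> tensored with an identity matrix (see
  \<open>L_pencil_kron_one\<close>). With the entries given directly, products with constant
  matrices become plain index shifts by one block.\<close>

definition kron_L :: "nat \<Rightarrow> nat \<Rightarrow> 'a::comm_ring_1 poly mat" where
  "kron_L k n = mat (k * n) ((k + 1) * n)
     (\<lambda>(i, j). if j = i then - 1 else if j = i + n then monom 1 1 else 0)"

lemma kron_L_carrier [simp]: "kron_L k n \<in> carrier_mat (k * n) ((k + 1) * n)"
  by (simp add: kron_L_def)

lemma kron_L_dim [simp]: "dim_row (kron_L k n) = k * n" "dim_col (kron_L k n) = (k + 1) * n"
  by (simp_all add: kron_L_def)

lemma L_pencil_kron_one: "L_pencil k \<otimes>\<^sub>m 1\<^sub>m n = kron_L k n"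
proof (rule eq_matI)
  fix i j assume "i < dim_row (kron_L k n :: 'a poly mat)" "j < dim_col (kron_L k n :: 'a poly mat)"
  then have ij: "i < k * n" "j < (k + 1) * n" by simp_all
  have n: "n > 0" using ij by (cases n) auto
  have b: "i div n < k" "j div n < k + 1" using ij n by (simp_all add: less_mult_imp_div_less)
  have e1: "j = i \<longleftrightarrow> i mod n = j mod n \<and> j div n = i div n" by (metis div_mult_mod_eq)
  have e2: "j = i + n \<longleftrightarrow> i mod n = j mod n \<and> j div n = i div n + 1"
  proof
    assume r: "i mod n = j mod n \<and> j div n = i div n + 1"
    have "j = j div n * n + j mod n" by simp
    also have "\<dots> = i div n * n + i mod n + n" using r by simp
    finally show "j = i + n" by simp
  qed (use n in simp)
  have "(L_pencil k \<otimes>\<^sub>m 1\<^sub>m n) $$ (i, j) =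
      L_pencil k $$ (i div n, j div n) * (if i mod n = j mod n then 1 else 0 :: 'a poly)"
    using ij n by (simp add: kron_def L_pencil_def)
  also have "\<dots> = kron_L k n $$ (i, j)"
    using b ij unfolding kron_L_def L_pencil_def by (auto simp: e1 e2)
  finally show "(L_pencil k \<otimes>\<^sub>m 1\<^sub>m n) $$ (i, j) = (kron_L k n :: 'a poly mat) $$ (i, j)" .
qed (auto simp: kron_def L_pencil_def)

lemma kron_transpose:
  assumes "dim_row B > 0" "dim_col B > 0"
  shows "(A \<otimes>\<^sub>m B)\<^sup>T = A\<^sup>T \<otimes>\<^sub>m B\<^sup>T"
proof (rule eq_matI)
  fix i j assume "i < dim_row (A\<^sup>T \<otimes>\<^sub>m B\<^sup>T)" "j < dim_col (A\<^sup>T \<otimes>\<^sub>m B\<^sup>T)"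
  then have "i < dim_col A * dim_col B" "j < dim_row A * dim_row B" by (auto simp: kron_def)
  then show "(A \<otimes>\<^sub>m B)\<^sup>T $$ (i, j) = (A\<^sup>T \<otimes>\<^sub>m B\<^sup>T) $$ (i, j)"
    using assms by (simp add: kron_def less_mult_imp_div_less)
qed (auto simp: kron_def)

text \<open>A row of \<open>kron_L\<close> has two nonzero entries, \<open>n\<close> columns apart;
  so row \<open>i\<close> of \<open>D\<close> enters the constant coefficient and row
  \<open>i + n\<close> the linear one. This block shift produces the recurrences that are solved
  below.\<close>

lemma kron_L_mult_const_index:
  assumes D: "D \<in> carrier_mat ((k + 1) * n) c" and ij: "i < k * n" "j < c"
  shows "(kron_L k n * const_mat D) $$ (i, j) = [:- D $$ (i, j), D $$ (i + n, j):]"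
proof -
  have n: "n > 0" using ij by (cases n) auto
  have i2: "i < (k + 1) * n" "i + n < (k + 1) * n" using ij by auto
  have "(kron_L k n * const_mat D) $$ (i, j) =
      (\<Sum>l<(k + 1) * n. kron_L k n $$ (i, l) * [:D $$ (l, j):])"
    using D ij by (simp add: scalar_prod_def atLeast0LessThan)
  also have "\<dots> = (\<Sum>l<(k + 1) * n. (if l = i then - [:D $$ (l, j):] else 0) +
      (if l = i + n then monom 1 1 * [:D $$ (l, j):] else 0))"
    using n ij by (intro sum.cong refl) (auto simp: kron_L_def)
  also have "\<dots> = - [:D $$ (i, j):] + monom 1 1 * [:D $$ (i + n, j):]"
    unfolding sum.distrib using i2 by simp
  also have "\<dots> = [:- D $$ (i, j), D $$ (i + n, j):]" by (simp add: monom_altdef)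
  finally show ?thesis .
qed

lemma const_mult_kron_L_transpose_index:
  assumes C: "C \<in> carrier_mat r ((k + 1) * m)" and ij: "i < r" "j < k * m"
  shows "(const_mat C * (kron_L k m)\<^sup>T) $$ (i, j) = [:- C $$ (i, j), C $$ (i, j + m):]"
proof -
  have "const_mat C * (kron_L k m)\<^sup>T = (kron_L k m * const_mat C\<^sup>T)\<^sup>T"
    using C transpose_mult[OF kron_L_carrier[of k m], of "const_mat C\<^sup>T" r]
    by (simp add: const_mat_transpose)
  moreover have "(kron_L k m * const_mat C\<^sup>T) $$ (j, i) = [:- C\<^sup>T $$ (j, i), C\<^sup>T $$ (j + m, i):]"
    using C ij by (intro kron_L_mult_const_index[of _ _ _ r]) auto
  ultimately show ?thesis using C ij by simp
qed

text \<open>The last block column of \<open>kron_L\<close> contains no \<open>-1\<close> and the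
  first one no \<open>\<lambda>\<close>; there one of the two terms is missing. These are the
  boundary cases of \<open>comm_solves\<close>.\<close>

lemma const_mult_kron_L_index:
  assumes Z: "Z \<in> carrier_mat r (k * n)" and ij: "i < r" "j < (k + 1) * n"
  shows "(const_mat Z * kron_L k n) $$ (i, j) =
    [:if j < k * n then - Z $$ (i, j) else 0, if n \<le> j then Z $$ (i, j - n) else 0:]"
proof -
  have n: "n > 0" using ij by (cases n) auto
  have "(const_mat Z * kron_L k n) $$ (i, j) = (\<Sum>l<k * n. [:Z $$ (i, l):] * kron_L k n $$ (l, j))"
    using Z ij by (simp add: scalar_prod_def atLeast0LessThan)
  also have "\<dots> = (\<Sum>l<k * n. (if l = j then - [:Z $$ (i, l):] else 0) +
      (if l = j - n then (if n \<le> j then monom 1 1 * [:Z $$ (i, l):] else 0) else 0))"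
    using n ij by (intro sum.cong refl) (auto simp: kron_L_def)
  also have "\<dots> = (if j < k * n then - [:Z $$ (i, j):] else 0) +
      (if n \<le> j then monom 1 1 * [:Z $$ (i, j - n):] else 0)"
    unfolding sum.distrib using ij by auto
  also have "\<dots> = [:if j < k * n then - Z $$ (i, j) else 0, if n \<le> j then Z $$ (i, j - n) else 0:]"
    by (simp add: monom_altdef)
  finally show ?thesis .
qed

text \<open>Extension by zero to all integer positions turns the boundary cases of the telescoping sums
  below into vanishing terms.\<close>

definition zext :: "'a::zero poly mat \<Rightarrow> nat \<Rightarrow> int \<times> int \<Rightarrow> 'a" where
  "zext R e = (\<lambda>(i, j). if 0 \<le> i \<and> i < int (dim_row R) \<and> 0 \<le> j \<and> j < int (dim_col R)
     then coeff (R $$ (nat i, nat j)) e else 0)"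

lemma zext_inside:
  "i < dim_row R \<Longrightarrow> j < dim_col R \<Longrightarrow> zext R e (int i, int j) = coeff (R $$ (i, j)) e"
  by (simp add: zext_def)

lemma zext_outside:
  "i < 0 \<or> int (dim_row R) \<le> i \<or> j < 0 \<or> int (dim_col R) \<le> j \<Longrightarrow> zext R e (i, j) = 0"
  by (auto simp: zext_def)

lemma zext_minus:
  fixes R S :: "'a::ab_group_add poly mat"
  assumes "R \<in> carrier_mat r c" "S \<in> carrier_mat r c"
  shows "zext (R - S) e p = zext R e p - zext S e p"
  using assms by (cases p) (auto simp: zext_def)

text \<open>An injective index map visits each entry of the coefficient matrix at most once, and
  positions outside the matrix contribute nothing.\<close>

lemma L2_set_zext_le:
  assumes "finite S" "inj_on \<phi> S"
  shows "L2_set (\<lambda>p. norm (zext R e (\<phi> p))) S \<le> frob_norm (coeff_mat R e)"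
proof -
  define E where "E = (\<lambda>(i, j). (int i, int j)) ` ({..<dim_row R} \<times> {..<dim_col R})"
  have inj: "inj_on (\<lambda>(i, j). (int i, int j)) ({..<dim_row R} \<times> {..<dim_col R})" by (auto simp: inj_on_def)
  have out: "zext R e q = 0" if "q \<notin> E" for q
  proof (cases q)
    case (Pair a b)
    have False if "0 \<le> a" "a < int (dim_row R)" "0 \<le> b" "b < int (dim_col R)"
    proof -
      have "(a, b) = (\<lambda>(i, j). (int i, int j)) (nat a, nat b)" using that by simp
      moreover have "(nat a, nat b) \<in> {..<dim_row R} \<times> {..<dim_col R}" using that by auto
      ultimately show False using \<open>q \<notin> E\<close> Pair unfolding E_def by blast
    qed
    then show ?thesis using Pair by (auto simp: zext_def)
  qed
  have "(\<Sum>p\<in>S. (norm (zext R e (\<phi> p)))\<^sup>2) = (\<Sum>q\<in>\<phi> ` S. (norm (zext R e q))\<^sup>2)"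
    using assms by (simp add: sum.reindex)
  also have "\<dots> = (\<Sum>q\<in>\<phi> ` S \<inter> E. (norm (zext R e q))\<^sup>2)"
    using assms out by (intro sum.mono_neutral_right) auto
  also have "\<dots> \<le> (\<Sum>q\<in>E. (norm (zext R e q))\<^sup>2)"
    by (intro sum_mono2) (auto simp: E_def)
  also have "\<dots> = (\<Sum>(i, j)\<in>{..<dim_row R} \<times> {..<dim_col R}. (norm (coeff_mat R e $$ (i, j)))\<^sup>2)"
    unfolding E_def using inj by (subst sum.reindex) (auto intro!: sum.cong simp: zext_inside)
  finally show ?thesis
    unfolding L2_set_def frob_norm_def coeff_mat_dim sum.cartesian_product by (rule real_sqrt_le_mono)
qed

lemma L2_set_sum_le:
  fixes f :: "nat \<Rightarrow> 'b \<Rightarrow> real"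
  shows "L2_set (\<lambda>p. \<Sum>t<h. f t p) S \<le> (\<Sum>t<h. L2_set (f t) S)"
proof (induction h)
  case (Suc h)
  have "L2_set (\<lambda>p. \<Sum>t<Suc h. f t p) S \<le> L2_set (\<lambda>p. \<Sum>t<h. f t p) S + L2_set (f h) S"
    by (simp add: L2_set_triangle_ineq)
  then show ?case using Suc by simp
qed (simp add: L2_set_def)

lemma sum_le_sqrt2: "a + b \<le> sqrt 2 * sqrt (a\<^sup>2 + b\<^sup>2)" for a b :: real
proof -
  have "(a + b)\<^sup>2 \<le> 2 * (a\<^sup>2 + b\<^sup>2)"
    using zero_le_power2[of "a - b"] by (simp add: power2_eq_square algebra_simps)
  then have "a + b \<le> sqrt (2 * (a\<^sup>2 + b\<^sup>2))" by (rule real_le_rsqrt)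
  then show ?thesis by (simp only: real_sqrt_mult)
qed

text \<open>Every summand is an injectively shifted copy of a coefficient matrix, so the triangle
  inequality yields \<open>h\<close> times the sum of the two coefficient norms. Passing from this
  sum to the root of the sum of squares costs the factor \<open>sqrt 2\<close>.\<close>

lemma frob_norm_zext_sum_le:
  fixes R :: "'a::real_normed_vector poly mat"
  assumes A: "A \<in> carrier_mat a b" and R: "has_grade 1 R"
    and le: "\<And>i j. i < a \<Longrightarrow> j < b \<Longrightarrow>
      norm (A $$ (i, j)) \<le> (\<Sum>t<h. norm (zext R 0 (\<phi> t (i, j))) + norm (zext R 1 (\<psi> t (i, j))))"
    and inj: "\<And>t. inj_on (\<phi> t) ({..<a} \<times> {..<b})" "\<And>t. inj_on (\<psi> t) ({..<a} \<times> {..<b})"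
  shows "frob_norm A \<le> sqrt 2 * real h * frob_norm_poly R"
proof -
  let ?S = "{..<a} \<times> {..<b}"
  have "frob_norm A = L2_set (\<lambda>p. norm (A $$ p)) ?S" by (rule frob_norm_eq_L2[OF A])
  also have "\<dots> \<le> L2_set (\<lambda>p. \<Sum>t<h. norm (zext R 0 (\<phi> t p)) + norm (zext R 1 (\<psi> t p))) ?S"
    using le by (intro L2_set_mono) auto
  also have "\<dots> \<le> (\<Sum>t<h. L2_set (\<lambda>p. norm (zext R 0 (\<phi> t p)) + norm (zext R 1 (\<psi> t p))) ?S)"
    by (rule L2_set_sum_le)
  also have "\<dots> \<le> (\<Sum>t<h. frob_norm (coeff_mat R 0) + frob_norm (coeff_mat R 1))"
  proof (intro sum_mono)
    fix t
    have "L2_set (\<lambda>p. norm (zext R 0 (\<phi> t p)) + norm (zext R 1 (\<psi> t p))) ?S \<le>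
        L2_set (\<lambda>p. norm (zext R 0 (\<phi> t p))) ?S + L2_set (\<lambda>p. norm (zext R 1 (\<psi> t p))) ?S"
      by (rule L2_set_triangle_ineq)
    also have "\<dots> \<le> frob_norm (coeff_mat R 0) + frob_norm (coeff_mat R 1)"
      by (intro add_mono L2_set_zext_le inj) auto
    finally show "L2_set (\<lambda>p. norm (zext R 0 (\<phi> t p)) + norm (zext R 1 (\<psi> t p))) ?S \<le>
      frob_norm (coeff_mat R 0) + frob_norm (coeff_mat R 1)" .
  qed
  also have "\<dots> \<le> (\<Sum>t<h. sqrt 2 * sqrt ((frob_norm (coeff_mat R 0))\<^sup>2 + (frob_norm (coeff_mat R 1))\<^sup>2))"
    by (intro sum_mono sum_le_sqrt2)
  also have "\<dots> = sqrt 2 * real h * frob_norm_poly R"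
    using frob_norm_poly_eq_L2[OF R] by (simp add: L2_set_def)
  finally show ?thesis .
qed

section \<open>The linear equation that clears the (2,2) block\<close>

text \<open>With \<open>sylv_right\<close> a right inverse of the operator sending
  \<open>(C, D)\<close> to the left-hand side in \<open>sylv_solves\<close>. Comparing coefficients
  with \<open>K = K_0 + \<lambda> K_1\<close> gives \<open>C(i,j) + D(i,j) = - K_0(i,j)\<close> and
  \<open>C(i,j+m) + D(i+n,j) = K_1(i,j)\<close>. Alternating between the two moves along the
  positions \<open>(i - t n, j + t m)\<close>, which have left the matrix by
  \<open>t = min \<epsilon> \<eta>\<close>.\<close>

definition sylv_left :: "nat \<Rightarrow> nat \<Rightarrow> nat \<Rightarrow> nat \<Rightarrow> 'a::ab_group_add poly mat \<Rightarrow> 'a mat" where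
  "sylv_left \<epsilon> n \<eta> m K = mat (\<epsilon> * n) ((\<eta> + 1) * m) (\<lambda>(i, j). \<Sum>t<min \<epsilon> \<eta>.
     - zext K 0 (int i - int t * int n, int j + int t * int m)
     - zext K 1 (int i - int (Suc t) * int n, int j + int t * int m))"

definition sylv_right :: "nat \<Rightarrow> nat \<Rightarrow> nat \<Rightarrow> nat \<Rightarrow> 'a::ab_group_add poly mat \<Rightarrow> 'a mat" where
  "sylv_right \<epsilon> n \<eta> m K = mat ((\<epsilon> + 1) * n) (\<eta> * m) (\<lambda>(i, j). \<Sum>t<min \<epsilon> \<eta>.
     zext K 1 (int i - int (Suc t) * int n, int j + int t * int m)
     + zext K 0 (int i - int (Suc t) * int n, int j + int (Suc t) * int m))"

lemma sylv_carrier [simp]: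
  "sylv_left \<epsilon> n \<eta> m K \<in> carrier_mat (\<epsilon> * n) ((\<eta> + 1) * m)"
  "sylv_right \<epsilon> n \<eta> m K \<in> carrier_mat ((\<epsilon> + 1) * n) (\<eta> * m)"
  by (simp_all add: sylv_left_def sylv_right_def)

lemma sylv_minus:
  fixes K K' :: "'a::ab_group_add poly mat"
  assumes "K \<in> carrier_mat (\<epsilon> * n) (\<eta> * m)" "K' \<in> carrier_mat (\<epsilon> * n) (\<eta> * m)"
  shows "sylv_left \<epsilon> n \<eta> m (K - K') = sylv_left \<epsilon> n \<eta> m K - sylv_left \<epsilon> n \<eta> m K'"
    and "sylv_right \<epsilon> n \<eta> m (K - K') = sylv_right \<epsilon> n \<eta> m K - sylv_right \<epsilon> n \<eta> m K'"
  unfolding sylv_left_def sylv_right_def zext_minus[OF assms]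
  by (intro eq_matI; simp add: sum_subtractf sum.distrib sum_negf)+

lemma sylv_norm:
  fixes K :: "'a::real_normed_vector poly mat"
  assumes K: "has_grade 1 K"
  shows "frob_norm (sylv_left \<epsilon> n \<eta> m K) \<le> sqrt 2 * real (min \<epsilon> \<eta>) * frob_norm_poly K"
    and "frob_norm (sylv_right \<epsilon> n \<eta> m K) \<le> sqrt 2 * real (min \<epsilon> \<eta>) * frob_norm_poly K"
proof -
  show "frob_norm (sylv_left \<epsilon> n \<eta> m K) \<le> sqrt 2 * real (min \<epsilon> \<eta>) * frob_norm_poly K"
  proof (rule frob_norm_zext_sum_le[OF sylv_carrier(1) K,
        where \<phi> = "\<lambda>t (i, j). (int i - int t * int n, int j + int t * int m)"
          and \<psi> = "\<lambda>t (i, j). (int i - int (Suc t) * int n, int j + int t * int m)"])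
    fix i j assume "i < \<epsilon> * n" "j < (\<eta> + 1) * m"
    then show "norm (sylv_left \<epsilon> n \<eta> m K $$ (i, j)) \<le> (\<Sum>t<min \<epsilon> \<eta>.
      norm (zext K 0 (case (i, j) of (i, j) \<Rightarrow> (int i - int t * int n, int j + int t * int m))) +
      norm (zext K 1 (case (i, j) of (i, j) \<Rightarrow> (int i - int (Suc t) * int n, int j + int t * int m))))"
      unfolding sylv_left_def
      by (simp only: index_mat prod.case) (intro order.trans[OF norm_sum] sum_mono order.trans[OF norm_triangle_ineq4], simp)
  qed (auto simp: inj_on_def)
  show "frob_norm (sylv_right \<epsilon> n \<eta> m K) \<le> sqrt 2 * real (min \<epsilon> \<eta>) * frob_norm_poly K"
  proof (rule frob_norm_zext_sum_le[OF sylv_carrier(2) K,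
        where \<phi> = "\<lambda>t (i, j). (int i - int (Suc t) * int n, int j + int (Suc t) * int m)"
          and \<psi> = "\<lambda>t (i, j). (int i - int (Suc t) * int n, int j + int t * int m)"])
    fix i j assume "i < (\<epsilon> + 1) * n" "j < \<eta> * m"
    then show "norm (sylv_right \<epsilon> n \<eta> m K $$ (i, j)) \<le> (\<Sum>t<min \<epsilon> \<eta>.
      norm (zext K 0 (case (i, j) of (i, j) \<Rightarrow> (int i - int (Suc t) * int n, int j + int (Suc t) * int m))) +
      norm (zext K 1 (case (i, j) of (i, j) \<Rightarrow> (int i - int (Suc t) * int n, int j + int t * int m))))"
      unfolding sylv_right_def
      by (simp only: index_mat prod.case) (intro order.trans[OF norm_sum] sum_mono order.trans[OF norm_triangle_ineq], simp)
  qed (auto simp: inj_on_def)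
qed

lemma poly_eq_grade_1:
  assumes "has_grade 1 R" "i < dim_row R" "j < dim_col R"
  shows "[:coeff (R $$ (i, j)) 0, coeff (R $$ (i, j)) 1:] = R $$ (i, j)"
proof (rule poly_eqI)
  fix e
  show "coeff [:coeff (R $$ (i, j)) 0, coeff (R $$ (i, j)) 1:] e = coeff (R $$ (i, j)) e"
    using has_grade_coeff[OF assms, of e] by (auto simp: coeff_pCons split: nat.splits)
qed

text \<open>In the constant coefficient the \<open>K_1\<close> terms of the two sums cancel and the
  \<open>K_0\<close> terms telescope; in the linear coefficient the roles are exchanged.\<close>

lemma sylv_solves:
  fixes K :: "'a::comm_ring_1 poly mat"
  assumes K: "K \<in> carrier_mat (\<epsilon> * n) (\<eta> * m)" "has_grade 1 K"
  shows "const_mat (sylv_left \<epsilon> n \<eta> m K) * (kron_L \<eta> m)\<^sup>T + kron_L \<epsilon> n * const_mat (sylv_right \<epsilon> n \<eta> m K) = K"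
    (is "?C * _ + _ * ?D = K")
proof (rule eq_matI)
  fix i j assume "i < dim_row K" "j < dim_col K"
  then have ij: "i < \<epsilon> * n" "j < \<eta> * m" using K by auto
  let ?h = "min \<epsilon> \<eta>"
  let ?C = "sylv_left \<epsilon> n \<eta> m K" and ?D = "sylv_right \<epsilon> n \<eta> m K"
  let ?f = "\<lambda>e t. zext K e (int i - int t * int n, int j + int t * int m)"
  \<comment> \<open>If \<open>\<epsilon> \<le> \<eta>\<close>, the row index has become negative;
    otherwise the column index has passed the last column. Hence a telescoping sum keeps only its
    end at \<open>t = 0\<close>.\<close>
  have van: "?f e ?h = 0" for e
  proof (rule zext_outside)
    show "int i - int ?h * int n < 0 \<or> int (dim_row K) \<le> int i - int ?h * int n \<or>
      int j + int ?h * int m < 0 \<or> int (dim_col K) \<le> int j + int ?h * int m"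
    proof (cases "\<epsilon> \<le> \<eta>")
      case True
      have "int i < int \<epsilon> * int n" using ij(1) by (metis of_nat_less_iff of_nat_mult)
      then show ?thesis using True by (simp add: min_def)
    next
      case False
      then show ?thesis using K by (simp add: min_def)
    qed
  qed
  have C0: "?C $$ (i, j) + ?D $$ (i, j) = - coeff (K $$ (i, j)) 0"
  proof -
    have "?C $$ (i, j) + ?D $$ (i, j) = (\<Sum>t<?h. ?f 0 (Suc t) - ?f 0 t)"
      using ij unfolding sylv_left_def sylv_right_def
      by (simp add: sum.distrib sum_subtractf sum_negf)
    also have "\<dots> = ?f 0 ?h - ?f 0 0" by (rule sum_lessThan_telescope)
    also have "\<dots> = - coeff (K $$ (i, j)) 0" using van[of 0] ij K by (simp add: zext_inside)
    finally show ?thesis .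
  qed
  have C1: "?C $$ (i, j + m) + ?D $$ (i + n, j) = coeff (K $$ (i, j)) 1"
  proof -
    have "?C $$ (i, j + m) + ?D $$ (i + n, j) = (\<Sum>t<?h. ?f 1 t - ?f 1 (Suc t))"
      using ij unfolding sylv_left_def sylv_right_def
      by (simp add: sum.distrib sum_subtractf sum_negf) (simp add: algebra_simps)
    also have "\<dots> = ?f 1 0 - ?f 1 ?h" by (rule sum_lessThan_telescope')
    also have "\<dots> = coeff (K $$ (i, j)) 1" using van[of 1] ij K by (simp add: zext_inside)
    finally show ?thesis .
  qed
  have "(const_mat ?C * (kron_L \<eta> m)\<^sup>T + kron_L \<epsilon> n * const_mat ?D) $$ (i, j) =
      (const_mat ?C * (kron_L \<eta> m)\<^sup>T) $$ (i, j) + (kron_L \<epsilon> n * const_mat ?D) $$ (i, j)"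
    using ij by (intro index_add_mat) (simp_all add: sylv_right_def)
  also have "\<dots> = [:- ?C $$ (i, j), ?C $$ (i, j + m):] + [:- ?D $$ (i, j), ?D $$ (i + n, j):]"
    by (simp only: const_mult_kron_L_transpose_index[OF sylv_carrier(1) ij] kron_L_mult_const_index[OF sylv_carrier(2) ij])
  also have "\<dots> = [:- (?C $$ (i, j) + ?D $$ (i, j)), ?C $$ (i, j + m) + ?D $$ (i + n, j):]" by simp
  also have "\<dots> = [:coeff (K $$ (i, j)) 0, coeff (K $$ (i, j)) 1:]" unfolding C0 C1 by simp
  also have "\<dots> = K $$ (i, j)" using K ij by (intro poly_eq_grade_1) auto
  finally show "(const_mat ?C * (kron_L \<eta> m)\<^sup>T + kron_L \<epsilon> n * const_mat ?D) $$ (i, j) = K $$ (i, j)" .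
qed (use K in \<open>auto simp: sylv_left_def sylv_right_def\<close>)

section \<open>The linear equation that restores the off-diagonal blocks\<close>

text \<open>The main block diagonals are underdetermined; the choice made by \<open>j \<le> i\<close> is constant along the
  chains \<open>(i, j) \<mapsto> (i + n, j + n)\<close> and makes every chain end at a prescribed boundary value.\<close>

definition comm_Y :: "nat \<Rightarrow> nat \<Rightarrow> 'a::ab_group_add poly mat \<Rightarrow> 'a mat" where
  "comm_Y k n N = mat ((k + 1) * n) ((k + 1) * n) (\<lambda>(i, j). if j \<le> i
     then \<Sum>t<k. zext N 0 (int i - int (Suc t) * int n, int j - int (Suc t) * int n)
       + zext N 1 (int i - int (Suc t) * int n, int j - int t * int n)
     else \<Sum>t<k. - zext N 0 (int i + int t * int n, int j + int t * int n)
       - zext N 1 (int i + int t * int n, int j + int (Suc t) * int n))"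

text \<open>The constant coefficient of \<open>K Y - Z K = N\<close> forces
  \<open>Z = Y + N_0\<close> on the first \<open>k * n\<close> columns, so only \<open>Y\<close> is
  a genuine unknown.\<close>

definition comm_Z :: "nat \<Rightarrow> nat \<Rightarrow> 'a::ab_group_add poly mat \<Rightarrow> 'a mat" where
  "comm_Z k n N = mat (k * n) (k * n) (\<lambda>(i, j). comm_Y k n N $$ (i, j) + coeff (N $$ (i, j)) 0)"

lemma comm_carrier [simp]:
  "comm_Y k n N \<in> carrier_mat ((k + 1) * n) ((k + 1) * n)"
  "comm_Z k n N \<in> carrier_mat (k * n) (k * n)"
  by (simp_all add: comm_Y_def comm_Z_def)

lemma comm_Y_minus:
  fixes N N' :: "'a::ab_group_add poly mat"
  assumes "N \<in> carrier_mat (k * n) ((k + 1) * n)" "N' \<in> carrier_mat (k * n) ((k + 1) * n)"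
  shows "comm_Y k n (N - N') = comm_Y k n N - comm_Y k n N'"
  unfolding comm_Y_def zext_minus[OF assms]
  by (intro eq_matI; simp add: sum_subtractf sum.distrib sum_negf)

lemma comm_Y_norm:
  fixes N :: "'a::real_normed_vector poly mat"
  assumes N: "has_grade 1 N"
  shows "frob_norm (comm_Y k n N) \<le> sqrt 2 * real k * frob_norm_poly N"
proof (rule frob_norm_zext_sum_le[OF comm_carrier(1) N,
      where \<phi> = "\<lambda>t (i, j). if j \<le> i then (int i - int (Suc t) * int n, int j - int (Suc t) * int n)
          else (int i + int t * int n, int j + int t * int n)"
        and \<psi> = "\<lambda>t (i, j). if j \<le> i then (int i - int (Suc t) * int n, int j - int t * int n)
          else (int i + int t * int n, int j + int (Suc t) * int n)"])
  fix i j assume ij: "i < (k + 1) * n" "j < (k + 1) * n"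
  show "norm (comm_Y k n N $$ (i, j)) \<le> (\<Sum>t<k.
      norm (zext N 0 (case (i, j) of (i, j) \<Rightarrow> if j \<le> i then (int i - int (Suc t) * int n, int j - int (Suc t) * int n)
          else (int i + int t * int n, int j + int t * int n))) +
      norm (zext N 1 (case (i, j) of (i, j) \<Rightarrow> if j \<le> i then (int i - int (Suc t) * int n, int j - int t * int n)
          else (int i + int t * int n, int j + int (Suc t) * int n))))"
  proof (cases "j \<le> i")
    case True
    then show ?thesis using ij unfolding comm_Y_def
      by (simp only: index_mat prod.case if_True) (intro order.trans[OF norm_sum] sum_mono norm_triangle_ineq)
  next
    case False
    then show ?thesis using ij unfolding comm_Y_def
      by (simp only: index_mat prod.case if_False)
        (intro order.trans[OF norm_sum] sum_mono order.trans[OF norm_triangle_ineq4], simp)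
  qed
next
  \<comment> \<open>Both branches change \<open>j - i\<close> by the same amount, 0 in the first map
    and \<open>n\<close> in the second. A point of the image therefore reveals which branch produced
    it, and each branch is a translation.\<close>
  fix t
  show "inj_on (\<lambda>(i, j). if j \<le> i then (int i - int (Suc t) * int n, int j - int (Suc t) * int n)
          else (int i + int t * int n, int j + int t * int n)) ({..<(k + 1) * n} \<times> {..<(k + 1) * n})"
    by (rule inj_onI) (auto split: if_splits)
  show "inj_on (\<lambda>(i, j). if j \<le> i then (int i - int (Suc t) * int n, int j - int t * int n)
          else (int i + int t * int n, int j + int (Suc t) * int n)) ({..<(k + 1) * n} \<times> {..<(k + 1) * n})"
    by (rule inj_onI) (auto split: if_splits simp: algebra_simps)
qed

lemma comm_Z_norm:
  fixes N :: "'a::real_normed_vector poly mat"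
  assumes N: "N \<in> carrier_mat (k * n) ((k + 1) * n)" "has_grade 1 N"
  shows "frob_norm (comm_Z k n N) \<le> frob_norm (comm_Y k n N) + frob_norm_poly N"
proof -
  let ?S = "{..<k * n} \<times> {..<k * n}"
  have "frob_norm (comm_Z k n N) = L2_set (\<lambda>p. norm (comm_Y k n N $$ p + coeff (N $$ p) 0)) ?S"
    unfolding frob_norm_eq_L2[OF comm_carrier(2)] by (intro L2_set_cong) (auto simp: comm_Z_def)
  also have "\<dots> \<le> L2_set (\<lambda>p. norm (comm_Y k n N $$ p) + norm (coeff (N $$ p) 0)) ?S"
    by (intro L2_set_mono norm_triangle_ineq norm_ge_zero)
  also have "\<dots> \<le> L2_set (\<lambda>p. norm (comm_Y k n N $$ p)) ?S + L2_set (\<lambda>p. norm (coeff (N $$ p) 0)) ?S"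
    by (rule L2_set_triangle_ineq)
  also have "L2_set (\<lambda>p. norm (comm_Y k n N $$ p)) ?S \<le> frob_norm (comm_Y k n N)"
    unfolding frob_norm_eq_L2[OF comm_carrier(1)] L2_set_def
    by (intro real_sqrt_le_mono sum_mono2) auto
  also have "L2_set (\<lambda>p. norm (coeff (N $$ p) 0)) ?S \<le> frob_norm (coeff_mat N 0)"
  proof -
    have "L2_set (\<lambda>p. norm (coeff (N $$ p) 0)) ?S = L2_set (\<lambda>p. norm (coeff_mat N 0 $$ p)) ?S"
      using N by (intro L2_set_cong) auto
    also have "\<dots> \<le> L2_set (\<lambda>p. norm (coeff_mat N 0 $$ p)) ({..<k * n} \<times> {..<(k + 1) * n})"
      unfolding L2_set_def by (intro real_sqrt_le_mono sum_mono2) auto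
    also have "\<dots> = frob_norm (coeff_mat N 0)" using N by (intro frob_norm_eq_L2[symmetric]) simp
    finally show ?thesis .
  qed
  also have "frob_norm (coeff_mat N 0) \<le> frob_norm_poly N"
    unfolding frob_norm_poly_eq_L2[OF N(2)] by (rule member_le_L2_set) auto
  finally show ?thesis by simp
qed

text \<open>Eliminating \<open>Z\<close> leaves
  \<open>Y(i+n, j) - Y(i, j-n) = N_1(i, j) + N_0(i, j-n)\<close> along the block diagonals, with the
  boundary values \<open>Y(i, j) = - N_0(i, j)\<close> in the last block column and
  \<open>Y(i+n, j) = N_1(i, j)\<close> in the first.\<close>

lemma comm_solves:
  fixes N :: "'a::comm_ring_1 poly mat"
  assumes N: "N \<in> carrier_mat (k * n) ((k + 1) * n)" "has_grade 1 N"
  shows "kron_L k n * const_mat (comm_Y k n N) - const_mat (comm_Z k n N) * kron_L k n = N"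
proof (rule eq_matI)
  fix i j assume "i < dim_row N" "j < dim_col N"
  then have ij: "i < k * n" "j < (k + 1) * n" using N by auto
  then have n: "n > 0" and k: "k > 0" by (cases n, auto, cases k, auto)
  let ?Y = "comm_Y k n N" and ?Z = "comm_Z k n N"
  have dims: "int (dim_row N) = int k * int n" "int (dim_col N) = int k * int n + int n" using N by (auto simp: algebra_simps)
  have ii: "int i < int k * int n" "int j < int k * int n + int n"
    using ij by (metis of_nat_less_iff of_nat_mult, metis add.commute distrib_right mult_1 of_nat_add of_nat_less_iff of_nat_mult of_nat_1)
  have Z: "?Z $$ (i, j) = ?Y $$ (i, j) + coeff (N $$ (i, j)) 0" if "j < k * n"
    using that ij by (simp add: comm_Z_def)
  have E0: "- ?Y $$ (i, j) + (if j < k * n then ?Z $$ (i, j) else 0) = coeff (N $$ (i, j)) 0"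
  proof (cases "j < k * n")
    case True
    then show ?thesis using Z by simp
  next
    \<comment> \<open>Last block column, where \<open>Z\<close> has no entry: all positions of the
      sum except the first one of \<open>N_0\<close> lie to the right of \<open>N\<close>.\<close>
    case False
    then have jk: "int k * int n \<le> int j" by (metis linorder_not_less of_nat_le_iff of_nat_mult)
    then have "\<not> j \<le> i" using ij False by simp
    then have "?Y $$ (i, j) = (\<Sum>t<k. - zext N 0 (int i + int t * int n, int j + int t * int n)
       - zext N 1 (int i + int t * int n, int j + int (Suc t) * int n))"
      using ij by (simp add: comm_Y_def)
    also have "\<dots> = (\<Sum>t<k. if t = 0 then - zext N 0 (int i, int j) else 0)"
    proof (intro sum.cong refl)
      fix t
      have nt: "0 \<le> int t * int n" and st: "int (Suc t) * int n = int t * int n + int n"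
        by (simp_all add: algebra_simps)
      have "zext N 1 (int i + int t * int n, int j + int (Suc t) * int n) = 0"
        using jk nt st dims by (intro zext_outside) linarith
      moreover have "zext N 0 (int i + int t * int n, int j + int t * int n) = 0" if "t > 0"
      proof -
        have "int n \<le> int t * int n" using that by (cases t) (auto simp: algebra_simps)
        then show ?thesis using jk by (intro zext_outside) (simp add: dims)
      qed
      ultimately show "- zext N 0 (int i + int t * int n, int j + int t * int n)
         - zext N 1 (int i + int t * int n, int j + int (Suc t) * int n) = (if t = 0 then - zext N 0 (int i, int j) else 0)"
        by auto
    qed
    also have "\<dots> = - coeff (N $$ (i, j)) 0" using k ij N by (simp add: zext_inside)
    finally show ?thesis using False by simp
  qed
  have E1: "?Y $$ (i + n, j) - (if n \<le> j then ?Z $$ (i, j - n) else 0) = coeff (N $$ (i, j)) 1"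
  proof (cases "n \<le> j")
    \<comment> \<open>First block column: all positions of the sum except the first one of
      \<open>N_1\<close> lie to the left of \<open>N\<close>.\<close>
    case False
    have "?Y $$ (i + n, j) = (\<Sum>t<k. zext N 0 (int (i + n) - int (Suc t) * int n, int j - int (Suc t) * int n)
       + zext N 1 (int (i + n) - int (Suc t) * int n, int j - int t * int n))"
      using ij False by (simp add: comm_Y_def)
    also have "\<dots> = (\<Sum>t<k. if t = 0 then zext N 1 (int i, int j) else 0)"
    proof (intro sum.cong refl)
      fix t
      have nt: "0 \<le> int t * int n" and st: "int (Suc t) * int n = int t * int n + int n"
        by (simp_all add: algebra_simps)
      have jn: "int j < int n" using False by simp
      then have "zext N 0 (int (i + n) - int (Suc t) * int n, int j - int (Suc t) * int n) = 0"
        using nt st by (intro zext_outside) linarith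
      moreover have "zext N 1 (int (i + n) - int (Suc t) * int n, int j - int t * int n) = 0" if "t > 0"
      proof -
        have "int n \<le> int t * int n" using that by (cases t) (auto simp: algebra_simps)
        then show ?thesis using jn by (intro zext_outside) linarith
      qed
      ultimately show "zext N 0 (int (i + n) - int (Suc t) * int n, int j - int (Suc t) * int n)
       + zext N 1 (int (i + n) - int (Suc t) * int n, int j - int t * int n) = (if t = 0 then zext N 1 (int i, int j) else 0)"
        by auto
    qed
    also have "\<dots> = coeff (N $$ (i, j)) 1" using k ij N by (simp add: zext_inside)
    finally show ?thesis using False by simp
  next
    case True
    then have jn: "int (j - n) = int j - int n" "j - n < k * n" using ij by auto
    have Z': "?Z $$ (i, j - n) = ?Y $$ (i, j - n) + zext N 0 (int i, int j - int n)"
      using ij True N jn zext_inside[of i N "j - n" 0] by (simp add: comm_Z_def)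
    have "?Y $$ (i + n, j) - ?Y $$ (i, j - n) = zext N 1 (int i, int j) + zext N 0 (int i, int j - int n)"
    \<comment> \<open>As \<open>n \<le> j\<close>, the test is equivalent to
      \<open>j - n \<le> i\<close>; so both entries of \<open>Y\<close> come from the same branch of
      \<open>comm_Y\<close> and their sums telescope. After \<open>k\<close> block steps up or down
      the row index is outside \<open>N\<close>.\<close>
    proof (cases "j \<le> i + n")
      case le: True
      let ?g = "\<lambda>t. zext N 0 (int i - int t * int n, int j - int (Suc t) * int n)
        + zext N 1 (int i - int t * int n, int j - int t * int n)"
      have "?Y $$ (i + n, j) - ?Y $$ (i, j - n) = (\<Sum>t<k. ?g t - ?g (Suc t))"
      proof -
        have "?Y $$ (i + n, j) = (\<Sum>t<k. ?g t)"
          using ij le unfolding comm_Y_def by (simp add: algebra_simps)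
        moreover have "?Y $$ (i, j - n) = (\<Sum>t<k. ?g (Suc t))"
          using ij le True unfolding comm_Y_def by (simp add: jn(1)) (simp add: algebra_simps)
        ultimately show ?thesis by (simp only: sum_subtractf)
      qed
      also have "\<dots> = ?g 0 - ?g k" by (rule sum_lessThan_telescope')
      also have "?g k = 0"
      proof -
        have "zext N e (int i - int k * int n, x) = 0" for e x using ii by (intro zext_outside) simp
        then show ?thesis by simp
      qed
      finally show ?thesis by simp
    next
      case gt: False
      let ?g = "\<lambda>t. zext N 0 (int i + int t * int n, int j + int t * int n - int n)
        + zext N 1 (int i + int t * int n, int j + int t * int n)"
      have "?Y $$ (i + n, j) - ?Y $$ (i, j - n) = (\<Sum>t<k. ?g t - ?g (Suc t))"
      proof -
        have "?Y $$ (i + n, j) = (\<Sum>t<k. - ?g (Suc t))"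
          using ij gt unfolding comm_Y_def by (simp add: algebra_simps)
        moreover have "?Y $$ (i, j - n) = (\<Sum>t<k. - ?g t)"
          using ij gt True unfolding comm_Y_def by (simp add: jn(1)) (simp add: algebra_simps)
        ultimately show ?thesis by (simp add: sum_subtractf sum_negf)
      qed
      also have "\<dots> = ?g 0 - ?g k" by (rule sum_lessThan_telescope')
      also have "?g k = 0"
      proof -
        have "zext N e (int i + int k * int n, x) = 0" for e x by (intro zext_outside) (simp add: dims)
        then show ?thesis by simp
      qed
      finally show ?thesis by simp
    qed
    then have "?Y $$ (i + n, j) - ?Z $$ (i, j - n) = zext N 1 (int i, int j)"
      unfolding Z' by (simp add: algebra_simps)
    then show ?thesis using True ij N by (simp add: zext_inside)
  qed
  have "(kron_L k n * const_mat ?Y - const_mat ?Z * kron_L k n) $$ (i, j) =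
      (kron_L k n * const_mat ?Y) $$ (i, j) - (const_mat ?Z * kron_L k n) $$ (i, j)"
    using ij by (intro index_minus_mat) (simp_all add: comm_Z_def)
  also have "\<dots> = [:- ?Y $$ (i, j), ?Y $$ (i + n, j):] -
      [:if j < k * n then - ?Z $$ (i, j) else 0, if n \<le> j then ?Z $$ (i, j - n) else 0:]"
    by (simp only: kron_L_mult_const_index[OF comm_carrier(1) ij] const_mult_kron_L_index[OF comm_carrier(2) ij])
  also have "\<dots> = [:- ?Y $$ (i, j) + (if j < k * n then ?Z $$ (i, j) else 0),
      ?Y $$ (i + n, j) - (if n \<le> j then ?Z $$ (i, j - n) else 0):]" by simp
  also have "\<dots> = N $$ (i, j)" unfolding E0 E1 using N ij by (intro poly_eq_grade_1) auto
  finally show "(kron_L k n * const_mat ?Y - const_mat ?Z * kron_L k n) $$ (i, j) = N $$ (i, j)" .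
qed (use N in \<open>auto simp: comm_Y_def comm_Z_def\<close>)

section \<open>Reduction of the perturbed pencil by strict equivalence\<close>

text \<open>The left-hand side is the (2,2) block of the perturbed pencil after \<open>C\<close>
  times the first block row has been added to the second and the first block column times
  \<open>D\<close> to the second. The matrix \<open>A\<close> is the perturbed (1,1) block, and its
  product with \<open>C\<close> and \<open>D\<close> is the only quadratic term.\<close>

lemma riccati_solution:
  fixes A dB dG H :: "'a::{real_normed_field,euclidean_space} poly mat"
  assumes A: "A \<in> carrier_mat ((\<eta> + 1) * m) ((\<epsilon> + 1) * n)" "has_grade 1 A" "frob_norm_poly A \<le> \<mu>"
    and dB: "dB \<in> carrier_mat ((\<eta> + 1) * m) (\<eta> * m)" "has_grade 1 dB" "frob_norm_poly dB \<le> \<delta>"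
    and dG: "dG \<in> carrier_mat (\<epsilon> * n) ((\<epsilon> + 1) * n)" "has_grade 1 dG" "frob_norm_poly dG \<le> \<delta>"
    and H: "H \<in> carrier_mat (\<epsilon> * n) (\<eta> * m)" "has_grade 1 H" "frob_norm_poly H \<le> \<delta>"
  defines "\<kappa> \<equiv> sqrt 2 * real (min \<epsilon> \<eta>)"
  assumes s1: "\<kappa> * \<delta> \<le> 1 / 32" and s2: "\<kappa>\<^sup>2 * \<delta> * \<mu> \<le> 9 / 100"
  shows "\<exists>C D. C \<in> carrier_mat (\<epsilon> * n) ((\<eta> + 1) * m) \<and> D \<in> carrier_mat ((\<epsilon> + 1) * n) (\<eta> * m) \<and>
    frob_norm C \<le> 5 / 4 * \<kappa> * \<delta> \<and> frob_norm D \<le> 5 / 4 * \<kappa> * \<delta> \<and>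
    const_mat C * ((kron_L \<eta> m)\<^sup>T + dB) + (kron_L \<epsilon> n + dG) * const_mat D + H + const_mat C * A * const_mat D
      = 0\<^sub>m (\<epsilon> * n) (\<eta> * m)"
proof -
  define a b c e where "a = \<epsilon> * n" and "b = (\<eta> + 1) * m" and "c = (\<epsilon> + 1) * n" and "e = \<eta> * m"
  note abce = a_def[symmetric] b_def[symmetric] c_def[symmetric] e_def[symmetric]
  define L R where "L = (sylv_left \<epsilon> n \<eta> m :: 'a poly mat \<Rightarrow> _)" and "R = (sylv_right \<epsilon> n \<eta> m :: 'a poly mat \<Rightarrow> _)"
  have A: "A \<in> carrier_mat b c" "has_grade 1 A" "frob_norm_poly A \<le> \<mu>"
    and dB: "dB \<in> carrier_mat b e" "has_grade 1 dB" "frob_norm_poly dB \<le> \<delta>"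
    and dG: "dG \<in> carrier_mat a c" "has_grade 1 dG" "frob_norm_poly dG \<le> \<delta>"
    and H: "H \<in> carrier_mat a e" "has_grade 1 H" "frob_norm_poly H \<le> \<delta>"
    using A dB dG H by (simp_all only: abce)
  have \<delta>: "0 \<le> \<delta>" using order.trans[OF frob_norm_poly_nonneg H(3)] .
  have \<mu>: "0 \<le> \<mu>" using order.trans[OF frob_norm_poly_nonneg A(3)] .
  have \<kappa>: "0 \<le> \<kappa>" by (simp add: \<kappa>_def)
  have LR: "L K \<in> carrier_mat a b" "R K \<in> carrier_mat c e" for K
    unfolding L_def R_def a_def b_def c_def e_def by (rule sylv_carrier)+
  have LRm: "L (K - K') = L K - L K'" "R (K - K') = R K - R K'"
    if "K \<in> carrier_mat a e" "K' \<in> carrier_mat a e" for K K'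
    using that unfolding L_def R_def a_def e_def by (simp_all add: sylv_minus)
  have LRn: "frob_norm (L K) \<le> \<kappa> * frob_norm_poly K" "frob_norm (R K) \<le> \<kappa> * frob_norm_poly K"
    if "has_grade 1 K" for K
    using that unfolding L_def R_def \<kappa>_def by (simp_all only: sylv_norm)
  \<comment> \<open>For \<open>C = L K\<close> and \<open>D = R K\<close> the unperturbed linear
    part equals \<open>K\<close> by \<open>sylv_solves\<close>; the full equation then reads
    \<open>K = \<Phi> K\<close>.\<close>
  define \<Phi> where "\<Phi> K = - (H + const_mat (L K) * dB + dG * const_mat (R K) + const_mat (L K) * A * const_mat (R K))" for K
  have c1: "const_mat X * dB \<in> carrier_mat a e" "has_grade 1 (const_mat X * dB)"
      "frob_norm_poly (const_mat X * dB) \<le> frob_norm X * \<delta>"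
    if "X \<in> carrier_mat a b" for X
    using that dB by (auto intro: mult_carrier_mat has_grade_const_mult
        intro!: order.trans[OF frob_norm_poly_const_mult[OF that dB(1)]] mult_left_mono)
  have c2: "dG * const_mat Y \<in> carrier_mat a e" "has_grade 1 (dG * const_mat Y)"
      "frob_norm_poly (dG * const_mat Y) \<le> \<delta> * frob_norm Y"
    if "Y \<in> carrier_mat c e" for Y
    using that dG by (auto intro: mult_carrier_mat has_grade_mult_const
        intro!: order.trans[OF frob_norm_poly_mult_const[OF dG(1) that]] mult_right_mono)
  have c3: "const_mat X * A * const_mat Y \<in> carrier_mat a e" "has_grade 1 (const_mat X * A * const_mat Y)"
      "frob_norm_poly (const_mat X * A * const_mat Y) \<le> frob_norm X * \<mu> * frob_norm Y"
    if X: "X \<in> carrier_mat a b" and Y: "Y \<in> carrier_mat c e" for X Y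
  proof -
    have XA: "const_mat X * A \<in> carrier_mat a c" "has_grade 1 (const_mat X * A)"
      using X A by (auto intro: mult_carrier_mat has_grade_const_mult)
    then show "const_mat X * A * const_mat Y \<in> carrier_mat a e" "has_grade 1 (const_mat X * A * const_mat Y)"
      using Y by (auto intro: mult_carrier_mat has_grade_mult_const)
    have "frob_norm_poly (const_mat X * A) \<le> frob_norm X * \<mu>"
      using A(3) by (intro order.trans[OF frob_norm_poly_const_mult[OF X A(1)]] mult_left_mono) auto
    then show "frob_norm_poly (const_mat X * A * const_mat Y) \<le> frob_norm X * \<mu> * frob_norm Y"
      by (intro order.trans[OF frob_norm_poly_mult_const[OF XA(1) Y]] mult_right_mono) auto
  qed
  have id1: "- (h + x + y + z) - - (h + x' + y' + z') = - ((x - x') + (y - y') + (z - z'))"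
    and id2: "z - z' = (z - y) + (y - z')"
    and id3: "(x' + x) + (y' + y) + h + z = (x' + y') - - (h + x + y + z)"
    if "h \<in> carrier_mat a e" "x \<in> carrier_mat a e" "x' \<in> carrier_mat a e" "y \<in> carrier_mat a e"
      "y' \<in> carrier_mat a e" "z \<in> carrier_mat a e" "z' \<in> carrier_mat a e" for h x y z x' y' z' :: "'a poly mat"
    using that by (intro eq_matI; auto)+
  \<comment> \<open>The slack of one quarter absorbs the linear terms, at most
    \<open>5/2 * 1/32\<close>, and the quadratic one, at most \<open>25/16 * 9/100\<close>, both
    relative to \<open>\<delta>\<close>.\<close>
  define \<rho> where "\<rho> = 5 / 4 * \<delta>"
  define S where "S = {K :: 'a poly mat. K \<in> carrier_mat a e \<and> has_grade 1 K \<and> frob_norm_poly K \<le> \<rho>}"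
  have tri3: "frob_norm_poly (X + Y + Z) \<le> frob_norm_poly X + frob_norm_poly Y + frob_norm_poly Z"
    if "X \<in> carrier_mat a e" "Y \<in> carrier_mat a e" "Z \<in> carrier_mat a e" for X Y Z :: "'a poly mat"
    using frob_norm_poly_triangle[of "X + Y" a e Z] frob_norm_poly_triangle[of X a e Y] that by auto
  have \<Phi>c: "\<Phi> K \<in> carrier_mat a e" "has_grade 1 (\<Phi> K)" for K
    unfolding \<Phi>_def using H c1[OF LR(1)] c2[OF LR(2)] c3[OF LR]
    by (auto intro!: add_carrier_mat has_grade_add[of _ a e])
  have Sn: "frob_norm (L K) \<le> 5 / 4 * \<kappa> * \<delta>" "frob_norm (R K) \<le> 5 / 4 * \<kappa> * \<delta>" if "K \<in> S" for K
  proof -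
    have "has_grade 1 K" "frob_norm_poly K \<le> \<rho>" using that by (auto simp: S_def)
    moreover from this have "\<kappa> * frob_norm_poly K \<le> \<kappa> * \<rho>" using \<kappa> by (intro mult_left_mono)
    ultimately show "frob_norm (L K) \<le> 5 / 4 * \<kappa> * \<delta>" "frob_norm (R K) \<le> 5 / 4 * \<kappa> * \<delta>"
      using LRn[of K] by (auto simp: \<rho>_def)
  qed
  let ?s = "5 / 4 * \<kappa> * \<delta>"
  have s0: "0 \<le> ?s" using \<kappa> \<delta> by simp
  have maps: "\<Phi> K \<in> S" if K: "K \<in> S" for K
  proof -
    have "frob_norm_poly (\<Phi> K) \<le> frob_norm_poly H + frob_norm_poly (const_mat (L K) * dB)
       + frob_norm_poly (dG * const_mat (R K)) + frob_norm_poly (const_mat (L K) * A * const_mat (R K))"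
      unfolding \<Phi>_def frob_norm_poly_uminus
      using frob_norm_poly_triangle[of "H + const_mat (L K) * dB + dG * const_mat (R K)" a e
          "const_mat (L K) * A * const_mat (R K)"] tri3[OF H(1) c1(1)[OF LR(1)] c2(1)[OF LR(2)], of K K]
        c1(1)[OF LR(1), of K] c2(1)[OF LR(2), of K] c3(1)[OF LR, of K K] H(1) by auto
    also have "\<dots> \<le> \<delta> + ?s * \<delta> + \<delta> * ?s + ?s * \<mu> * ?s"
    proof (intro add_mono)
      show "frob_norm_poly (const_mat (L K) * dB) \<le> ?s * \<delta>"
        using Sn[OF K] \<delta> by (intro order.trans[OF c1(3)[OF LR(1)]] mult_right_mono) auto
      show "frob_norm_poly (dG * const_mat (R K)) \<le> \<delta> * ?s"
        using Sn[OF K] \<delta> by (intro order.trans[OF c2(3)[OF LR(2)]] mult_left_mono) auto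
      show "frob_norm_poly (const_mat (L K) * A * const_mat (R K)) \<le> ?s * \<mu> * ?s"
        using Sn[OF K] \<mu> s0 by (intro order.trans[OF c3(3)[OF LR]] mult_mono) auto
    qed (rule H(3))
    also have "\<dots> = \<delta> * (1 + 5 / 2 * (\<kappa> * \<delta>) + 25 / 16 * (\<kappa>\<^sup>2 * \<delta> * \<mu>))"
      by (simp add: power2_eq_square algebra_simps)
    also have "\<dots> \<le> \<delta> * (5 / 4)" using s1 s2 \<delta> by (intro mult_left_mono) linarith+
    finally show ?thesis using \<Phi>c[of K] by (simp add: S_def \<rho>_def)
  qed
  have lip: "frob_norm_poly (\<Phi> K - \<Phi> K') \<le> 1 / 2 * frob_norm_poly (K - K')" if K: "K \<in> S" "K' \<in> S" for K K'
  proof -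
    have Kc: "K \<in> carrier_mat a e" "K' \<in> carrier_mat a e" "has_grade 1 (K - K')"
      using K by (auto simp: S_def intro: has_grade_minus[of _ a e])
    define k where "k = frob_norm_poly (K - K')"
    have k: "0 \<le> k" by (simp add: k_def)
    define X Y where "X = L K - L K'" and "Y = R K - R K'"
    have X: "X \<in> carrier_mat a b" "frob_norm X \<le> \<kappa> * k" and Y: "Y \<in> carrier_mat c e" "frob_norm Y \<le> \<kappa> * k"
      using LRn[OF Kc(3)] LR by (auto simp: X_def Y_def k_def LRm[OF Kc(1,2), symmetric])
    have m1: "const_mat (L K) * dB - const_mat (L K') * dB = const_mat X * dB"
      unfolding X_def const_mat_minus[OF LR(1) LR(1)]
      by (rule minus_mult_distrib_mat[symmetric]) (use LR dB in simp_all)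
    have m2: "dG * const_mat (R K) - dG * const_mat (R K') = dG * const_mat Y"
      unfolding Y_def const_mat_minus[OF LR(2) LR(2)]
      by (rule mult_minus_distrib_mat[symmetric]) (use LR dG in simp_all)
    \<comment> \<open>The quadratic term is bilinear in \<open>L K\<close> and \<open>R K\<close>;
      its difference is split by changing one factor at a time.\<close>
    have m3: "const_mat (L K) * A * const_mat (R K) - const_mat (L K') * A * const_mat (R K') =
        const_mat X * A * const_mat (R K) + const_mat (L K') * A * const_mat Y"
    proof -
      have "const_mat X * A = const_mat (L K) * A - const_mat (L K') * A"
        unfolding X_def const_mat_minus[OF LR(1) LR(1)]
        by (rule minus_mult_distrib_mat) (use LR A in simp_all)
      then have "const_mat X * A * const_mat (R K) = const_mat (L K) * A * const_mat (R K) - const_mat (L K') * A * const_mat (R K)"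
        using minus_mult_distrib_mat[of "const_mat (L K) * A" a c "const_mat (L K') * A" "const_mat (R K)" e]
          mult_carrier_mat[of "const_mat (L K)" a b A c] mult_carrier_mat[of "const_mat (L K')" a b A c] LR A by simp
      moreover have "const_mat (L K') * A * const_mat Y = const_mat (L K') * A * const_mat (R K) - const_mat (L K') * A * const_mat (R K')"
        unfolding Y_def const_mat_minus[OF LR(2) LR(2)]
        using mult_minus_distrib_mat[of "const_mat (L K') * A" a c "const_mat (R K)" e "const_mat (R K')"]
          mult_carrier_mat[of "const_mat (L K')" a b A c] LR A by simp
      ultimately show ?thesis
        using id2[of H H H "const_mat (L K') * A * const_mat (R K)" H "const_mat (L K) * A * const_mat (R K)"
            "const_mat (L K') * A * const_mat (R K')"] H(1) c3(1)[OF LR] by simp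
    qed
    have "\<Phi> K - \<Phi> K' = - ((const_mat (L K) * dB - const_mat (L K') * dB) + (dG * const_mat (R K) - dG * const_mat (R K'))
       + (const_mat (L K) * A * const_mat (R K) - const_mat (L K') * A * const_mat (R K')))"
      unfolding \<Phi>_def by (intro id1 H(1) c1(1) c2(1) c3(1) LR)
    then have "frob_norm_poly (\<Phi> K - \<Phi> K') = frob_norm_poly (const_mat X * dB + dG * const_mat Y +
        (const_mat X * A * const_mat (R K) + const_mat (L K') * A * const_mat Y))"
      by (simp only: m1 m2 m3 frob_norm_poly_uminus)
    also have "\<dots> \<le> frob_norm_poly (const_mat X * dB) + frob_norm_poly (dG * const_mat Y) +
        (frob_norm_poly (const_mat X * A * const_mat (R K)) + frob_norm_poly (const_mat (L K') * A * const_mat Y))"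
      using tri3[OF c1(1)[OF X(1)] c2(1)[OF Y(1)] add_carrier_mat[OF c3(1)[OF LR(1) Y(1)], of "const_mat X * A * const_mat (R K)" K']]
        frob_norm_poly_triangle[OF c3(1)[OF X(1) LR(2)] c3(1)[OF LR(1) Y(1)], of K K'] by auto
    also have "\<dots> \<le> \<kappa> * k * \<delta> + \<delta> * (\<kappa> * k) + (\<kappa> * k * \<mu> * ?s + ?s * \<mu> * (\<kappa> * k))"
    proof (intro add_mono)
      show "frob_norm_poly (const_mat X * dB) \<le> \<kappa> * k * \<delta>"
        using X \<delta> by (intro order.trans[OF c1(3)[OF X(1)]] mult_right_mono) auto
      show "frob_norm_poly (dG * const_mat Y) \<le> \<delta> * (\<kappa> * k)"
        using Y \<delta> by (intro order.trans[OF c2(3)[OF Y(1)]] mult_left_mono) auto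
      show "frob_norm_poly (const_mat X * A * const_mat (R K)) \<le> \<kappa> * k * \<mu> * ?s"
        using Sn[OF K(1)] X \<mu> s0 \<kappa> k by (intro order.trans[OF c3(3)[OF X(1) LR(2)]] mult_mono) auto
      show "frob_norm_poly (const_mat (L K') * A * const_mat Y) \<le> ?s * \<mu> * (\<kappa> * k)"
        using Sn[OF K(2)] Y \<mu> s0 \<kappa> k by (intro order.trans[OF c3(3)[OF LR(1) Y(1)]] mult_mono) auto
    qed
    also have "\<dots> = (2 * (\<kappa> * \<delta>) + 5 / 2 * (\<kappa>\<^sup>2 * \<delta> * \<mu>)) * k"
      by (simp add: power2_eq_square algebra_simps)
    \<comment> \<open>The bounds \<open>s1\<close> and \<open>s2\<close> give at most
      \<open>1/16 + 9/40\<close>, which is below one half.\<close>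
    also have "\<dots> \<le> 1 / 2 * k" using s1 s2 k by (intro mult_right_mono) linarith+
    finally show ?thesis by (simp add: k_def)
  qed
  have "0 \<le> \<rho>" using \<delta> by (simp add: \<rho>_def)
  from pencil_fixed_point[of a e \<rho> \<Phi> "1 / 2", folded S_def, OF maps lip _ _ this]
  obtain K where K: "K \<in> S" "\<Phi> K = K" by auto
  have Kc: "K \<in> carrier_mat a e" "has_grade 1 K" using K by (auto simp: S_def)
  have sol: "const_mat (L K) * (kron_L \<eta> m)\<^sup>T + kron_L \<epsilon> n * const_mat (R K) = K"
    unfolding L_def R_def by (rule sylv_solves) (use Kc in \<open>simp_all only: a_def e_def\<close>)
  have KLc: "(kron_L \<eta> m)\<^sup>T \<in> carrier_mat b e" "kron_L \<epsilon> n \<in> carrier_mat a c"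
    unfolding a_def b_def c_def e_def by (simp_all only: transpose_carrier_mat kron_L_carrier)
  have d1: "const_mat (L K) * ((kron_L \<eta> m)\<^sup>T + dB) = const_mat (L K) * (kron_L \<eta> m)\<^sup>T + const_mat (L K) * dB"
    by (rule mult_add_distrib_mat) (use LR KLc dB in auto)
  have d2: "(kron_L \<epsilon> n + dG) * const_mat (R K) = kron_L \<epsilon> n * const_mat (R K) + dG * const_mat (R K)"
    by (rule add_mult_distrib_mat) (use LR KLc dG in auto)
  have p: "const_mat (L K) * (kron_L \<eta> m)\<^sup>T \<in> carrier_mat a e" "kron_L \<epsilon> n * const_mat (R K) \<in> carrier_mat a e"
    using LR[of K] KLc by (auto intro: mult_carrier_mat simp del: transpose_carrier_mat)
  have "const_mat (L K) * ((kron_L \<eta> m)\<^sup>T + dB) + (kron_L \<epsilon> n + dG) * const_mat (R K) + H + const_mat (L K) * A * const_mat (R K)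
    = (const_mat (L K) * (kron_L \<eta> m)\<^sup>T + kron_L \<epsilon> n * const_mat (R K)) - \<Phi> K"
    unfolding d1 d2 \<Phi>_def by (rule id3[OF H(1) c1(1)[OF LR(1)] p(1) c2(1)[OF LR(2)] p(2) c3(1)[OF LR] H(1)])
  also have "\<dots> = 0\<^sub>m a e" unfolding sol K(2) using Kc by (intro eq_matI) auto
  finally show ?thesis
    using LR[of K] Sn[OF K(1)] unfolding abce by blast
qed

text \<open>With \<open>N = K Y - Z K\<close> as the unknown the equation becomes
  \<open>N = - dG - dG Y(N)\<close>, which is affine because \<open>Z\<close> multiplies the
  unperturbed pencil only. By \<open>s1\<close> the contraction factor is 1/4, and
  \<open>1 / (1 - 1/4) = 4/3\<close> gives the radius. The bound \<open>s2\<close> then keeps the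
  norm of \<open>Z\<close> at most \<open>1/3 + 4/15\<close>, so that \<open>1 + Z\<close> is
  invertible.\<close>

lemma kron_L_perturbed:
  fixes dG :: "'a::{real_normed_field,euclidean_space} poly mat"
  assumes dG: "dG \<in> carrier_mat (k * n) ((k + 1) * n)" "has_grade 1 dG" "frob_norm_poly dG \<le> g"
    and s1: "sqrt 2 * real k * g \<le> 1 / 4" and s2: "g \<le> 1 / 5"
  shows "\<exists>Y Z. Y \<in> carrier_mat ((k + 1) * n) ((k + 1) * n) \<and> Z \<in> carrier_mat (k * n) (k * n) \<and>
    frob_norm Y \<le> 4 / 3 * (sqrt 2 * real k * g) \<and> frob_norm Z < 1 \<and>
    (kron_L k n + dG) * const_mat (1\<^sub>m ((k + 1) * n) + Y) = const_mat (1\<^sub>m (k * n) + Z) * kron_L k n"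
proof -
  define a c where "a = k * n" and "c = (k + 1) * n"
  note ac = a_def[symmetric] c_def[symmetric]
  define Y Z where "Y = (comm_Y k n :: 'a poly mat \<Rightarrow> _)" and "Z = (comm_Z k n :: 'a poly mat \<Rightarrow> _)"
  define \<kappa> where "\<kappa> = sqrt 2 * real k"
  have \<kappa>: "0 \<le> \<kappa>" by (simp add: \<kappa>_def)
  have dG: "dG \<in> carrier_mat a c" "has_grade 1 dG" "frob_norm_poly dG \<le> g" using dG by (simp_all only: ac)
  have g: "0 \<le> g" using order.trans[OF frob_norm_poly_nonneg dG(3)] .
  have YZ: "Y N \<in> carrier_mat c c" "Z N \<in> carrier_mat a a" for N
    unfolding Y_def Z_def a_def c_def by (rule comm_carrier)+
  have Yn: "frob_norm (Y N) \<le> \<kappa> * frob_norm_poly N" if "has_grade 1 N" for N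
    using comm_Y_norm[OF that] by (simp add: Y_def \<kappa>_def)
  define \<Phi> where "\<Phi> N = - (dG + dG * const_mat (Y N))" for N
  have c2: "dG * const_mat X \<in> carrier_mat a c" "has_grade 1 (dG * const_mat X)"
      "frob_norm_poly (dG * const_mat X) \<le> g * frob_norm X"
    if "X \<in> carrier_mat c c" for X
    using that dG by (auto intro: mult_carrier_mat has_grade_mult_const
        intro!: order.trans[OF frob_norm_poly_mult_const[OF dG(1) that]] mult_right_mono)
  define \<rho> where "\<rho> = 4 / 3 * g"
  define S where "S = {N :: 'a poly mat. N \<in> carrier_mat a c \<and> has_grade 1 N \<and> frob_norm_poly N \<le> \<rho>}"
  have \<Phi>c: "\<Phi> N \<in> carrier_mat a c" "has_grade 1 (\<Phi> N)" for N
    unfolding \<Phi>_def using dG c2[OF YZ(1)]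
    by (auto intro!: add_carrier_mat has_grade_add[of _ a c])
  have SY: "frob_norm (Y N) \<le> 4 / 3 * (\<kappa> * g)" if "N \<in> S" for N
  proof -
    have "has_grade 1 N" "frob_norm_poly N \<le> \<rho>" using that by (auto simp: S_def)
    moreover from this have "\<kappa> * frob_norm_poly N \<le> \<kappa> * \<rho>" using \<kappa> by (intro mult_left_mono)
    ultimately show ?thesis using Yn[of N] by (auto simp: \<rho>_def)
  qed
  have s1': "\<kappa> * g \<le> 1 / 4" using s1 by (simp add: \<kappa>_def)
  have maps: "\<Phi> N \<in> S" if N: "N \<in> S" for N
  proof -
    have "frob_norm_poly (\<Phi> N) \<le> frob_norm_poly dG + frob_norm_poly (dG * const_mat (Y N))"
      unfolding \<Phi>_def frob_norm_poly_uminus by (rule frob_norm_poly_triangle[OF dG(1) c2(1)[OF YZ(1)]])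
    also have "\<dots> \<le> g + g * (4 / 3 * (\<kappa> * g))"
      using SY[OF N] g by (intro add_mono dG(3) order.trans[OF c2(3)[OF YZ(1)]] mult_left_mono)
    also have "\<dots> = g * (1 + 4 / 3 * (\<kappa> * g))" by (simp add: algebra_simps)
    also have "\<dots> \<le> g * (4 / 3)" using s1' g by (intro mult_left_mono) linarith+
    finally show ?thesis using \<Phi>c[of N] by (simp add: S_def \<rho>_def)
  qed
  have id: "- (h + x) - - (h + x') = - (x - x')"
    if "h \<in> carrier_mat a c" "x \<in> carrier_mat a c" "x' \<in> carrier_mat a c" for h x x' :: "'a poly mat"
    using that by (intro eq_matI) auto
  have lip: "frob_norm_poly (\<Phi> N - \<Phi> N') \<le> 1 / 4 * frob_norm_poly (N - N')" if N: "N \<in> S" "N' \<in> S" for N N'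
  proof -
    have Nc: "N \<in> carrier_mat a c" "N' \<in> carrier_mat a c" "has_grade 1 (N - N')"
      using N by (auto simp: S_def intro: has_grade_minus[of _ a c])
    have X: "Y N - Y N' = Y (N - N')"
      using Nc unfolding Y_def a_def c_def by (simp only: comm_Y_minus)
    have "\<Phi> N - \<Phi> N' = - (dG * const_mat (Y N) - dG * const_mat (Y N'))"
      unfolding \<Phi>_def by (intro id dG(1) c2(1) YZ)
    also have "dG * const_mat (Y N) - dG * const_mat (Y N') = dG * const_mat (Y (N - N'))"
      unfolding X[symmetric] const_mat_minus[OF YZ(1) YZ(1)]
      by (rule mult_minus_distrib_mat[symmetric]) (use YZ dG in simp_all)
    finally have "frob_norm_poly (\<Phi> N - \<Phi> N') \<le> g * frob_norm (Y (N - N'))"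
      using c2(3)[OF YZ(1), of "N - N'"] by simp
    also have "\<dots> \<le> g * (\<kappa> * frob_norm_poly (N - N'))" using Yn[OF Nc(3)] g by (intro mult_left_mono)
    also have "\<dots> = \<kappa> * g * frob_norm_poly (N - N')" by simp
    also have "\<dots> \<le> 1 / 4 * frob_norm_poly (N - N')" using s1' by (intro mult_right_mono) auto
    finally show ?thesis .
  qed
  have "0 \<le> \<rho>" using g by (simp add: \<rho>_def)
  from pencil_fixed_point[of a c \<rho> \<Phi> "1 / 4", folded S_def, OF maps lip _ _ this]
  obtain N where N: "N \<in> S" "\<Phi> N = N" by auto
  have Nc: "N \<in> carrier_mat a c" "has_grade 1 N" "frob_norm_poly N \<le> \<rho>" using N by (auto simp: S_def)
  have sol: "kron_L k n * const_mat (Y N) - const_mat (Z N) * kron_L k n = N"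
    unfolding Y_def Z_def by (rule comm_solves) (use Nc in \<open>simp_all only: a_def c_def\<close>)
  have K: "kron_L k n \<in> carrier_mat a c" unfolding a_def c_def by (rule kron_L_carrier)
  have KY: "kron_L k n * const_mat (Y N) \<in> carrier_mat a c" and ZK: "const_mat (Z N) * kron_L k n \<in> carrier_mat a c"
    by (rule mult_carrier_mat[OF K], simp add: YZ) (rule mult_carrier_mat[OF _ K], simp add: YZ)
  have "(kron_L k n + dG) * const_mat (1\<^sub>m c + Y N) = (kron_L k n + dG) + (kron_L k n + dG) * const_mat (Y N)"
    using K dG(1) YZ(1)[of N] unfolding const_mat_add[OF one_carrier_mat YZ(1)] const_mat_one
    by (subst mult_add_distrib_mat[of _ a c _ c]) auto
  also have "\<dots> = (kron_L k n + dG) + (kron_L k n * const_mat (Y N) + dG * const_mat (Y N))"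
    using K dG(1) YZ(1)[of N] by (subst add_mult_distrib_mat[of _ a c]) auto
  also have "\<dots> = kron_L k n + const_mat (Z N) * kron_L k n"
  proof -
    have "x + h + (y + w) = x + z" if "y - z = n" "- (h + w) = n" "x \<in> carrier_mat a c" "h \<in> carrier_mat a c" "y \<in> carrier_mat a c"
      "w \<in> carrier_mat a c" "z \<in> carrier_mat a c" for x h y w z n :: "'a poly mat"
    proof (intro eq_matI)
      fix i j assume ij: "i < dim_row (x + z)" "j < dim_col (x + z)"
      have "(y - z) $$ (i, j) = (- (h + w)) $$ (i, j)" using that(1,2) by simp
      then have "y $$ (i, j) - z $$ (i, j) = - (h $$ (i, j) + w $$ (i, j))" using that(3-7) ij by simp
      then have "h $$ (i, j) + (y $$ (i, j) + w $$ (i, j)) = z $$ (i, j)" by (simp add: algebra_simps)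
      then show "(x + h + (y + w)) $$ (i, j) = (x + z) $$ (i, j)" using that(3-7) ij by (simp add: add.assoc)
    qed (use that in auto)
    from this[OF sol N(2)[unfolded \<Phi>_def] K dG(1) KY c2(1)[OF YZ(1)] ZK] show ?thesis .
  qed
  also have "\<dots> = const_mat (1\<^sub>m a + Z N) * kron_L k n"
    using K YZ(2)[of N] unfolding const_mat_add[OF one_carrier_mat YZ(2)] const_mat_one
    by (subst add_mult_distrib_mat[of _ a a]) auto
  finally have eq: "(kron_L k n + dG) * const_mat (1\<^sub>m c + Y N) = const_mat (1\<^sub>m a + Z N) * kron_L k n" .
  have "frob_norm (Z N) \<le> frob_norm (Y N) + frob_norm_poly N"
    unfolding Y_def Z_def by (rule comm_Z_norm) (use Nc in \<open>simp_all only: a_def c_def\<close>)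
  also have "\<dots> \<le> 4 / 3 * (1 / 4) + 4 / 3 * (1 / 5)"
    using SY[OF N(1)] Nc(3) s1' s2 unfolding \<rho>_def by linarith
  finally have "frob_norm (Z N) < 1" by simp
  then show ?thesis using eq SY[OF N(1)] YZ[of N] unfolding ac \<kappa>_def by blast
qed

section \<open>Invertible constant matrices and strict equivalence\<close>

text \<open>A nonzero \<open>v\<close> in the kernel of \<open>1 + Z\<close> would satisfy
  \<open>Z v = - v\<close>, contradicting submultiplicativity of the norm. It is rewritten as the
  one-column matrix \<open>X\<close> so that \<open>frob_norm_mult\<close> applies.\<close>

lemma one_plus_invertible:
  fixes Z :: "'a::real_normed_field mat"
  assumes Z: "Z \<in> carrier_mat r r" and n: "frob_norm Z < 1"
  shows "\<exists>W \<in> carrier_mat r r. W * (1\<^sub>m r + Z) = 1\<^sub>m r \<and> (1\<^sub>m r + Z) * W = 1\<^sub>m r"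
proof -
  have A: "1\<^sub>m r + Z \<in> carrier_mat r r" using Z by simp
  have "det (1\<^sub>m r + Z) \<noteq> 0"
  proof
    assume "det (1\<^sub>m r + Z) = 0"
    then obtain v where v: "v \<in> carrier_vec r" "v \<noteq> 0\<^sub>v r" "(1\<^sub>m r + Z) *\<^sub>v v = 0\<^sub>v r"
      using det_0_iff_vec_prod_zero_field[OF A] by blast
    define X where "X = mat r 1 (\<lambda>(i, j). v $ i)"
    have X: "X \<in> carrier_mat r 1" by (simp add: X_def)
    have "Z * X = - X"
    proof (rule eq_matI)
      fix i j assume ij: "i < dim_row (- X)" "j < dim_col (- X)"
      then have i: "i < r" "j = 0" by (auto simp: X_def)
      have "col X 0 = v" using v(1) by (intro eq_vecI) (auto simp: X_def)
      then have "(Z * X) $$ (i, j) = row Z i \<bullet> v" using i Z X by simp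
      moreover have "(Z *\<^sub>v v) $ i + v $ i = 0"
      proof -
        have "(1\<^sub>m r + Z) *\<^sub>v v = 1\<^sub>m r *\<^sub>v v + Z *\<^sub>v v" using Z v(1) by (intro add_mult_distrib_mat_vec[of _ r r]) auto
        then have "(1\<^sub>m r *\<^sub>v v + Z *\<^sub>v v) $ i = 0\<^sub>v r $ i" unfolding v(3) by (rule arg_cong[OF sym])
        then show ?thesis using i v(1) Z by (simp add: add.commute)
      qed
      ultimately show "(Z * X) $$ (i, j) = (- X) $$ (i, j)"
        using i Z by (simp add: X_def eq_neg_iff_add_eq_0)
    qed (use Z X in auto)
    then have "frob_norm X \<le> frob_norm Z * frob_norm X" using frob_norm_mult[OF Z X] by simp
    moreover have "frob_norm X > 0"
    proof -
      have "frob_norm_poly (const_mat X) > 0"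
      proof (rule frob_norm_poly_pos)
        show "const_mat X \<in> carrier_mat r 1" using X by simp
        show "const_mat X \<noteq> 0\<^sub>m r 1"
        proof
          assume z: "const_mat X = 0\<^sub>m r 1"
          have "v $ i = 0" if "i < r" for i
            using arg_cong[OF z, of "\<lambda>A. A $$ (i, 0)"] that by (simp add: X_def)
          then show False using v(1,2) by (auto intro: eq_vecI)
        qed
      qed
      then show ?thesis by simp
    qed
    ultimately show False using mult_strict_right_mono[OF n, of "frob_norm X"] by simp
  qed
  then obtain W where "W \<in> carrier_mat r r" "(1\<^sub>m r + Z) * W = 1\<^sub>m r" "W * (1\<^sub>m r + Z) = 1\<^sub>m r"
    using det_non_zero_imp_unit[OF A] unfolding Units_def ring_mat_def by auto
  then show ?thesis by blast
qed

text \<open>The inverse is carried along as a second matrix, so that products, transposes and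
  triangular block matrices are inverted by formula.\<close>

definition inverse_pair :: "nat \<Rightarrow> 'a::semiring_1 mat \<Rightarrow> 'a mat \<Rightarrow> bool" where
  "inverse_pair r X X' \<longleftrightarrow> X \<in> carrier_mat r r \<and> X' \<in> carrier_mat r r \<and> X * X' = 1\<^sub>m r \<and> X' * X = 1\<^sub>m r"

lemma inverse_pair_sym: "inverse_pair r X X' \<Longrightarrow> inverse_pair r X' X"
  by (simp add: inverse_pair_def)

lemma inverse_pair_mult:
  assumes "inverse_pair r X X'" "inverse_pair r Y Y'"
  shows "inverse_pair r (X * Y) (Y' * X')"
proof -
  have c: "X \<in> carrier_mat r r" "X' \<in> carrier_mat r r" "Y \<in> carrier_mat r r" "Y' \<in> carrier_mat r r"
    using assms by (auto simp: inverse_pair_def)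
  have "X * Y * (Y' * X') = X * (Y * Y') * X'"
    using c by (simp add: assoc_mult_mat[of _ r r _ r _ r])
  moreover have "Y' * X' * (X * Y) = Y' * (X' * X) * Y"
    using c by (simp add: assoc_mult_mat[of _ r r _ r _ r])
  ultimately show ?thesis using assms c by (simp add: inverse_pair_def)
qed

lemma inverse_pair_transpose:
  fixes X :: "'a::comm_semiring_1 mat"
  assumes "inverse_pair r X X'"
  shows "inverse_pair r X\<^sup>T X'\<^sup>T"
proof -
  have c: "X \<in> carrier_mat r r" "X' \<in> carrier_mat r r" using assms by (auto simp: inverse_pair_def)
  have "X\<^sup>T * X'\<^sup>T = (X' * X)\<^sup>T" "X'\<^sup>T * X\<^sup>T = (X * X')\<^sup>T"
    by (rule transpose_mult[OF c(2,1), symmetric], rule transpose_mult[OF c, symmetric])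
  then show ?thesis using c assms unfolding inverse_pair_def by (auto simp: transpose_one)
qed

lemma inverse_pair_one: "inverse_pair r (1\<^sub>m r) (1\<^sub>m r)"
  by (simp add: inverse_pair_def)

lemma inverse_pair_diag:
  assumes "inverse_pair r X X'" "inverse_pair s Y Y'"
  shows "inverse_pair (r + s) (four_block_mat X (0\<^sub>m r s) (0\<^sub>m s r) Y) (four_block_mat X' (0\<^sub>m r s) (0\<^sub>m s r) Y')"
proof -
  have c: "X \<in> carrier_mat r r" "X' \<in> carrier_mat r r" "Y \<in> carrier_mat s s" "Y' \<in> carrier_mat s s"
    and e: "X * X' = 1\<^sub>m r" "X' * X = 1\<^sub>m r" "Y * Y' = 1\<^sub>m s" "Y' * Y = 1\<^sub>m s"
    using assms by (auto simp: inverse_pair_def)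
  have "four_block_mat X (0\<^sub>m r s) (0\<^sub>m s r) Y * four_block_mat X' (0\<^sub>m r s) (0\<^sub>m s r) Y' = 1\<^sub>m (r + s)"
    using c e by (subst mult_four_block_mat[OF c(1) _ _ c(3) c(2) _ _ c(4)]) auto
  moreover have "four_block_mat X' (0\<^sub>m r s) (0\<^sub>m s r) Y' * four_block_mat X (0\<^sub>m r s) (0\<^sub>m s r) Y = 1\<^sub>m (r + s)"
    using c e by (subst mult_four_block_mat[OF c(2) _ _ c(4) c(1) _ _ c(3)]) auto
  ultimately show ?thesis using c by (auto simp: inverse_pair_def)
qed

lemma inverse_pair_lower:
  fixes C :: "'a::comm_ring_1 mat"
  assumes C: "C \<in> carrier_mat s r"
  shows "inverse_pair (r + s) (four_block_mat (1\<^sub>m r) (0\<^sub>m r s) C (1\<^sub>m s))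
    (four_block_mat (1\<^sub>m r) (0\<^sub>m r s) (- C) (1\<^sub>m s))"
proof -
  have "four_block_mat (1\<^sub>m r) (0\<^sub>m r s) X (1\<^sub>m s) * four_block_mat (1\<^sub>m r) (0\<^sub>m r s) (- X) (1\<^sub>m s) = 1\<^sub>m (r + s)"
    if X: "X \<in> carrier_mat s r" for X :: "'a mat"
  proof -
    have "X + - X = 0\<^sub>m s r" "- 0\<^sub>m r r = (0\<^sub>m r r :: 'a mat)" using X by (intro eq_matI; auto)+
    then show ?thesis using X by (subst mult_four_block_mat[of _ r r _ s _ s _ _ r _ s]) auto
  qed
  from this[OF C] this[of "- C"] show ?thesis using C by (auto simp: inverse_pair_def)
qed

lemma inverse_pair_upper:
  fixes D :: "'a::comm_ring_1 mat"
  assumes D: "D \<in> carrier_mat r s"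
  shows "inverse_pair (r + s) (four_block_mat (1\<^sub>m r) D (0\<^sub>m s r) (1\<^sub>m s))
    (four_block_mat (1\<^sub>m r) (- D) (0\<^sub>m s r) (1\<^sub>m s))"
proof -
  have *: "(four_block_mat (1\<^sub>m r) (0\<^sub>m r s) X\<^sup>T (1\<^sub>m s))\<^sup>T = four_block_mat (1\<^sub>m r) X (0\<^sub>m s r) (1\<^sub>m s)"
    if "X \<in> carrier_mat r s" for X :: "'a mat"
    using that by (subst transpose_four_block_mat[of _ r r _ s _ s]) auto
  have "- D\<^sup>T = (- D)\<^sup>T" by (intro eq_matI) auto
  then show ?thesis
    using inverse_pair_transpose[OF inverse_pair_lower[of "D\<^sup>T" s r]] D *[OF D] *[of "- D"] by simp
qed

definition strictly_equivalent :: "'a::comm_ring_1 poly mat \<Rightarrow> 'a poly mat \<Rightarrow> bool" where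
  "strictly_equivalent W T \<longleftrightarrow> (\<exists>E E' F F'. inverse_pair (dim_row T) E E' \<and> inverse_pair (dim_col T) F F' \<and>
     W = const_mat E * T * const_mat F)"

lemma strictly_equivalentI:
  assumes "inverse_pair r E E'" "inverse_pair c F F'" "T \<in> carrier_mat r c"
  shows "strictly_equivalent (const_mat E * T * const_mat F) T"
  using assms unfolding strictly_equivalent_def by auto

lemma strictly_equivalent_trans:
  assumes "strictly_equivalent W T" "strictly_equivalent T S"
  shows "strictly_equivalent W S"
proof -
  define r c where "r = dim_row S" and "c = dim_col S"
  have S: "S \<in> carrier_mat r c" by (simp add: r_def c_def)
  obtain E E' F F' where 1: "inverse_pair r E E'" "inverse_pair c F F'" "T = const_mat E * S * const_mat F"
    using assms(2) unfolding strictly_equivalent_def r_def c_def by blast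
  then have Td: "dim_row T = r" "dim_col T = c" by (auto simp: inverse_pair_def)
  obtain G G' H H' where 2: "inverse_pair r G G'" "inverse_pair c H H'" "W = const_mat G * T * const_mat H"
    using assms(1) unfolding strictly_equivalent_def Td by blast
  have c: "const_mat E \<in> carrier_mat r r" "const_mat F \<in> carrier_mat c c" "const_mat G \<in> carrier_mat r r" "const_mat H \<in> carrier_mat c c"
    using 1 2 by (auto simp: inverse_pair_def)
  have "W = const_mat G * (const_mat E * S * const_mat F) * const_mat H" using 1 2 by simp
  also have "\<dots> = const_mat G * const_mat E * S * (const_mat F * const_mat H)"
  proof -
    have ES: "const_mat E * S \<in> carrier_mat r c" using c S by simp
    have GES: "const_mat G * (const_mat E * S) \<in> carrier_mat r c" using c(3) ES by (rule mult_carrier_mat)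
    have "const_mat G * (const_mat E * S * const_mat F) = const_mat G * (const_mat E * S) * const_mat F"
      by (rule assoc_mult_mat[OF c(3) ES c(2), symmetric])
    then show ?thesis
      using assoc_mult_mat[OF GES c(2) c(4)] assoc_mult_mat[OF c(3) c(1) S] by simp
  qed
  also have "\<dots> = const_mat (G * E) * S * const_mat (F * H)"
    using 1 2 by (simp add: inverse_pair_def const_mat_mult[of _ r r _ r] const_mat_mult[of _ c c _ c])
  finally show ?thesis
    using strictly_equivalentI[OF inverse_pair_mult[OF 2(1) 1(1)] inverse_pair_mult[OF 1(2) 2(2)] S] by simp
qed

lemma strictly_equivalent_sym:
  assumes "strictly_equivalent W T"
  shows "strictly_equivalent T W"
proof -
  define r c where "r = dim_row T" and "c = dim_col T"
  have T: "T \<in> carrier_mat r c" by (simp add: r_def c_def)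
  obtain E E' F F' where 1: "inverse_pair r E E'" "inverse_pair c F F'" "W = const_mat E * T * const_mat F"
    using assms unfolding strictly_equivalent_def r_def c_def by blast
  have c: "E \<in> carrier_mat r r" "F \<in> carrier_mat c c" "E' \<in> carrier_mat r r" "F' \<in> carrier_mat c c"
    using 1 by (auto simp: inverse_pair_def)
  have W: "W \<in> carrier_mat r c" using 1(3) T c by auto
  have ET: "const_mat E * T \<in> carrier_mat r c" using c T by auto
  have "const_mat E' * W * const_mat F' = const_mat E' * (const_mat E * T * (const_mat F * const_mat F'))"
    unfolding 1(3) using assoc_mult_mat[of "const_mat E'" r r "const_mat E * T * const_mat F" c "const_mat F'" c]
      assoc_mult_mat[OF ET, of "const_mat F" c "const_mat F'" c] W c 1(3) by simp
  also have "const_mat F * const_mat F' = 1\<^sub>m c"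
    using 1(2) const_mat_mult[OF c(2) c(4)] by (simp add: inverse_pair_def)
  also have "const_mat E' * (const_mat E * T * 1\<^sub>m c) = const_mat E' * const_mat E * T"
    using ET assoc_mult_mat[of "const_mat E'" r r "const_mat E" r T c] c T by simp
  also have "const_mat E' * const_mat E = 1\<^sub>m r"
    using 1(1) const_mat_mult[OF c(3) c(1)] by (simp add: inverse_pair_def)
  finally have "const_mat E' * W * const_mat F' = T" using T by simp
  then show ?thesis
    using strictly_equivalentI[OF inverse_pair_sym[OF 1(1)] inverse_pair_sym[OF 1(2)] W] by simp
qed

lemma diag_mult_four_block_mat:
  fixes A :: "'a::semiring_1 mat"
  assumes "X \<in> carrier_mat b b" "Y \<in> carrier_mat a a"
    "A \<in> carrier_mat b c" "B \<in> carrier_mat b e" "C \<in> carrier_mat a c" "D \<in> carrier_mat a e"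
  shows "four_block_mat X (0\<^sub>m b a) (0\<^sub>m a b) Y * four_block_mat A B C D = four_block_mat (X * A) (X * B) (Y * C) (Y * D)"
  using assms by (subst mult_four_block_mat[of _ b b _ a _ a _ _ c _ e]) auto

lemma four_block_mat_mult_diag:
  fixes A :: "'a::semiring_1 mat"
  assumes "X \<in> carrier_mat c c" "Y \<in> carrier_mat e e"
    "A \<in> carrier_mat b c" "B \<in> carrier_mat b e" "C \<in> carrier_mat a c" "D \<in> carrier_mat a e"
  shows "four_block_mat A B C D * four_block_mat X (0\<^sub>m c e) (0\<^sub>m e c) Y = four_block_mat (A * X) (B * Y) (C * X) (D * Y)"
  using assms by (subst mult_four_block_mat[of _ b c _ e _ a _ _ c _ e]) auto

lemma lower_mult_four_block_mat:
  fixes A :: "'a::semiring_1 mat"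
  assumes "X \<in> carrier_mat a b"
    "A \<in> carrier_mat b c" "B \<in> carrier_mat b e" "C \<in> carrier_mat a c" "D \<in> carrier_mat a e"
  shows "four_block_mat (1\<^sub>m b) (0\<^sub>m b a) X (1\<^sub>m a) * four_block_mat A B C D = four_block_mat A B (X * A + C) (X * B + D)"
  using assms by (subst mult_four_block_mat[of _ b b _ a _ a _ _ c _ e]) auto

lemma four_block_mat_mult_upper:
  fixes A :: "'a::semiring_1 mat"
  assumes "X \<in> carrier_mat c e"
    "A \<in> carrier_mat b c" "B \<in> carrier_mat b e" "C \<in> carrier_mat a c" "D \<in> carrier_mat a e"
  shows "four_block_mat A B C D * four_block_mat (1\<^sub>m c) X (0\<^sub>m e c) (1\<^sub>m e) = four_block_mat A (A * X + B) C (C * X + D)"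
  using assms by (subst mult_four_block_mat[of _ b c _ e _ a _ _ c _ e]) auto

text \<open>Block elimination with \<open>C\<close> and \<open>D\<close> makes the (2,2) block zero
  by \<open>zero\<close>. After that, \<open>S\<close> and \<open>R\<close> act on the first block
  row and column, while \<open>R2\<close> and \<open>S2\<close> act on the target instead; this
  matches \<open>eqB\<close> and \<open>eqG\<close> as they stand, and no inverse has to be moved
  across a product.\<close>

lemma strictly_equivalent_four_block:
  fixes A :: "'a::comm_ring_1 poly mat"
  assumes A: "A \<in> carrier_mat b c" and B: "B \<in> carrier_mat b e" and G: "G \<in> carrier_mat a c" and H: "H \<in> carrier_mat a e"
    and Kb: "Kb \<in> carrier_mat b e" and Kg: "Kg \<in> carrier_mat a c"
    and C: "C \<in> carrier_mat a b" and D: "D \<in> carrier_mat c e"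
    and zero: "const_mat C * B + G * const_mat D + H + const_mat C * A * const_mat D = 0\<^sub>m a e"
    and S: "inverse_pair b S S'" and R: "inverse_pair c R R'"
    and S2: "inverse_pair e S2 S2'" and R2: "inverse_pair a R2 R2'"
    and eqB: "const_mat S * (B + A * const_mat D) = Kb * const_mat S2"
    and eqG: "(G + const_mat C * A) * const_mat R = const_mat R2 * Kg"
  shows "strictly_equivalent (four_block_mat A B G H) (four_block_mat (const_mat S * A * const_mat R) Kb Kg (0\<^sub>m a e))"
proof -
  let ?W = "four_block_mat A B G H"
  let ?T = "four_block_mat (const_mat S * A * const_mat R) Kb Kg (0\<^sub>m a e)"
  define CA AD where "CA = const_mat C * A" and "AD = A * const_mat D"
  define W1 where "W1 = four_block_mat A (B + AD) (G + CA) (0\<^sub>m a e)"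
  have c: "S \<in> carrier_mat b b" "R \<in> carrier_mat c c" "S2 \<in> carrier_mat e e" "R2 \<in> carrier_mat a a"
    using S R S2 R2 by (auto simp: inverse_pair_def)
  have CA: "CA \<in> carrier_mat a c" and AD: "AD \<in> carrier_mat b e"
    using A C D by (auto simp: CA_def AD_def)
  have CB: "const_mat C * B \<in> carrier_mat a e" and GD: "G * const_mat D \<in> carrier_mat a e"
    and CAD: "CA * const_mat D \<in> carrier_mat a e"
    using B C D G CA by auto
  have W: "?W \<in> carrier_mat (b + a) (c + e)" using A H by simp
  have step1: "const_mat (four_block_mat (1\<^sub>m b) (0\<^sub>m b a) C (1\<^sub>m a)) * ?W * const_mat (four_block_mat (1\<^sub>m c) D (0\<^sub>m e c) (1\<^sub>m e)) = W1"
  proof -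
    have CG: "CA + G \<in> carrier_mat a c" and CH: "const_mat C * B + H \<in> carrier_mat a e"
      using G H by (auto intro: add_carrier_mat)
    have "const_mat (four_block_mat (1\<^sub>m b) (0\<^sub>m b a) C (1\<^sub>m a)) * ?W = four_block_mat A B (CA + G) (const_mat C * B + H)"
      unfolding const_mat_four_block[OF one_carrier_mat zero_carrier_mat C one_carrier_mat] const_mat_one const_mat_zero CA_def
      using A B C G H by (intro lower_mult_four_block_mat) simp_all
    moreover have "four_block_mat A B (CA + G) (const_mat C * B + H) * const_mat (four_block_mat (1\<^sub>m c) D (0\<^sub>m e c) (1\<^sub>m e))
        = four_block_mat A (AD + B) (CA + G) ((CA + G) * const_mat D + (const_mat C * B + H))"
      unfolding const_mat_four_block[OF one_carrier_mat D zero_carrier_mat one_carrier_mat] const_mat_one const_mat_zero AD_def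
      using A B D CG CH by (intro four_block_mat_mult_upper) simp_all
    moreover have "(CA + G) * const_mat D + (const_mat C * B + H) = 0\<^sub>m a e"
    proof -
      have "(CA + G) * const_mat D = CA * const_mat D + G * const_mat D"
        using CA G D by (intro add_mult_distrib_mat) auto
      moreover have sw: "p + q + (r + s) = r + q + s + p"
        if "p \<in> carrier_mat a e" "q \<in> carrier_mat a e" "r \<in> carrier_mat a e" "s \<in> carrier_mat a e" for p q r s :: "'a poly mat"
        using that by (intro eq_matI) auto
      ultimately have "(CA + G) * const_mat D + (const_mat C * B + H) =
          const_mat C * B + G * const_mat D + H + CA * const_mat D"
        by (simp only: sw[OF CAD GD CB H])
      then show ?thesis by (simp only: zero[folded CA_def])
    qed
    moreover have "AD + B = B + AD" "CA + G = G + CA" using AD B CA G by (auto intro: comm_add_mat)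
    ultimately show ?thesis by (simp add: W1_def)
  qed
  have W1c: "W1 \<in> carrier_mat (b + a) (c + e)" using A unfolding W1_def by (auto intro: four_block_carrier_mat)
  have SA: "const_mat S * A \<in> carrier_mat b c" using c A by auto
  have SAR: "const_mat S * A * const_mat R \<in> carrier_mat b c" using c SA by auto
  have T: "?T \<in> carrier_mat (b + a) (c + e)" using SAR by (auto intro: four_block_carrier_mat)
  \<comment> \<open>The common value of both sides: it arises from \<open>W1\<close> through
    \<open>S\<close> and \<open>R\<close>, and from the target through \<open>R2\<close> and
    \<open>S2\<close>.\<close>
  define W2 where "W2 = four_block_mat (const_mat S * A * const_mat R) (const_mat S * (B + AD)) ((G + CA) * const_mat R) (0\<^sub>m a e)"
  have BA: "B + AD \<in> carrier_mat b e" "G + CA \<in> carrier_mat a c" using AD CA by auto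
  have SB: "const_mat S * (B + AD) \<in> carrier_mat b e" using BA c by (auto intro!: mult_carrier_mat)
  have step2: "const_mat (four_block_mat S (0\<^sub>m b a) (0\<^sub>m a b) (1\<^sub>m a)) * W1 * const_mat (four_block_mat R (0\<^sub>m c e) (0\<^sub>m e c) (1\<^sub>m e)) = W2"
  proof -
    have "const_mat (four_block_mat S (0\<^sub>m b a) (0\<^sub>m a b) (1\<^sub>m a)) * W1 =
        four_block_mat (const_mat S * A) (const_mat S * (B + AD)) (1\<^sub>m a * (G + CA)) (1\<^sub>m a * 0\<^sub>m a e)"
      unfolding W1_def const_mat_four_block[OF c(1) zero_carrier_mat zero_carrier_mat one_carrier_mat] const_mat_one const_mat_zero
      by (rule diag_mult_four_block_mat[OF _ one_carrier_mat A BA zero_carrier_mat]) (simp add: c)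
    also have "\<dots> = four_block_mat (const_mat S * A) (const_mat S * (B + AD)) (G + CA) (0\<^sub>m a e)"
      unfolding left_mult_one_mat[OF BA(2)] by simp
    also have "\<dots> * const_mat (four_block_mat R (0\<^sub>m c e) (0\<^sub>m e c) (1\<^sub>m e)) =
      four_block_mat (const_mat S * A * const_mat R) (const_mat S * (B + AD) * 1\<^sub>m e) ((G + CA) * const_mat R) (0\<^sub>m a e * 1\<^sub>m e)"
      unfolding const_mat_four_block[OF c(2) zero_carrier_mat zero_carrier_mat one_carrier_mat] const_mat_one const_mat_zero
      by (rule four_block_mat_mult_diag[OF _ one_carrier_mat SA SB BA(2) zero_carrier_mat]) (simp add: c)
    also have "\<dots> = W2" unfolding right_mult_one_mat[OF SB] by (simp add: W2_def)
    finally show ?thesis .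
  qed
  have step3: "const_mat (four_block_mat (1\<^sub>m b) (0\<^sub>m b a) (0\<^sub>m a b) R2) * ?T * const_mat (four_block_mat (1\<^sub>m c) (0\<^sub>m c e) (0\<^sub>m e c) S2) = W2"
  proof -
    have RK: "const_mat R2 * Kg \<in> carrier_mat a c" and KS: "Kb * const_mat S2 \<in> carrier_mat b e" using c Kg Kb by auto
    have "const_mat (four_block_mat (1\<^sub>m b) (0\<^sub>m b a) (0\<^sub>m a b) R2) * ?T =
        four_block_mat (1\<^sub>m b * (const_mat S * A * const_mat R)) (1\<^sub>m b * Kb) (const_mat R2 * Kg) (const_mat R2 * 0\<^sub>m a e)"
      unfolding const_mat_four_block[OF one_carrier_mat zero_carrier_mat zero_carrier_mat c(4)] const_mat_one const_mat_zero
      by (rule diag_mult_four_block_mat[OF one_carrier_mat _ SAR Kb Kg zero_carrier_mat]) (simp add: c)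
    also have "\<dots> = four_block_mat (const_mat S * A * const_mat R) Kb (const_mat R2 * Kg) (0\<^sub>m a e)"
      unfolding left_mult_one_mat[OF SAR] left_mult_one_mat[OF Kb] using c by simp
    finally have "const_mat (four_block_mat (1\<^sub>m b) (0\<^sub>m b a) (0\<^sub>m a b) R2) * ?T = \<dots>" .
    moreover have "four_block_mat (const_mat S * A * const_mat R) Kb (const_mat R2 * Kg) (0\<^sub>m a e) * const_mat (four_block_mat (1\<^sub>m c) (0\<^sub>m c e) (0\<^sub>m e c) S2)
        = four_block_mat (const_mat S * A * const_mat R * 1\<^sub>m c) (Kb * const_mat S2) (const_mat R2 * Kg * 1\<^sub>m c) (0\<^sub>m a e * const_mat S2)"
      unfolding const_mat_four_block[OF one_carrier_mat zero_carrier_mat zero_carrier_mat c(3)] const_mat_one const_mat_zero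
      by (rule four_block_mat_mult_diag[OF one_carrier_mat _ SAR Kb RK zero_carrier_mat]) (simp add: c)
    moreover have "\<dots> = four_block_mat (const_mat S * A * const_mat R) (Kb * const_mat S2) (const_mat R2 * Kg) (0\<^sub>m a e)"
      unfolding right_mult_one_mat[OF SAR] right_mult_one_mat[OF RK] using c by simp
    ultimately show ?thesis unfolding W2_def using eqB[folded AD_def] eqG[folded CA_def] by simp
  qed
  have "strictly_equivalent W1 ?W"
    using strictly_equivalentI[OF inverse_pair_lower[OF C] inverse_pair_upper[OF D] W] step1 by simp
  then have 1: "strictly_equivalent ?W W1" by (rule strictly_equivalent_sym)
  have "strictly_equivalent W2 W1"
    using strictly_equivalentI[OF inverse_pair_diag[OF S inverse_pair_one] inverse_pair_diag[OF R inverse_pair_one] W1c] step2 by simp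
  then have 2: "strictly_equivalent W1 W2" by (rule strictly_equivalent_sym)
  have 3: "strictly_equivalent W2 ?T"
    using strictly_equivalentI[OF inverse_pair_diag[OF inverse_pair_one R2] inverse_pair_diag[OF inverse_pair_one S2] T] step3 by simp
  show ?thesis using strictly_equivalent_trans[OF strictly_equivalent_trans[OF 1 2] 3] .
qed

section \<open>Block diagonalization by unimodular matrices\<close>

text \<open>Block rows and block columns are kept as separate factors, so that a product of three
  block rows with three block columns can be checked block by block in
  \<open>three_by_three\<close>.\<close>

definition hcat :: "'a mat \<Rightarrow> 'a mat \<Rightarrow> 'a mat" where
  "hcat A B = mat (dim_row A) (dim_col A + dim_col B)
     (\<lambda>(i, j). if j < dim_col A then A $$ (i, j) else B $$ (i, j - dim_col A))"

definition vcat :: "'a mat \<Rightarrow> 'a mat \<Rightarrow> 'a mat" where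
  "vcat A B = mat (dim_row A + dim_row B) (dim_col A)
     (\<lambda>(i, j). if i < dim_row A then A $$ (i, j) else B $$ (i - dim_row A, j))"

lemma hcat_carrier: "A \<in> carrier_mat r c1 \<Longrightarrow> B \<in> carrier_mat r c2 \<Longrightarrow> hcat A B \<in> carrier_mat r (c1 + c2)"
  by (auto simp: hcat_def)

lemma vcat_carrier: "A \<in> carrier_mat r1 c \<Longrightarrow> B \<in> carrier_mat r2 c \<Longrightarrow> vcat A B \<in> carrier_mat (r1 + r2) c"
  by (auto simp: vcat_def)

lemma four_block_eq_cat:
  assumes "A \<in> carrier_mat r1 c1" "B \<in> carrier_mat r1 c2" "C \<in> carrier_mat r2 c1" "D \<in> carrier_mat r2 c2"
  shows "four_block_mat A B C D = vcat (hcat A B) (hcat C D)"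
  using assms by (intro eq_matI) (auto simp: vcat_def hcat_def)

lemma vcat_mult:
  assumes "A \<in> carrier_mat r1 l" "B \<in> carrier_mat r2 l" "X \<in> carrier_mat l c"
  shows "vcat A B * X = vcat (A * X) (B * X)"
proof (rule eq_matI)
  fix i j assume "i < dim_row (vcat (A * X) (B * X))" "j < dim_col (vcat (A * X) (B * X))"
  then have ij: "i < r1 + r2" "j < c" using assms by (auto simp: vcat_def)
  show "(vcat A B * X) $$ (i, j) = vcat (A * X) (B * X) $$ (i, j)"
  proof (cases "i < r1")
    case True
    then have "row (vcat A B) i = row A i" using assms by (intro eq_vecI) (auto simp: vcat_def)
    then show ?thesis using True ij assms by (simp add: vcat_def)
  next
    case False
    then have "row (vcat A B) i = row B (i - r1)" using assms ij by (intro eq_vecI) (auto simp: vcat_def)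
    then show ?thesis using False ij assms by (simp add: vcat_def)
  qed
qed (use assms in \<open>auto simp: vcat_def\<close>)

lemma mult_hcat:
  assumes "X \<in> carrier_mat r l" "A \<in> carrier_mat l c1" "B \<in> carrier_mat l c2"
  shows "X * hcat A B = hcat (X * A) (X * B)"
proof (rule eq_matI)
  fix i j assume "i < dim_row (hcat (X * A) (X * B))" "j < dim_col (hcat (X * A) (X * B))"
  then have ij: "i < r" "j < c1 + c2" using assms by (auto simp: hcat_def)
  show "(X * hcat A B) $$ (i, j) = hcat (X * A) (X * B) $$ (i, j)"
  proof (cases "j < c1")
    case True
    then have "col (hcat A B) j = col A j" using assms by (intro eq_vecI) (auto simp: hcat_def)
    then show ?thesis using True ij assms by (simp add: hcat_def)
  next
    case False
    then have "col (hcat A B) j = col B (j - c1)" using assms ij by (intro eq_vecI) (auto simp: hcat_def)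
    then show ?thesis using False ij assms by (simp add: hcat_def)
  qed
qed (use assms in \<open>auto simp: hcat_def\<close>)

lemma hcat_mult_vcat:
  fixes A :: "'a::semiring_0 mat"
  assumes "A \<in> carrier_mat r l1" "B \<in> carrier_mat r l2" "C \<in> carrier_mat l1 c" "D \<in> carrier_mat l2 c"
  shows "hcat A B * vcat C D = A * C + B * D"
proof (rule eq_matI)
  fix i j assume "i < dim_row (A * C + B * D)" "j < dim_col (A * C + B * D)"
  then have ij: "i < r" "j < c" using assms by auto
  have "row (hcat A B) i = row A i @\<^sub>v row B i" "col (vcat C D) j = col C j @\<^sub>v col D j"
    using assms ij by (intro eq_vecI; auto simp: hcat_def vcat_def)+
  moreover have "(row A i @\<^sub>v row B i) \<bullet> (col C j @\<^sub>v col D j) = row A i \<bullet> col C j + row B i \<bullet> col D j"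
    using assms ij by (intro scalar_prod_append[of _ l1 _ l2]) auto
  ultimately show "(hcat A B * vcat C D) $$ (i, j) = (A * C + B * D) $$ (i, j)"
    using assms ij by (simp add: hcat_def vcat_def)
qed (use assms in \<open>auto simp: hcat_def vcat_def\<close>)

lemma hcat_add:
  assumes "A \<in> carrier_mat r c1" "B \<in> carrier_mat r c2" "A' \<in> carrier_mat r c1" "B' \<in> carrier_mat r c2"
  shows "hcat A B + hcat A' B' = hcat (A + A') (B + B')"
  using assms by (intro eq_matI) (auto simp: hcat_def)

lemma block_diag_three:
  assumes "Q \<in> carrier_mat m n"
  shows "vcat (hcat (1\<^sub>m p) (hcat (0\<^sub>m p q) (0\<^sub>m p n)))
      (vcat (hcat (0\<^sub>m q p) (hcat (1\<^sub>m q) (0\<^sub>m q n))) (hcat (0\<^sub>m m p) (hcat (0\<^sub>m m q) Q)))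
    = four_block_mat (1\<^sub>m (p + q)) (0\<^sub>m (p + q) n) (0\<^sub>m m (p + q)) Q"
    (is "?l = ?r")
proof (rule eq_matI)
  fix i j assume "i < dim_row ?r" "j < dim_col ?r"
  then have "i < p + q + m" "j < p + q + n" using assms by auto
  then show "?l $$ (i, j) = ?r $$ (i, j)"
    using assms unfolding vcat_def hcat_def
    by (cases "i < p"; cases "i < p + q"; cases "j < p"; cases "j < p + q"; simp add: less_diff_conv2; linarith?)
qed (use assms in \<open>simp_all add: vcat_def hcat_def\<close>)

text \<open>With a polynomial inverse the determinant divides 1, hence is a nonzero
  constant.\<close>

lemma unimodularI:
  fixes U :: "'a::field poly mat"
  assumes U: "U \<in> carrier_mat k k" and U': "U' \<in> carrier_mat k k" and e: "U * U' = 1\<^sub>m k"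
  shows "unimodular k U" "unimodular k U'"
proof -
  have "det U * det U' = 1" using det_mult[OF U U'] e by simp
  then have "det U dvd 1" "det U' dvd 1" by (metis dvdI, metis dvdI mult.commute)
  then show "unimodular k U" "unimodular k U'"
    using U U' unfolding unimodular_def by (auto simp: is_unit_poly_iff dvd_field_iff)
qed

lemma mult_uminus_mat:
  fixes A B :: "'a::comm_ring_1 mat"
  assumes "A \<in> carrier_mat r l" "B \<in> carrier_mat l s"
  shows "A * (- B) = - (A * B)" "(- A) * B = - (A * B)"
  using assms by auto

section \<open>Pencils built from pairs of dual bases\<close>

text \<open>\<open>K\<close> stacked on \<open>J\<close> is inverse to \<open>N\<close> next to
  \<open>\<Lambda>\<close>; thus \<open>\<Lambda>\<close> spans the kernel of \<open>K\<close> and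
  is completed to a unimodular matrix. The second family is the transposed situation:
  \<open>N2\<close> stacked on \<open>\<Lambda>2\<close> is inverse to \<open>K2\<close> next to
  \<open>J2\<close>. In this abstract form the argument serves a block Kronecker pencil and its
  reversal alike.\<close>

locale dual_blocks =
  fixes a b c e m n :: nat
    and K N \<Lambda> J K2 N2 \<Lambda>2 J2 :: "'a::field poly mat"
  assumes dims: "c = a + n" "b = e + m"
    and K: "K \<in> carrier_mat a c" and N: "N \<in> carrier_mat c a"
    and \<Lambda>: "\<Lambda> \<in> carrier_mat c n" and J: "J \<in> carrier_mat n c"
    and KN: "K * N = 1\<^sub>m a" and K\<Lambda>: "K * \<Lambda> = 0\<^sub>m a n" and JN: "J * N = 0\<^sub>m n a"
    and J\<Lambda>: "J * \<Lambda> = 1\<^sub>m n" and complete1: "N * K + \<Lambda> * J = 1\<^sub>m c"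
    and K2: "K2 \<in> carrier_mat b e" and N2: "N2 \<in> carrier_mat e b"
    and \<Lambda>2: "\<Lambda>2 \<in> carrier_mat m b" and J2: "J2 \<in> carrier_mat b m"
    and NK2: "N2 * K2 = 1\<^sub>m e" and \<Lambda>K2: "\<Lambda>2 * K2 = 0\<^sub>m m e" and NJ2: "N2 * J2 = 0\<^sub>m e m"
    and \<Lambda>J2: "\<Lambda>2 * J2 = 1\<^sub>m m" and complete2: "K2 * N2 + J2 * \<Lambda>2 = 1\<^sub>m b"
begin

context
  fixes M :: "'a poly mat"
  assumes M: "M \<in> carrier_mat b c"
begin

text \<open>\<open>W\<close>, \<open>X\<close>, \<open>T\<close> and \<open>Q\<close> are the four
  blocks of \<open>M\<close> in the coordinates given by \<open>N2\<close>,
  \<open>\<Lambda>2\<close> on the left and \<open>N\<close>, \<open>\<Lambda>\<close> on the right.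
  The first three can be eliminated against identity blocks; \<open>Q\<close> survives and is the
  matrix polynomial.\<close>

definition "MN = M * N"
definition "M\<Lambda> = M * \<Lambda>"
definition "W = N2 * MN"
definition "X = N2 * M\<Lambda>"
definition "T = \<Lambda>2 * MN"
definition "Q = \<Lambda>2 * M\<Lambda>"

lemma product_carriers:
  "MN \<in> carrier_mat b a" "M\<Lambda> \<in> carrier_mat b n" "W \<in> carrier_mat e a" "X \<in> carrier_mat e n"
  "T \<in> carrier_mat m a" "Q \<in> carrier_mat m n"
  unfolding MN_def M\<Lambda>_def W_def X_def T_def Q_def
  by (rule mult_carrier_mat[OF M N] mult_carrier_mat[OF M \<Lambda>] mult_carrier_mat[OF N2 mult_carrier_mat[OF M N]]
    mult_carrier_mat[OF N2 mult_carrier_mat[OF M \<Lambda>]] mult_carrier_mat[OF \<Lambda>2 mult_carrier_mat[OF M N]]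
    mult_carrier_mat[OF \<Lambda>2 mult_carrier_mat[OF M \<Lambda>]])+

lemma dual_cancel: "N2 * (K2 * W) = W" "N2 * (K2 * X) = X"
  "\<Lambda>2 * (K2 * W) = 0\<^sub>m m a" "\<Lambda>2 * (K2 * X) = 0\<^sub>m m n"
  using assoc_mult_mat[OF N2 K2 product_carriers(3)] assoc_mult_mat[OF N2 K2 product_carriers(4)]
    assoc_mult_mat[OF \<Lambda>2 K2 product_carriers(3)] assoc_mult_mat[OF \<Lambda>2 K2 product_carriers(4)] NK2 \<Lambda>K2 product_carriers by auto

definition "pencil_L = four_block_mat M K2 K (0\<^sub>m a e)"
text \<open>Block rows and columns of the unimodular factors: \<open>N2\<close> and \<open>N\<close>
  turn \<open>K2\<close> and \<open>K\<close> into identities, and the entries \<open>- T\<close>,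
  \<open>- W\<close>, \<open>- X\<close> clear the unwanted blocks of \<open>M\<close>.\<close>

definition "row1 = hcat N2 (0\<^sub>m e a)"
definition "row2 = hcat (0\<^sub>m a b) (1\<^sub>m a)"
definition "row3 = hcat \<Lambda>2 (- T)"
definition "col1 = vcat (0\<^sub>m c e) (1\<^sub>m e)"
definition "col2 = vcat N (- W)"
definition "col3 = vcat \<Lambda> (- X)"

lemma block_carriers:
  "row1 \<in> carrier_mat e (b + a)" "row2 \<in> carrier_mat a (b + a)" "row3 \<in> carrier_mat m (b + a)"
  "col1 \<in> carrier_mat (c + e) e" "col2 \<in> carrier_mat (c + e) a" "col3 \<in> carrier_mat (c + e) n"
  "pencil_L \<in> carrier_mat (b + a) (c + e)"
  unfolding row1_def row2_def row3_def col1_def col2_def col3_def pencil_L_def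
  by (intro hcat_carrier vcat_carrier four_block_carrier_mat N N2 \<Lambda> \<Lambda>2 M K K2 zero_carrier_mat one_carrier_mat
    uminus_carrier_mat product_carriers)+

lemma pencil_L_mult_vcat:
  assumes "x \<in> carrier_mat c k" "y \<in> carrier_mat e k"
  shows "pencil_L * vcat x y = vcat (M * x + K2 * y) (K * x)"
proof -
  have "pencil_L * vcat x y = vcat (hcat M K2 * vcat x y) (hcat K (0\<^sub>m a e) * vcat x y)"
    unfolding pencil_L_def four_block_eq_cat[OF M K2 K zero_carrier_mat]
    by (rule vcat_mult[OF hcat_carrier[OF M K2] hcat_carrier[OF K zero_carrier_mat] vcat_carrier[OF assms]])
  also have "hcat M K2 * vcat x y = M * x + K2 * y" by (rule hcat_mult_vcat[OF M K2 assms])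
  also have "hcat K (0\<^sub>m a e) * vcat x y = K * x + 0\<^sub>m a e * y" by (rule hcat_mult_vcat[OF K zero_carrier_mat assms])
  also have "\<dots> = K * x" using assms K by auto
  finally show ?thesis .
qed

lemma pencil_L_mult_cols:
  "pencil_L * col1 = vcat K2 (0\<^sub>m a e)"
  "pencil_L * col2 = vcat (MN - K2 * W) (1\<^sub>m a)"
  "pencil_L * col3 = vcat (M\<Lambda> - K2 * X) (0\<^sub>m a n)"
proof -
  have mi: "A + - B = A - B" if "A \<in> carrier_mat r s" "B \<in> carrier_mat r s" for A B :: "'a poly mat" and r s
    using that by (intro eq_matI) auto
  show "pencil_L * col1 = vcat K2 (0\<^sub>m a e)"
    unfolding col1_def by (subst pencil_L_mult_vcat) (use M K K2 in auto)
  show "pencil_L * col2 = vcat (MN - K2 * W) (1\<^sub>m a)"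
    unfolding col2_def using product_carriers K2
    by (subst pencil_L_mult_vcat[OF N])
      (auto simp: KN MN_def[symmetric] mult_uminus_mat[OF K2 product_carriers(3)] mi[OF product_carriers(1) mult_carrier_mat[OF K2 product_carriers(3)]])
  show "pencil_L * col3 = vcat (M\<Lambda> - K2 * X) (0\<^sub>m a n)"
    unfolding col3_def using product_carriers K2
    by (subst pencil_L_mult_vcat[OF \<Lambda>])
      (auto simp: K\<Lambda> M\<Lambda>_def[symmetric] mult_uminus_mat[OF K2 product_carriers(4)] mi[OF product_carriers(2) mult_carrier_mat[OF K2 product_carriers(4)]])
qed

lemma block_diagonalization_entries:
  "row1 * (pencil_L * col1) = 1\<^sub>m e" "row1 * (pencil_L * col2) = 0\<^sub>m e a" "row1 * (pencil_L * col3) = 0\<^sub>m e n"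
  "row2 * (pencil_L * col1) = 0\<^sub>m a e" "row2 * (pencil_L * col2) = 1\<^sub>m a" "row2 * (pencil_L * col3) = 0\<^sub>m a n"
  "row3 * (pencil_L * col1) = 0\<^sub>m m e" "row3 * (pencil_L * col2) = 0\<^sub>m m a" "row3 * (pencil_L * col3) = Q"
proof -
  have KW: "K2 * W \<in> carrier_mat b a" "K2 * X \<in> carrier_mat b n" using K2 product_carriers by auto
  have d: "MN - K2 * W \<in> carrier_mat b a" "M\<Lambda> - K2 * X \<in> carrier_mat b n" using KW by (auto intro: minus_carrier_mat)
  have z: "A - A = 0\<^sub>m r s" if "A \<in> carrier_mat r s" for A :: "'a poly mat" and r s
    using that by (intro eq_matI) auto
  have z2: "A - 0\<^sub>m r s = A" "A + - A = 0\<^sub>m r s" if "A \<in> carrier_mat r s" for A :: "'a poly mat" and r s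
    using that by (intro eq_matI; auto)+
  have s: "N2 * (MN - K2 * W) = 0\<^sub>m e a" "N2 * (M\<Lambda> - K2 * X) = 0\<^sub>m e n"
    "\<Lambda>2 * (MN - K2 * W) = T" "\<Lambda>2 * (M\<Lambda> - K2 * X) = Q"
    unfolding mult_minus_distrib_mat[OF N2 product_carriers(1) KW(1)] mult_minus_distrib_mat[OF N2 product_carriers(2) KW(2)]
      mult_minus_distrib_mat[OF \<Lambda>2 product_carriers(1) KW(1)] mult_minus_distrib_mat[OF \<Lambda>2 product_carriers(2) KW(2)]
      dual_cancel W_def[symmetric] X_def[symmetric] T_def[symmetric] Q_def[symmetric]
    by (simp_all only: z[OF product_carriers(3)] z[OF product_carriers(4)] z2(1)[OF product_carriers(5)] z2(1)[OF product_carriers(6)])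
  note h = hcat_mult_vcat
  show "row1 * (pencil_L * col1) = 1\<^sub>m e"
    unfolding pencil_L_mult_cols row1_def by (subst h[OF N2 zero_carrier_mat K2 zero_carrier_mat]) (simp add: NK2)
  show "row1 * (pencil_L * col2) = 0\<^sub>m e a"
    unfolding pencil_L_mult_cols row1_def by (subst h[OF N2 zero_carrier_mat d(1) one_carrier_mat]) (simp add: s)
  show "row1 * (pencil_L * col3) = 0\<^sub>m e n"
    unfolding pencil_L_mult_cols row1_def by (subst h[OF N2 zero_carrier_mat d(2) zero_carrier_mat]) (simp add: s)
  show "row2 * (pencil_L * col1) = 0\<^sub>m a e"
    unfolding pencil_L_mult_cols row2_def by (subst h[OF zero_carrier_mat one_carrier_mat K2 zero_carrier_mat]) (use K2 in simp)
  show "row2 * (pencil_L * col2) = 1\<^sub>m a"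
    unfolding pencil_L_mult_cols row2_def by (subst h[OF zero_carrier_mat one_carrier_mat d(1) one_carrier_mat])
      (simp add: left_mult_zero_mat[OF d(1)])
  show "row2 * (pencil_L * col3) = 0\<^sub>m a n"
    unfolding pencil_L_mult_cols row2_def by (subst h[OF zero_carrier_mat one_carrier_mat d(2) zero_carrier_mat])
      (simp add: left_mult_zero_mat[OF d(2)])
  have T: "- T \<in> carrier_mat m a" using product_carriers by simp
  show "row3 * (pencil_L * col1) = 0\<^sub>m m e"
    unfolding pencil_L_mult_cols row3_def by (subst h[OF \<Lambda>2 T K2 zero_carrier_mat]) (use T in \<open>simp add: \<Lambda>K2\<close>)
  show "row3 * (pencil_L * col2) = 0\<^sub>m m a"
    unfolding pencil_L_mult_cols row3_def by (subst h[OF \<Lambda>2 T d(1) one_carrier_mat]) (use T in \<open>simp add: s z2(2)[OF product_carriers(5)]\<close>)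
  show "row3 * (pencil_L * col3) = Q"
    unfolding pencil_L_mult_cols row3_def by (subst h[OF \<Lambda>2 T d(2) zero_carrier_mat]) (use T product_carriers in \<open>simp add: s\<close>)
qed

definition "U = vcat row1 (vcat row2 row3)"
definition "V = hcat col1 (hcat col2 col3)"

lemma three_by_three:
  assumes u: "u1 \<in> carrier_mat e k" "u2 \<in> carrier_mat a k" "u3 \<in> carrier_mat l k"
    and v: "v1 \<in> carrier_mat k e" "v2 \<in> carrier_mat k a" "v3 \<in> carrier_mat k s"
    and "u1 * v1 = 1\<^sub>m e" "u1 * v2 = 0\<^sub>m e a" "u1 * v3 = 0\<^sub>m e s"
      "u2 * v1 = 0\<^sub>m a e" "u2 * v2 = 1\<^sub>m a" "u2 * v3 = 0\<^sub>m a s"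
      "u3 * v1 = 0\<^sub>m l e" "u3 * v2 = 0\<^sub>m l a" "u3 * v3 = (R :: 'a poly mat)"
  shows "vcat u1 (vcat u2 u3) * hcat v1 (hcat v2 v3) = four_block_mat (1\<^sub>m (e + a)) (0\<^sub>m (e + a) s) (0\<^sub>m l (e + a)) R"
proof -
  have R: "R \<in> carrier_mat l s" using mult_carrier_mat[OF u(3) v(3)] assms(15) by simp
  have v23: "hcat v2 v3 \<in> carrier_mat k (a + s)" by (intro hcat_carrier v)
  have u23: "vcat u2 u3 \<in> carrier_mat (a + l) k" by (intro vcat_carrier u)
  have vv: "hcat v1 (hcat v2 v3) \<in> carrier_mat k (e + (a + s))" by (intro hcat_carrier v)
  have row: "u * hcat v1 (hcat v2 v3) = hcat (u * v1) (hcat (u * v2) (u * v3))" if "u \<in> carrier_mat l' k" for u :: "'a poly mat" and l'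
    by (simp add: mult_hcat[OF that v(1) v23] mult_hcat[OF that v(2,3)])
  have "vcat u1 (vcat u2 u3) * hcat v1 (hcat v2 v3) =
      vcat (u1 * hcat v1 (hcat v2 v3)) (vcat (u2 * hcat v1 (hcat v2 v3)) (u3 * hcat v1 (hcat v2 v3)))"
    by (simp add: vcat_mult[OF u(1) u23 vv] vcat_mult[OF u(2,3) vv])
  also have "\<dots> = vcat (hcat (1\<^sub>m e) (hcat (0\<^sub>m e a) (0\<^sub>m e s)))
      (vcat (hcat (0\<^sub>m a e) (hcat (1\<^sub>m a) (0\<^sub>m a s))) (hcat (0\<^sub>m l e) (hcat (0\<^sub>m l a) R)))"
    by (simp only: row[OF u(1)] row[OF u(2)] row[OF u(3)] assms)
  also have "\<dots> = four_block_mat (1\<^sub>m (e + a)) (0\<^sub>m (e + a) s) (0\<^sub>m l (e + a)) R"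
    by (rule block_diag_three[OF R])
  finally show ?thesis .
qed

lemma block_diagonalization: "U * pencil_L * V = four_block_mat (1\<^sub>m (e + a)) (0\<^sub>m (e + a) n) (0\<^sub>m m (e + a)) Q"
proof -
  have U: "U \<in> carrier_mat (e + (a + m)) (b + a)" and V: "V \<in> carrier_mat (c + e) (e + (a + n))"
    unfolding U_def V_def by (intro vcat_carrier hcat_carrier block_carriers)+
  have c23: "hcat col2 col3 \<in> carrier_mat (c + e) (a + n)" by (intro hcat_carrier block_carriers)
  have LVc: "pencil_L * V = hcat (pencil_L * col1) (hcat (pencil_L * col2) (pencil_L * col3))"
    unfolding V_def
    by (simp only: mult_hcat[OF block_carriers(7,4) c23] mult_hcat[OF block_carriers(7,5,6)])
  have "U * pencil_L * V = U * (pencil_L * V)" by (rule assoc_mult_mat[OF U block_carriers(7) V])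
  also have "\<dots> = four_block_mat (1\<^sub>m (e + a)) (0\<^sub>m (e + a) n) (0\<^sub>m m (e + a)) Q"
    unfolding LVc U_def
    by (rule three_by_three[OF block_carriers(1-3) mult_carrier_mat[OF block_carriers(7,4)]
          mult_carrier_mat[OF block_carriers(7,5)] mult_carrier_mat[OF block_carriers(7,6)] block_diagonalization_entries])
  finally show ?thesis .
qed

text \<open>Polynomial inverses of \<open>U\<close> and \<open>V\<close>, in which
  \<open>K2\<close>, \<open>J2\<close> and \<open>K\<close>, \<open>J\<close> undo
  \<open>N2\<close>, \<open>\<Lambda>2\<close> and \<open>N\<close>, \<open>\<Lambda>\<close>; they
  certify unimodularity.\<close>

definition "U' = hcat (vcat K2 (0\<^sub>m a e)) (hcat (vcat (J2 * T) (1\<^sub>m a)) (vcat J2 (0\<^sub>m a m)))"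
definition "V' = vcat (hcat (N2 * M) (1\<^sub>m e)) (vcat (hcat K (0\<^sub>m a e)) (hcat J (0\<^sub>m n e)))"

lemma add_uminus_mat_cancel: "A + - A = 0\<^sub>m r s" if "A \<in> carrier_mat r s" for A :: "'a poly mat"
  using that by (intro eq_matI) auto

lemma U_inverse: "U * U' = 1\<^sub>m (b + a)"
proof -
  have JT: "J2 * T \<in> carrier_mat b a" using J2 product_carriers by auto
  have T: "- T \<in> carrier_mat m a" using product_carriers by simp
  have 1: "N2 * (J2 * T) = 0\<^sub>m e a" "\<Lambda>2 * (J2 * T) = T"
    using assoc_mult_mat[OF N2 J2 product_carriers(5)] assoc_mult_mat[OF \<Lambda>2 J2 product_carriers(5)] NJ2 \<Lambda>J2 product_carriers by auto
  note h = hcat_mult_vcat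
  have "U * U' = four_block_mat (1\<^sub>m (e + a)) (0\<^sub>m (e + a) m) (0\<^sub>m m (e + a)) (1\<^sub>m m)"
    unfolding U_def U'_def
  proof (rule three_by_three[OF block_carriers(1-3) vcat_carrier[OF K2 zero_carrier_mat]
          vcat_carrier[OF JT one_carrier_mat] vcat_carrier[OF J2 zero_carrier_mat]])
    show "row1 * vcat K2 (0\<^sub>m a e) = 1\<^sub>m e" "row1 * vcat J2 (0\<^sub>m a m) = 0\<^sub>m e m"
      "row1 * vcat (J2 * T) (1\<^sub>m a) = 0\<^sub>m e a"
      unfolding row1_def h[OF N2 zero_carrier_mat K2 zero_carrier_mat] h[OF N2 zero_carrier_mat J2 zero_carrier_mat]
        h[OF N2 zero_carrier_mat JT one_carrier_mat] by (simp_all add: NK2 NJ2 1)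
    show "row2 * vcat K2 (0\<^sub>m a e) = 0\<^sub>m a e" "row2 * vcat J2 (0\<^sub>m a m) = 0\<^sub>m a m"
      "row2 * vcat (J2 * T) (1\<^sub>m a) = 1\<^sub>m a"
      unfolding row2_def h[OF zero_carrier_mat one_carrier_mat K2 zero_carrier_mat] h[OF zero_carrier_mat one_carrier_mat J2 zero_carrier_mat]
        h[OF zero_carrier_mat one_carrier_mat JT one_carrier_mat]
      by (simp_all add: left_mult_zero_mat[OF K2] left_mult_zero_mat[OF J2] left_mult_zero_mat[OF JT])
    show "row3 * vcat K2 (0\<^sub>m a e) = 0\<^sub>m m e" "row3 * vcat J2 (0\<^sub>m a m) = 1\<^sub>m m"
      "row3 * vcat (J2 * T) (1\<^sub>m a) = 0\<^sub>m m a"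
      unfolding row3_def h[OF \<Lambda>2 T K2 zero_carrier_mat] h[OF \<Lambda>2 T J2 zero_carrier_mat] h[OF \<Lambda>2 T JT one_carrier_mat]
        right_mult_zero_mat[OF T] right_mult_one_mat[OF T] 1 \<Lambda>K2 \<Lambda>J2 add_uminus_mat_cancel[OF product_carriers(5)] by simp_all
  qed
  then show ?thesis using dims by (simp add: add.commute add.left_commute)
qed

lemma V_inverse: "V' * V = 1\<^sub>m (c + e)"
proof -
  have NM: "N2 * M \<in> carrier_mat e c" using N2 M by auto
  have WX: "- W \<in> carrier_mat e a" "- X \<in> carrier_mat e n" using product_carriers by simp_all
  have 1: "N2 * M * N = W" "N2 * M * \<Lambda> = X"
    unfolding W_def X_def MN_def M\<Lambda>_def using assoc_mult_mat[OF N2 M N] assoc_mult_mat[OF N2 M \<Lambda>] by auto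
  note h = hcat_mult_vcat
  have "V' * V = four_block_mat (1\<^sub>m (e + a)) (0\<^sub>m (e + a) n) (0\<^sub>m n (e + a)) (1\<^sub>m n)"
    unfolding V_def V'_def
  proof (rule three_by_three[OF hcat_carrier[OF NM one_carrier_mat] hcat_carrier[OF K zero_carrier_mat]
        hcat_carrier[OF J zero_carrier_mat] block_carriers(4-6)])
    show "hcat (N2 * M) (1\<^sub>m e) * col1 = 1\<^sub>m e" "hcat (N2 * M) (1\<^sub>m e) * col2 = 0\<^sub>m e a" "hcat (N2 * M) (1\<^sub>m e) * col3 = 0\<^sub>m e n"
      unfolding col1_def col2_def col3_def h[OF NM one_carrier_mat zero_carrier_mat one_carrier_mat]
        h[OF NM one_carrier_mat N WX(1)] h[OF NM one_carrier_mat \<Lambda> WX(2)] left_mult_one_mat[OF WX(1)] left_mult_one_mat[OF WX(2)]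
        1 add_uminus_mat_cancel[OF product_carriers(3)] add_uminus_mat_cancel[OF product_carriers(4)] right_mult_zero_mat[OF NM] by simp_all
    show "hcat K (0\<^sub>m a e) * col1 = 0\<^sub>m a e" "hcat K (0\<^sub>m a e) * col2 = 1\<^sub>m a" "hcat K (0\<^sub>m a e) * col3 = 0\<^sub>m a n"
      unfolding col1_def col2_def col3_def h[OF K zero_carrier_mat zero_carrier_mat one_carrier_mat]
        h[OF K zero_carrier_mat N WX(1)] h[OF K zero_carrier_mat \<Lambda> WX(2)] left_mult_zero_mat[OF WX(1)] left_mult_zero_mat[OF WX(2)]
        KN K\<Lambda> right_mult_zero_mat[OF K] by simp_all
    show "hcat J (0\<^sub>m n e) * col1 = 0\<^sub>m n e" "hcat J (0\<^sub>m n e) * col2 = 0\<^sub>m n a" "hcat J (0\<^sub>m n e) * col3 = 1\<^sub>m n"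
      unfolding col1_def col2_def col3_def h[OF J zero_carrier_mat zero_carrier_mat one_carrier_mat]
        h[OF J zero_carrier_mat N WX(1)] h[OF J zero_carrier_mat \<Lambda> WX(2)] left_mult_zero_mat[OF WX(1)] left_mult_zero_mat[OF WX(2)]
        JN J\<Lambda> right_mult_zero_mat[OF J] by simp_all
  qed
  then show ?thesis using dims by (simp add: add.commute add.left_commute)
qed

lemma unimodular_UV: "unimodular (b + a) U" "unimodular (c + e) V"
proof -
  have c1: "U \<in> carrier_mat (e + (a + m)) (b + a)" "U' \<in> carrier_mat (b + a) (e + (a + m))"
    unfolding U_def U'_def
    by (intro vcat_carrier hcat_carrier block_carriers K2 mult_carrier_mat[OF J2 product_carriers(5)] J2 zero_carrier_mat one_carrier_mat)+
  have c2: "V' \<in> carrier_mat (e + (a + n)) (c + e)" "V \<in> carrier_mat (c + e) (e + (a + n))"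
    unfolding V_def V'_def
    by (intro vcat_carrier hcat_carrier block_carriers K J mult_carrier_mat[OF N2 M] zero_carrier_mat one_carrier_mat)+
  have d: "e + (a + m) = b + a" "e + (a + n) = c + e" using dims by auto
  show "unimodular (b + a) U" using unimodularI[OF _ _ U_inverse] c1 by (simp add: d)
  show "unimodular (c + e) V" using unimodularI[OF _ _ V_inverse] c2 by (simp add: d)
qed

text \<open>This identity, \<open>pencil_L_col3\<close>, \<open>Q_left_inverse\<close> and
  \<open>col3_resolution\<close> are the premises of \<open>right_minimal_indices_shift\<close> for
  the map \<open>col3\<close>: it carries the null space of \<open>Q\<close> to that of the pencil
  and has a polynomial inverse there.\<close>

lemma left_inverse_col3: "hcat J (0\<^sub>m n e) * col3 = 1\<^sub>m n"
proof -
  have X: "- X \<in> carrier_mat e n" using product_carriers by simp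
  show ?thesis
    unfolding col3_def hcat_mult_vcat[OF J zero_carrier_mat \<Lambda> X] left_mult_zero_mat[OF X] J\<Lambda> by simp
qed

text \<open>By \<open>complete2\<close>, \<open>M\<Lambda>\<close> splits into
  \<open>K2 X + J2 Q\<close>; the entry \<open>- X\<close> of \<open>col3\<close> cancels the first
  part.\<close>

lemma pencil_L_col3: "pencil_L * col3 = vcat J2 (0\<^sub>m a m) * Q"
proof -
  have KX: "K2 * X \<in> carrier_mat b n" and JQ: "J2 * Q \<in> carrier_mat b n" using K2 J2 product_carriers by auto
  have "M\<Lambda> = (K2 * N2 + J2 * \<Lambda>2) * M\<Lambda>" using complete2 product_carriers by simp
  also have "\<dots> = K2 * N2 * M\<Lambda> + J2 * \<Lambda>2 * M\<Lambda>"
    using K2 N2 J2 \<Lambda>2 product_carriers by (intro add_mult_distrib_mat) auto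
  also have "\<dots> = K2 * X + J2 * Q"
    unfolding X_def Q_def assoc_mult_mat[OF K2 N2 product_carriers(2)] assoc_mult_mat[OF J2 \<Lambda>2 product_carriers(2)] ..
  finally have "M\<Lambda> = K2 * X + J2 * Q" .
  moreover have "A + B - A = B" if "A \<in> carrier_mat b n" "B \<in> carrier_mat b n" for A B :: "'a poly mat"
    using that by (intro eq_matI) auto
  ultimately have "M\<Lambda> - K2 * X = J2 * Q" using KX JQ by simp
  then show ?thesis
    unfolding pencil_L_mult_cols vcat_mult[OF J2 zero_carrier_mat product_carriers(6)] using product_carriers by simp
qed

lemma split_M: "M = MN * K + M\<Lambda> * J"
proof -
  have "M = M * (N * K + \<Lambda> * J)" using complete1 M by simp
  also have "\<dots> = M * (N * K) + M * (\<Lambda> * J)" using M N K \<Lambda> J by (intro mult_add_distrib_mat) auto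
  also have "\<dots> = MN * K + M\<Lambda> * J"
    unfolding MN_def M\<Lambda>_def using assoc_mult_mat[OF M N K] assoc_mult_mat[OF M \<Lambda> J] by simp
  finally show ?thesis .
qed

lemma mult_split_M:
  assumes Y: "Y \<in> carrier_mat l b"
  shows "Y * M = Y * MN * K + Y * M\<Lambda> * J"
proof -
  have "Y * M = Y * (MN * K + M\<Lambda> * J)" using split_M by simp
  also have "\<dots> = Y * (MN * K) + Y * (M\<Lambda> * J)" using Y product_carriers K J by (intro mult_add_distrib_mat) auto
  also have "\<dots> = Y * MN * K + Y * M\<Lambda> * J"
    using assoc_mult_mat[OF Y product_carriers(1) K] assoc_mult_mat[OF Y product_carriers(2) J] by simp
  finally show ?thesis .
qed

text \<open>By \<open>complete1\<close>, \<open>\<Lambda>2 M\<close> splits into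
  \<open>T K + Q J\<close>; the entry \<open>- T\<close> of \<open>row3\<close> cancels the first
  part.\<close>

lemma Q_left_inverse: "Q * hcat J (0\<^sub>m n e) = row3 * pencil_L"
proof -
  have TK: "T * K \<in> carrier_mat m c" and QJ: "Q * J \<in> carrier_mat m c" and \<Lambda>M: "\<Lambda>2 * M \<in> carrier_mat m c"
    using product_carriers K J \<Lambda>2 M by auto
  have T: "- T \<in> carrier_mat m a" using product_carriers by simp
  have 1: "\<Lambda>2 * M = T * K + Q * J" unfolding T_def Q_def by (rule mult_split_M[OF \<Lambda>2])
  have 2: "A + B + - A = B" if "A \<in> carrier_mat m c" "B \<in> carrier_mat m c" for A B :: "'a poly mat"
    using that by (intro eq_matI) auto
  have "row3 * pencil_L = \<Lambda>2 * hcat M K2 + - T * hcat K (0\<^sub>m a e)"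
    unfolding row3_def pencil_L_def four_block_eq_cat[OF M K2 K zero_carrier_mat]
    by (rule hcat_mult_vcat[OF \<Lambda>2 T hcat_carrier[OF M K2] hcat_carrier[OF K zero_carrier_mat]])
  also have "\<dots> = hcat (\<Lambda>2 * M) (0\<^sub>m m e) + hcat (- (T * K)) (0\<^sub>m m e)"
    unfolding mult_hcat[OF \<Lambda>2 M K2] mult_hcat[OF T K zero_carrier_mat] \<Lambda>K2 right_mult_zero_mat[OF T]
      mult_uminus_mat(2)[OF product_carriers(5) K] ..
  also have "\<dots> = hcat (\<Lambda>2 * M + - (T * K)) (0\<^sub>m m e)"
    using hcat_add[OF \<Lambda>M zero_carrier_mat[of m e] uminus_carrier_mat[OF TK] zero_carrier_mat] by simp
  also have "\<Lambda>2 * M + - (T * K) = Q * J" unfolding 1 by (rule 2[OF TK QJ])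
  also have "hcat (Q * J) (0\<^sub>m m e) = Q * hcat J (0\<^sub>m n e)"
    unfolding mult_hcat[OF product_carriers(6) J zero_carrier_mat] right_mult_zero_mat[OF product_carriers(6)] ..
  finally show ?thesis by simp
qed

text \<open>On vectors annihilated by \<open>pencil_L\<close> the second summand vanishes, so every
  such vector lies in the image of \<open>col3\<close>.\<close>

lemma col3_resolution:
  "col3 * hcat J (0\<^sub>m n e) + four_block_mat (0\<^sub>m c b) N N2 (- W) * pencil_L = 1\<^sub>m (c + e)"
proof -
  have \<Lambda>J: "\<Lambda> * J \<in> carrier_mat c c" and XJ: "X * J \<in> carrier_mat e c" and NK: "N * K \<in> carrier_mat c c"
    and NM: "N2 * M \<in> carrier_mat e c" and WK: "W * K \<in> carrier_mat e c"
    using product_carriers \<Lambda> J N K N2 M by auto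
  have W: "- W \<in> carrier_mat e a" and X: "- X \<in> carrier_mat e n" using product_carriers by simp_all
  have "col3 * hcat J (0\<^sub>m n e) = vcat (hcat (\<Lambda> * J) (0\<^sub>m c e)) (hcat (- (X * J)) (0\<^sub>m e e))"
    unfolding col3_def vcat_mult[OF \<Lambda> X hcat_carrier[OF J zero_carrier_mat]] mult_hcat[OF \<Lambda> J zero_carrier_mat]
      mult_hcat[OF X J zero_carrier_mat] right_mult_zero_mat[OF \<Lambda>] right_mult_zero_mat[OF X]
      mult_uminus_mat(2)[OF product_carriers(4) J] ..
  also have "\<dots> = four_block_mat (\<Lambda> * J) (0\<^sub>m c e) (- (X * J)) (0\<^sub>m e e)"
    by (rule four_block_eq_cat[symmetric, OF \<Lambda>J zero_carrier_mat _ zero_carrier_mat]) (use XJ in simp)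
  finally have 1: "col3 * hcat J (0\<^sub>m n e) = \<dots>" .
  have "four_block_mat (0\<^sub>m c b) N N2 (- W) * pencil_L =
      four_block_mat (0\<^sub>m c b * M + N * K) (0\<^sub>m c b * K2 + N * 0\<^sub>m a e) (N2 * M + - W * K) (N2 * K2 + - W * 0\<^sub>m a e)"
    unfolding pencil_L_def by (rule mult_four_block_mat[OF zero_carrier_mat N N2 W M K2 K zero_carrier_mat])
  also have "\<dots> = four_block_mat (N * K) (0\<^sub>m c e) (N2 * M + - (W * K)) (1\<^sub>m e)"
    unfolding left_mult_zero_mat[OF M] left_mult_zero_mat[OF K2] right_mult_zero_mat[OF N] right_mult_zero_mat[OF W]
      NK2 mult_uminus_mat(2)[OF product_carriers(3) K] using NK by simp
  finally have 2: "four_block_mat (0\<^sub>m c b) N N2 (- W) * pencil_L = \<dots>" .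
  have e: "N2 * M = W * K + X * J" unfolding W_def X_def by (rule mult_split_M[OF N2])
  have 3: "- B + (A + B + - A) = 0\<^sub>m e c" if "A \<in> carrier_mat e c" "B \<in> carrier_mat e c" for A B :: "'a poly mat"
    using that by (intro eq_matI) auto
  have NMW: "N2 * M + - (W * K) \<in> carrier_mat e c" using NM WK by auto
  have "col3 * hcat J (0\<^sub>m n e) + four_block_mat (0\<^sub>m c b) N N2 (- W) * pencil_L =
      four_block_mat (\<Lambda> * J + N * K) (0\<^sub>m c e + 0\<^sub>m c e) (- (X * J) + (N2 * M + - (W * K))) (0\<^sub>m e e + 1\<^sub>m e)"
    unfolding 1 2 by (rule add_four_block_mat[OF \<Lambda>J zero_carrier_mat _ zero_carrier_mat NK zero_carrier_mat NMW one_carrier_mat])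
      (use XJ in simp)
  also have "\<dots> = four_block_mat (1\<^sub>m c) (0\<^sub>m c e) (0\<^sub>m e c) (1\<^sub>m e)"
    unfolding e 3[OF WK XJ] comm_add_mat[OF \<Lambda>J NK] complete1 by simp
  finally show ?thesis by simp
qed

end

end

section \<open>Kronecker products with an identity matrix and the dual systems of
  \<open>L_k\<close>\<close>

lemma kron_dim [simp]:
  "dim_row (A \<otimes>\<^sub>m B) = dim_row A * dim_row B" "dim_col (A \<otimes>\<^sub>m B) = dim_col A * dim_col B"
  by (simp_all add: kron_def)

lemma kron_one_index:
  assumes "i < dim_row A * n" "j < dim_col A * n"
  shows "(A \<otimes>\<^sub>m 1\<^sub>m n) $$ (i, j) = (if i mod n = j mod n then A $$ (i div n, j div n) else (0 :: 'a::semiring_1))"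
proof -
  have "n > 0" using assms by (cases n) auto
  then show ?thesis using assms by (simp add: kron_def)
qed

lemma sum_mod_class:
  fixes g :: "nat \<Rightarrow> 'a::comm_monoid_add"
  assumes "s < n"
  shows "(\<Sum>l<q * n. if l mod n = s then g (l div n) else 0) = (\<Sum>l<q. g l)"
proof -
  have "(\<Sum>l<q * n. if l mod n = s then g (l div n) else 0) = (\<Sum>l\<in>{l \<in> {..<q * n}. l mod n = s}. g (l div n))"
    by (rule sum.inter_filter[symmetric]) simp
  also have "\<dots> = (\<Sum>l<q. g l)"
  proof (rule sum.reindex_bij_witness[of _ "\<lambda>l. l * n + s" "\<lambda>l. l div n"])
    fix l assume "l \<in> {l \<in> {..<q * n}. l mod n = s}"
    then show "l div n * n + s = l" "l div n \<in> {..<q}" "g (l div n) = g (l div n)"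
      by (auto simp: less_mult_imp_div_less)
  next
    fix l assume "l \<in> {..<q}"
    then have "l * n + n \<le> q * n" by (metis add.commute lessThan_iff mult_Suc mult_le_mono1 Suc_leI)
    then show "(l * n + s) div n = l" "l * n + s \<in> {l \<in> {..<q * n}. l mod n = s}" using assms by auto
  qed
  finally show ?thesis .
qed

text \<open>The identity factors restrict the summation index to one residue class modulo
  \<open>n\<close>, and such a class has exactly one element in each block
  (\<open>sum_mod_class\<close>).\<close>

lemma kron_one_mult:
  fixes A B :: "'a::comm_semiring_1 mat"
  assumes A: "A \<in> carrier_mat p q" and B: "B \<in> carrier_mat q r"
  shows "(A \<otimes>\<^sub>m 1\<^sub>m n) * (B \<otimes>\<^sub>m 1\<^sub>m n) = (A * B) \<otimes>\<^sub>m 1\<^sub>m n"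
proof (rule eq_matI)
  fix i j assume "i < dim_row ((A * B) \<otimes>\<^sub>m 1\<^sub>m n)" "j < dim_col ((A * B) \<otimes>\<^sub>m 1\<^sub>m n)"
  then have ij: "i < p * n" "j < r * n" using A B by auto
  then have n: "n > 0" by (cases n) auto
  have d: "i div n < p" "j div n < r" using ij by (auto simp: less_mult_imp_div_less)
  have "((A \<otimes>\<^sub>m 1\<^sub>m n) * (B \<otimes>\<^sub>m 1\<^sub>m n)) $$ (i, j) =
      (\<Sum>l<q * n. (A \<otimes>\<^sub>m 1\<^sub>m n) $$ (i, l) * (B \<otimes>\<^sub>m 1\<^sub>m n) $$ (l, j))"
    using A B ij by (simp add: scalar_prod_def atLeast0LessThan)
  also have "\<dots> = (\<Sum>l<q * n. if l mod n = i mod n then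
      (if i mod n = j mod n then A $$ (i div n, l div n) * B $$ (l div n, j div n) else 0) else 0)"
    using A B ij by (intro sum.cong refl) (auto simp: kron_one_index)
  also have "\<dots> = (\<Sum>l<q. if i mod n = j mod n then A $$ (i div n, l) * B $$ (l, j div n) else 0)"
    using n by (intro sum_mod_class[where g = "\<lambda>l. if i mod n = j mod n then A $$ (i div n, l) * B $$ (l, j div n) else 0"]) auto
  also have "\<dots> = ((A * B) \<otimes>\<^sub>m 1\<^sub>m n) $$ (i, j)"
    using A B ij d by (auto simp: kron_one_index scalar_prod_def atLeast0LessThan)
  finally show "((A \<otimes>\<^sub>m 1\<^sub>m n) * (B \<otimes>\<^sub>m 1\<^sub>m n)) $$ (i, j) = ((A * B) \<otimes>\<^sub>m 1\<^sub>m n) $$ (i, j)" .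
qed (use A B in auto)

lemma kron_one_add:
  fixes A B :: "'a::comm_semiring_1 mat"
  assumes "A \<in> carrier_mat p q" "B \<in> carrier_mat p q"
  shows "(A + B) \<otimes>\<^sub>m 1\<^sub>m n = A \<otimes>\<^sub>m 1\<^sub>m n + B \<otimes>\<^sub>m 1\<^sub>m n"
  using assms by (intro eq_matI) (auto simp: kron_one_index less_mult_imp_div_less)

lemma kron_one_one: "1\<^sub>m p \<otimes>\<^sub>m 1\<^sub>m n = (1\<^sub>m (p * n) :: 'a::semiring_1 mat)"
proof (rule eq_matI)
  fix i j assume "i < dim_row (1\<^sub>m (p * n) :: 'a mat)" "j < dim_col (1\<^sub>m (p * n) :: 'a mat)"
  then have ij: "i < p * n" "j < p * n" by auto
  have "i = j \<longleftrightarrow> i mod n = j mod n \<and> i div n = j div n" by (metis div_mult_mod_eq)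
  then show "(1\<^sub>m p \<otimes>\<^sub>m 1\<^sub>m n) $$ (i, j) = (1\<^sub>m (p * n) :: 'a mat) $$ (i, j)"
    using ij by (auto simp: kron_one_index less_mult_imp_div_less)
qed auto

lemma kron_zero_one: "0\<^sub>m p q \<otimes>\<^sub>m 1\<^sub>m n = (0\<^sub>m (p * n) (q * n) :: 'a::semiring_1 mat)"
  by (intro eq_matI) (auto simp: kron_one_index less_mult_imp_div_less)

text \<open>One half of the \<open>dual_blocks\<close> assumptions; the other half is the same
  predicate after transposition, see \<open>dual_blocks_of_systems\<close>.\<close>

definition dual_system :: "nat \<Rightarrow> nat \<Rightarrow> 'a::field poly mat \<Rightarrow> 'a poly mat \<Rightarrow> 'a poly mat \<Rightarrow> 'a poly mat \<Rightarrow> bool" where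
  "dual_system k n K N \<Lambda> J \<longleftrightarrow>
     K \<in> carrier_mat (k * n) ((k + 1) * n) \<and> N \<in> carrier_mat ((k + 1) * n) (k * n) \<and>
     \<Lambda> \<in> carrier_mat ((k + 1) * n) n \<and> J \<in> carrier_mat n ((k + 1) * n) \<and>
     K * N = 1\<^sub>m (k * n) \<and> K * \<Lambda> = 0\<^sub>m (k * n) n \<and> J * N = 0\<^sub>m n (k * n) \<and> J * \<Lambda> = 1\<^sub>m n \<and>
     N * K + \<Lambda> * J = 1\<^sub>m ((k + 1) * n)"

lemma dual_system_kron:
  assumes "dual_system k 1 K N \<Lambda> J"
  shows "dual_system k n (K \<otimes>\<^sub>m 1\<^sub>m n) (N \<otimes>\<^sub>m 1\<^sub>m n) (\<Lambda> \<otimes>\<^sub>m 1\<^sub>m n) (J \<otimes>\<^sub>m 1\<^sub>m n)"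
proof -
  have K: "K \<in> carrier_mat k (k + 1)" and N: "N \<in> carrier_mat (k + 1) k"
    and \<Lambda>: "\<Lambda> \<in> carrier_mat (k + 1) 1" and J: "J \<in> carrier_mat 1 (k + 1)"
    and e: "K * N = 1\<^sub>m k" "K * \<Lambda> = 0\<^sub>m k 1" "J * N = 0\<^sub>m 1 k" "J * \<Lambda> = 1\<^sub>m 1" "N * K + \<Lambda> * J = 1\<^sub>m (k + 1)"
    using assms unfolding dual_system_def by simp_all
  have "N \<otimes>\<^sub>m 1\<^sub>m n * (K \<otimes>\<^sub>m 1\<^sub>m n) + \<Lambda> \<otimes>\<^sub>m 1\<^sub>m n * (J \<otimes>\<^sub>m 1\<^sub>m n) = (N * K + \<Lambda> * J) \<otimes>\<^sub>m 1\<^sub>m n"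
    unfolding kron_one_mult[OF N K] kron_one_mult[OF \<Lambda> J]
    by (rule kron_one_add[symmetric]) (use N K \<Lambda> J in auto)
  then show ?thesis
    unfolding dual_system_def kron_one_mult[OF K N] kron_one_mult[OF K \<Lambda>] kron_one_mult[OF J N] kron_one_mult[OF J \<Lambda>] e
      kron_one_one kron_zero_one
    using K N \<Lambda> J by (auto intro!: carrier_matI)
qed

lemma L_pencil_mult_index:
  assumes "B \<in> carrier_mat (k + 1) c" "i < k" "j < c"
  shows "(L_pencil k * B) $$ (i, j) = - B $$ (i, j) + monom 1 1 * B $$ (i + 1, j)"
proof -
  have "(L_pencil k * B) $$ (i, j) = (\<Sum>l<k + 1. L_pencil k $$ (i, l) * B $$ (l, j))"
    using assms by (simp add: scalar_prod_def atLeast0LessThan L_pencil_def)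
  also have "\<dots> = (\<Sum>l<k + 1. (if l = i then - B $$ (l, j) else 0) + (if l = i + 1 then monom 1 1 * B $$ (l, j) else 0))"
    using assms by (intro sum.cong refl) (auto simp: L_pencil_def)
  also have "\<dots> = - B $$ (i, j) + monom 1 1 * B $$ (i + 1, j)"
    unfolding sum.distrib using assms by simp
  finally show ?thesis .
qed

lemma mult_L_pencil_index:
  assumes "B \<in> carrier_mat r k" "i < r" "j < k + 1"
  shows "(B * L_pencil k) $$ (i, j) = (if j < k then - B $$ (i, j) else 0) + (if 1 \<le> j then monom 1 1 * B $$ (i, j - 1) else 0)"
proof -
  have "(B * L_pencil k) $$ (i, j) = (\<Sum>l<k. B $$ (i, l) * L_pencil k $$ (l, j))"
    using assms by (simp add: scalar_prod_def atLeast0LessThan L_pencil_def)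
  also have "\<dots> = (\<Sum>l<k. (if l = j then - B $$ (i, l) else 0) +
      (if l = j - 1 then (if 1 \<le> j then monom 1 1 * B $$ (i, l) else 0) else 0))"
    using assms by (intro sum.cong refl) (auto simp: L_pencil_def)
  also have "\<dots> = (if j < k then - B $$ (i, j) else 0) + (if 1 \<le> j then monom 1 1 * B $$ (i, j - 1) else 0)"
    unfolding sum.distrib using assms by auto
  finally show ?thesis .
qed

text \<open>The first \<open>k\<close> columns of \<open>L_k\<close> form a bidiagonal matrix with
  constant diagonal \<open>-1\<close>; \<open>N\<close> is its inverse, a finite geometric series in
  \<open>\<lambda>\<close>, with a zero row appended. \<open>J\<close> selects the last entry of
  \<open>\<Lambda>\<close>, which is 1.\<close>

lemma dual_system_L_pencil:
  "dual_system k 1 (L_pencil k :: 'a::field poly mat)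
     (mat (k + 1) k (\<lambda>(i, j). if i \<le> j then - monom 1 (j - i) else 0)) (Lambda_col k)
     (mat 1 (k + 1) (\<lambda>(i, j). if j = k then 1 else 0))"
    (is "dual_system _ _ ?K ?N ?\<Lambda> ?J")
proof -
  have c: "?K \<in> carrier_mat k (k + 1)" "?N \<in> carrier_mat (k + 1) k" "?\<Lambda> \<in> carrier_mat (k + 1) 1" "?J \<in> carrier_mat 1 (k + 1)"
    by (auto simp: L_pencil_def Lambda_col_def)
  have shift: "monom 1 1 * monom 1 (l - Suc i) = (monom 1 (l - i) :: 'a poly)" if "i < l" for l i
    using that by (simp add: mult_monom Suc_diff_Suc)
  have J: "(?J * B) $$ (i, j) = B $$ (k, j)" if "B \<in> carrier_mat (k + 1) c" "i < 1" "j < c" for B i j c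
    using that by (simp add: scalar_prod_def atLeast0LessThan if_distrib[of "\<lambda>x. x * _"] cong: if_cong)
  have 1: "?K * ?N = 1\<^sub>m k"
  proof (rule eq_matI)
    fix i j assume "i < dim_row (1\<^sub>m k :: 'a poly mat)" "j < dim_col (1\<^sub>m k :: 'a poly mat)"
    then have ij: "i < k" "j < k" by auto
    show "(?K * ?N) $$ (i, j) = 1\<^sub>m k $$ (i, j)"
      unfolding L_pencil_mult_index[OF c(2) ij] using ij shift[of i j]
      by (cases i j rule: linorder_cases) (auto simp: monom_0 one_pCons)
  qed (use c in auto)
  have 2: "?K * ?\<Lambda> = 0\<^sub>m k 1"
  proof (rule eq_matI)
    fix i j assume "i < dim_row (0\<^sub>m k 1 :: 'a poly mat)" "j < dim_col (0\<^sub>m k 1 :: 'a poly mat)"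
    then have ij: "i < k" "j < 1" by auto
    show "(?K * ?\<Lambda>) $$ (i, j) = 0\<^sub>m k 1 $$ (i, j)"
      unfolding L_pencil_mult_index[OF c(3) ij] using ij shift[of i k] by (simp add: Lambda_col_def)
  qed (use c in auto)
  have 3: "?J * ?N = 0\<^sub>m 1 k"
  proof (rule eq_matI)
    fix i j assume "i < dim_row (0\<^sub>m 1 k :: 'a poly mat)" "j < dim_col (0\<^sub>m 1 k :: 'a poly mat)"
    then have ij: "i < 1" "j < k" by auto
    show "(?J * ?N) $$ (i, j) = 0\<^sub>m 1 k $$ (i, j)" unfolding J[OF c(2) ij] using ij by simp
  qed (use c in auto)
  have 4: "?J * ?\<Lambda> = 1\<^sub>m 1"
  proof (rule eq_matI)
    fix i j assume "i < dim_row (1\<^sub>m 1 :: 'a poly mat)" "j < dim_col (1\<^sub>m 1 :: 'a poly mat)"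
    then have ij: "i < 1" "j < 1" by auto
    show "(?J * ?\<Lambda>) $$ (i, j) = 1\<^sub>m 1 $$ (i, j)" unfolding J[OF c(3) ij] using ij by (simp add: Lambda_col_def)
  qed (use c in auto)
  have 5: "?N * ?K + ?\<Lambda> * ?J = 1\<^sub>m (k + 1)"
  proof (rule eq_matI)
    fix i j assume "i < dim_row (1\<^sub>m (k + 1) :: 'a poly mat)" "j < dim_col (1\<^sub>m (k + 1) :: 'a poly mat)"
    then have ij: "i < k + 1" "j < k + 1" by auto
    have "(?\<Lambda> * ?J) $$ (i, j) = (if j = k then monom 1 (k - i) else 0)"
      using ij by (simp add: Lambda_col_def scalar_prod_def)
    moreover have "(?N * ?K + ?\<Lambda> * ?J) $$ (i, j) = (?N * ?K) $$ (i, j) + (?\<Lambda> * ?J) $$ (i, j)"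
      using ij c by (intro index_add_mat) auto
    ultimately show "(?N * ?K + ?\<Lambda> * ?J) $$ (i, j) = 1\<^sub>m (k + 1) $$ (i, j)"
      using ij shift[of i j] unfolding mult_L_pencil_index[OF c(2) ij]
      by (cases i j rule: linorder_cases) (auto simp: diff_Suc_eq_diff_pred[symmetric] Suc_diff_Suc not_less less_Suc_eq_le)
  qed (use c in auto)
  show ?thesis unfolding dual_system_def using c 1 2 3 4 5 by simp
qed

section \<open>Reversal with respect to a prescribed grade\<close>

lemma coeff_rev_poly: "coeff (rev_poly d p) k = (if k \<le> d then coeff p (d - k) else 0)"
proof -
  have "coeff (rev_poly d p) k = (\<Sum>i\<le>d. if d - i = k then coeff p i else 0)"
    by (simp add: rev_poly_def coeff_sum coeff_monom)
  also have "\<dots> = (\<Sum>i\<le>d. if i = d - k then (if k \<le> d then coeff p i else 0) else 0)"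
    by (intro sum.cong refl) auto
  also have "\<dots> = (if k \<le> d then coeff p (d - k) else 0)" by simp
  finally show ?thesis .
qed

lemma rev_poly_zero [simp]: "rev_poly d 0 = 0"
  by (simp add: poly_eq_iff coeff_rev_poly)

lemma rev_poly_eq_reflect:
  fixes p :: "'a::comm_semiring_1 poly"
  assumes "degree p \<le> d"
  shows "rev_poly d p = monom 1 (d - degree p) * reflect_poly p"
proof (rule poly_eqI)
  fix k
  have "coeff p (d - k) = 0" if "k < d - degree p" using that by (intro coeff_eq_0) auto
  then show "coeff (rev_poly d p) k = coeff (monom 1 (d - degree p) * reflect_poly p) k"
    using assms by (auto simp: coeff_rev_poly coeff_monom_mult coeff_reflect_poly)
qed

text \<open>Reversal with respect to a grade is reflection times a power of \<open>\<lambda>\<close>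
  that fills up to the grade. Reflection is multiplicative, and the filling exponents add up because
  degrees do.\<close>

lemma rev_poly_mult:
  fixes p q :: "'a::idom poly"
  assumes "degree p \<le> a" "degree q \<le> b"
  shows "rev_poly (a + b) (p * q) = rev_poly a p * rev_poly b q"
proof (cases "p = 0 \<or> q = 0")
  case False
  then have dg: "degree (p * q) = degree p + degree q" by (simp add: degree_mult_eq)
  then have "rev_poly (a + b) (p * q) = monom 1 (a + b - (degree p + degree q)) * (reflect_poly p * reflect_poly q)"
    using assms by (subst rev_poly_eq_reflect) (auto simp: reflect_poly_mult)
  also have "monom 1 (a + b - (degree p + degree q)) = monom (1::'a) (a - degree p) * monom 1 (b - degree q)"
    using assms by (simp add: mult_monom)
  finally show ?thesis using assms by (simp add: rev_poly_eq_reflect mult_ac)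
qed auto

lemma rev_poly_sum: "rev_poly d (\<Sum>x\<in>S. f x) = (\<Sum>x\<in>S. rev_poly d (f x))"
  by (rule poly_eqI) (simp add: coeff_rev_poly coeff_sum)

lemma rev_mat_dim [simp]: "dim_row (rev_mat d R) = dim_row R" "dim_col (rev_mat d R) = dim_col R"
  by (simp_all add: rev_mat_def)

lemma rev_mat_carrier [simp]: "rev_mat d R \<in> carrier_mat r c \<longleftrightarrow> R \<in> carrier_mat r c"
  unfolding carrier_mat_def by simp

lemma rev_mat_index [simp]:
  "i < dim_row R \<Longrightarrow> j < dim_col R \<Longrightarrow> rev_mat d R $$ (i, j) = rev_poly d (R $$ (i, j))"
  by (simp add: rev_mat_def)

lemma rev_mat_mult:
  fixes R S :: "'a::idom poly mat"
  assumes R: "R \<in> carrier_mat r l" "has_grade a R" and S: "S \<in> carrier_mat l c" "has_grade b S"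
  shows "rev_mat (a + b) (R * S) = rev_mat a R * rev_mat b S"
proof (rule eq_matI)
  fix i j assume "i < dim_row (rev_mat a R * rev_mat b S)" "j < dim_col (rev_mat a R * rev_mat b S)"
  then have ij: "i < r" "j < c" using R S by auto
  have "rev_mat (a + b) (R * S) $$ (i, j) = (\<Sum>k<l. rev_poly (a + b) (R $$ (i, k) * S $$ (k, j)))"
    using R(1) S(1) ij by (simp add: scalar_prod_def rev_poly_sum atLeast0LessThan)
  also have "\<dots> = (\<Sum>k<l. rev_poly a (R $$ (i, k)) * rev_poly b (S $$ (k, j)))"
    using R S ij by (intro sum.cong refl rev_poly_mult) (auto simp: has_grade_iff)
  also have "\<dots> = (rev_mat a R * rev_mat b S) $$ (i, j)"
    using R(1) S(1) ij by (simp add: scalar_prod_def atLeast0LessThan)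
  finally show "rev_mat (a + b) (R * S) $$ (i, j) = (rev_mat a R * rev_mat b S) $$ (i, j)" .
qed (use R S in auto)

lemma rev_mat_const: "rev_mat 0 (const_mat A) = const_mat A"
  by (intro eq_matI) (auto simp: rev_poly_def monom_0)

lemma rev_mat_transpose: "rev_mat d R\<^sup>T = (rev_mat d R)\<^sup>T"
  by (intro eq_matI) auto

lemma rev_mat_zero [simp]: "rev_mat d (0\<^sub>m r c) = 0\<^sub>m r c"
  by (intro eq_matI) auto

lemma rev_mat_kron_one:
  fixes A :: "'a::comm_ring_1 poly mat"
  shows "rev_mat d (A \<otimes>\<^sub>m 1\<^sub>m n) = rev_mat d A \<otimes>\<^sub>m 1\<^sub>m n"
  by (intro eq_matI) (auto simp: kron_one_index less_mult_imp_div_less)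

lemma has_grade_kron_one:
  fixes A :: "'a::comm_ring_1 poly mat"
  assumes "has_grade d A"
  shows "has_grade d (A \<otimes>\<^sub>m 1\<^sub>m n)"
  using assms by (auto simp: has_grade_iff kron_one_index less_mult_imp_div_less)

lemma has_grade_rev_mat: "has_grade d (rev_mat d R)"
  by (auto simp: has_grade_iff coeff_rev_poly intro!: degree_le)

lemma has_grade_L_pencil: "has_grade 1 (L_pencil k :: 'a::comm_ring_1 poly mat)"
  by (auto simp: has_grade_iff L_pencil_def intro: degree_monom_le)

lemma has_grade_Lambda_col: "has_grade k (Lambda_col k :: 'a::comm_ring_1 poly mat)"
  by (auto simp: has_grade_iff Lambda_col_def intro: order.trans[OF degree_monom_le])

lemma rev_L_pencil:
  "rev_mat 1 (L_pencil k) = mat k (k + 1) (\<lambda>(i, j). if j = i then - monom 1 1 else if j = i + 1 then 1 else (0 :: 'a::comm_ring_1 poly))"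
proof -
  have "rev_poly 1 (- 1) = (- monom 1 1 :: 'a poly)" "rev_poly 1 (monom 1 1) = (1 :: 'a poly)"
    by (auto simp: poly_eq_iff coeff_rev_poly coeff_monom)
  then show ?thesis by (intro eq_matI) (auto simp: L_pencil_def)
qed

lemma rev_Lambda_col: "rev_mat k (Lambda_col k) = mat (k + 1) 1 (\<lambda>(i, j). monom (1 :: 'a::comm_ring_1) i)"
proof -
  have "rev_poly k (monom 1 (k - i)) = (monom 1 i :: 'a poly)" if "i \<le> k" for i
    using that by (auto simp: poly_eq_iff coeff_rev_poly coeff_monom)
  then show ?thesis by (intro eq_matI) (auto simp: Lambda_col_def)
qed

lemma rev_L_pencil_mult_index:
  assumes "B \<in> carrier_mat (k + 1) c" "i < k" "j < c"
  shows "(rev_mat 1 (L_pencil k) * B) $$ (i, j) = - (monom 1 1 * B $$ (i, j)) + B $$ (i + 1, j)"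
proof -
  have "(rev_mat 1 (L_pencil k) * B) $$ (i, j) = (\<Sum>l<k + 1. rev_mat 1 (L_pencil k) $$ (i, l) * B $$ (l, j))"
    using assms by (simp add: scalar_prod_def atLeast0LessThan L_pencil_def)
  also have "\<dots> = (\<Sum>l<k + 1. (if l = i then - (monom 1 1 * B $$ (l, j)) else 0) + (if l = i + 1 then B $$ (l, j) else 0))"
    unfolding rev_L_pencil using assms by (intro sum.cong refl) auto
  also have "\<dots> = - (monom 1 1 * B $$ (i, j)) + B $$ (i + 1, j)"
    unfolding sum.distrib using assms by simp
  finally show ?thesis .
qed

lemma mult_rev_L_pencil_index:
  assumes "B \<in> carrier_mat r k" "i < r" "j < k + 1"
  shows "(B * rev_mat 1 (L_pencil k)) $$ (i, j) = (if j < k then - (monom 1 1 * B $$ (i, j)) else 0) + (if 1 \<le> j then B $$ (i, j - 1) else 0)"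
proof -
  have "(B * rev_mat 1 (L_pencil k)) $$ (i, j) = (\<Sum>l<k. B $$ (i, l) * rev_mat 1 (L_pencil k) $$ (l, j))"
    using assms by (simp add: scalar_prod_def atLeast0LessThan L_pencil_def)
  also have "\<dots> = (\<Sum>l<k. (if l = j then - (monom 1 1 * B $$ (i, l)) else 0) +
      (if l = j - 1 then (if 1 \<le> j then B $$ (i, l) else 0) else 0))"
    unfolding rev_L_pencil using assms by (intro sum.cong refl) auto
  also have "\<dots> = (if j < k then - (monom 1 1 * B $$ (i, j)) else 0) + (if 1 \<le> j then B $$ (i, j - 1) else 0)"
    unfolding sum.distrib using assms by auto
  finally show ?thesis .
qed

text \<open>The mirror image of \<open>dual_system_L_pencil\<close>: the entry 1 of the reversed
  \<open>\<Lambda>\<close> is now the first one, and \<open>N\<close> inverts the last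
  \<open>k\<close> columns, which have 1 on the diagonal and \<open>- \<lambda>\<close> below
  it.\<close>

lemma dual_system_rev_L_pencil:
  "dual_system k 1 (rev_mat 1 (L_pencil k) :: 'a::field poly mat)
     (mat (k + 1) k (\<lambda>(i, j). if j < i then monom 1 (i - 1 - j) else 0)) (rev_mat k (Lambda_col k))
     (mat 1 (k + 1) (\<lambda>(i, j). if j = 0 then 1 else 0))"
    (is "dual_system _ _ ?K ?N ?\<Lambda> ?J")
proof -
  have c: "?K \<in> carrier_mat k (k + 1)" "?N \<in> carrier_mat (k + 1) k" "?\<Lambda> \<in> carrier_mat (k + 1) 1" "?J \<in> carrier_mat 1 (k + 1)"
    by (auto simp: L_pencil_def Lambda_col_def)
  have shift: "monom 1 1 * monom 1 (i - Suc j) = (monom 1 (i - j) :: 'a poly)" if "j < i" for i j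
    using that by (simp add: mult_monom Suc_diff_Suc)
  have J: "(?J * B) $$ (i, j) = B $$ (0, j)" if "B \<in> carrier_mat (k + 1) c" "i < 1" "j < c" for B i j c
    using that by (simp add: scalar_prod_def atLeast0LessThan if_distrib[of "\<lambda>x. x * _"] cong: if_cong)
  have 1: "?K * ?N = 1\<^sub>m k"
  proof (rule eq_matI)
    fix i j assume "i < dim_row (1\<^sub>m k :: 'a poly mat)" "j < dim_col (1\<^sub>m k :: 'a poly mat)"
    then have ij: "i < k" "j < k" by auto
    show "(?K * ?N) $$ (i, j) = 1\<^sub>m k $$ (i, j)"
      unfolding rev_L_pencil_mult_index[OF c(2) ij] using ij shift[of j i]
      by (cases i j rule: linorder_cases) (auto simp: monom_0 one_pCons)
  qed (use c in auto)
  have 2: "?K * ?\<Lambda> = 0\<^sub>m k 1"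
  proof (rule eq_matI)
    fix i j assume "i < dim_row (0\<^sub>m k 1 :: 'a poly mat)" "j < dim_col (0\<^sub>m k 1 :: 'a poly mat)"
    then have ij: "i < k" "j < 1" by auto
    show "(?K * ?\<Lambda>) $$ (i, j) = 0\<^sub>m k 1 $$ (i, j)"
      unfolding rev_L_pencil_mult_index[OF c(3) ij] unfolding rev_Lambda_col using ij by (simp add: mult_monom)
  qed (use c in auto)
  have 3: "?J * ?N = 0\<^sub>m 1 k"
  proof (rule eq_matI)
    fix i j assume "i < dim_row (0\<^sub>m 1 k :: 'a poly mat)" "j < dim_col (0\<^sub>m 1 k :: 'a poly mat)"
    then have ij: "i < 1" "j < k" by auto
    show "(?J * ?N) $$ (i, j) = 0\<^sub>m 1 k $$ (i, j)" unfolding J[OF c(2) ij] using ij by simp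
  qed (use c in auto)
  have 4: "?J * ?\<Lambda> = 1\<^sub>m 1"
  proof (rule eq_matI)
    fix i j assume "i < dim_row (1\<^sub>m 1 :: 'a poly mat)" "j < dim_col (1\<^sub>m 1 :: 'a poly mat)"
    then have ij: "i < 1" "j < 1" by auto
    show "(?J * ?\<Lambda>) $$ (i, j) = 1\<^sub>m 1 $$ (i, j)"
      unfolding J[OF c(3) ij] unfolding rev_Lambda_col using ij by simp
  qed (use c in auto)
  have 5: "?N * ?K + ?\<Lambda> * ?J = 1\<^sub>m (k + 1)"
  proof (rule eq_matI)
    fix i j assume "i < dim_row (1\<^sub>m (k + 1) :: 'a poly mat)" "j < dim_col (1\<^sub>m (k + 1) :: 'a poly mat)"
    then have ij: "i < k + 1" "j < k + 1" by auto
    have "(?\<Lambda> * ?J) $$ (i, j) = (if j = 0 then monom 1 i else 0)"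
      unfolding rev_Lambda_col using ij by (simp add: scalar_prod_def)
    moreover have "(?N * ?K + ?\<Lambda> * ?J) $$ (i, j) = (?N * ?K) $$ (i, j) + (?\<Lambda> * ?J) $$ (i, j)"
      using ij c by (intro index_add_mat) auto
    ultimately show "(?N * ?K + ?\<Lambda> * ?J) $$ (i, j) = 1\<^sub>m (k + 1) $$ (i, j)"
      using ij shift[of j i] unfolding mult_rev_L_pencil_index[OF c(2) ij]
      by (cases i j rule: linorder_cases) (auto simp: not_less less_Suc_eq_le)
  qed (use c in auto)
  show ?thesis unfolding dual_system_def using c 1 2 3 4 5 by simp
qed

section \<open>Strong linearizations\<close>

lemma dual_blocks_of_systems:
  assumes "dual_system \<epsilon> n K N \<Lambda> J" "dual_system \<eta> m K' N' \<Lambda>' J'"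
  shows "dual_blocks (\<epsilon> * n) ((\<eta> + 1) * m) ((\<epsilon> + 1) * n) (\<eta> * m) m n K N \<Lambda> J K'\<^sup>T N'\<^sup>T \<Lambda>'\<^sup>T J'\<^sup>T"
proof -
  have c: "K' \<in> carrier_mat (\<eta> * m) ((\<eta> + 1) * m)" "N' \<in> carrier_mat ((\<eta> + 1) * m) (\<eta> * m)"
    "\<Lambda>' \<in> carrier_mat ((\<eta> + 1) * m) m" "J' \<in> carrier_mat m ((\<eta> + 1) * m)"
    and e: "K' * N' = 1\<^sub>m (\<eta> * m)" "K' * \<Lambda>' = 0\<^sub>m (\<eta> * m) m" "J' * N' = 0\<^sub>m m (\<eta> * m)" "J' * \<Lambda>' = 1\<^sub>m m"
      "N' * K' + \<Lambda>' * J' = 1\<^sub>m ((\<eta> + 1) * m)"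
    using assms(2) unfolding dual_system_def by blast+
  have t: "N'\<^sup>T * K'\<^sup>T = 1\<^sub>m (\<eta> * m)" "\<Lambda>'\<^sup>T * K'\<^sup>T = 0\<^sub>m m (\<eta> * m)" "N'\<^sup>T * J'\<^sup>T = 0\<^sub>m (\<eta> * m) m" "\<Lambda>'\<^sup>T * J'\<^sup>T = 1\<^sub>m m"
    unfolding transpose_mult[OF c(1,2), symmetric] transpose_mult[OF c(1,3), symmetric]
      transpose_mult[OF c(4,2), symmetric] transpose_mult[OF c(4,3), symmetric] e
    by (simp_all add: transpose_one zero_transpose_mat)
  have "K'\<^sup>T * N'\<^sup>T + J'\<^sup>T * \<Lambda>'\<^sup>T = (N' * K' + \<Lambda>' * J')\<^sup>T"
    unfolding transpose_mult[OF c(2,1), symmetric] transpose_mult[OF c(3,4), symmetric]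
    by (rule transpose_add[symmetric]) (use c in auto)
  then have t5: "K'\<^sup>T * N'\<^sup>T + J'\<^sup>T * \<Lambda>'\<^sup>T = 1\<^sub>m ((\<eta> + 1) * m)" unfolding e by (simp add: transpose_one)
  have d: "(\<epsilon> + 1) * n = \<epsilon> * n + n" "(\<eta> + 1) * m = \<eta> * m + m" by auto
  show ?thesis
    using assms(1) unfolding dual_system_def
    by unfold_locales (use c t t5 d in \<open>auto simp del: add_mult_distrib add_mult_distrib2 distrib_right distrib_left mult_Suc\<close>)
qed

lemma unimodular_mult:
  fixes U V :: "'a::field poly mat"
  assumes "unimodular k U" "unimodular k V"
  shows "unimodular k (U * V)"
proof -
  obtain c d where c: "c \<noteq> 0" "det U = [:c:]" "d \<noteq> 0" "det V = [:d:]" and UV: "U \<in> carrier_mat k k" "V \<in> carrier_mat k k"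
    using assms unfolding unimodular_def by blast
  have "det (U * V) = [:c * d:]" unfolding det_mult[OF UV] c by simp
  then show ?thesis using c UV unfolding unimodular_def by auto
qed

lemma const_mat_inverse:
  assumes "inverse_pair r E E'"
  shows "const_mat E * const_mat E' = 1\<^sub>m r" "const_mat E' * const_mat E = 1\<^sub>m r"
    "const_mat E \<in> carrier_mat r r" "const_mat E' \<in> carrier_mat r r"
proof -
  have c: "E \<in> carrier_mat r r" "E' \<in> carrier_mat r r" using assms by (auto simp: inverse_pair_def)
  show "const_mat E * const_mat E' = 1\<^sub>m r" "const_mat E' * const_mat E = 1\<^sub>m r"
    using const_mat_mult[OF c] const_mat_mult[OF c(2,1)] assms by (auto simp: inverse_pair_def)
  show "const_mat E \<in> carrier_mat r r" "const_mat E' \<in> carrier_mat r r" using c by auto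
qed

lemma linearization_strictly_equivalent:
  fixes T :: "'a::field poly mat"
  assumes eq: "strictly_equivalent T' T" and lin: "linearization T Q"
  shows "linearization T' Q"
proof -
  define r c where "r = dim_row T" and "c = dim_col T"
  have T: "T \<in> carrier_mat r c" by (simp add: r_def c_def)
  obtain E E' F F' where E: "inverse_pair r E E'" and F: "inverse_pair c F F'" and T': "T' = const_mat E * T * const_mat F"
    using eq unfolding strictly_equivalent_def r_def c_def by blast
  note e = const_mat_inverse[OF E] and f = const_mat_inverse[OF F]
  obtain s U V where U: "unimodular r U" and V: "unimodular c V"
    and UTV: "U * T * V = four_block_mat (1\<^sub>m s) (0\<^sub>m s (dim_col Q)) (0\<^sub>m (dim_row Q) s) Q" and g: "has_grade 1 T"
    using lin unfolding linearization_def r_def c_def by blast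
  have Uc: "U \<in> carrier_mat r r" and Vc: "V \<in> carrier_mat c c" using U V by (auto simp: unimodular_def)
  have ET: "const_mat E * T \<in> carrier_mat r c" by (rule mult_carrier_mat[OF e(3) T])
  have T'c: "T' \<in> carrier_mat r c" unfolding T' by (rule mult_carrier_mat[OF ET f(3)])
  have grade: "has_grade 1 T'"
    using has_grade_mult_const[OF ET, of F c 1] has_grade_const_mult[of E r r T c 1] T g E F by (simp add: T' inverse_pair_def)
  have "U * const_mat E' * T' * (const_mat F' * V) = U * T * V"
  proof -
    have "const_mat E' * T' = T * const_mat F"
    proof -
      have "const_mat E' * T' = const_mat E' * (const_mat E * (T * const_mat F))"
        unfolding T' assoc_mult_mat[OF e(3) T f(3)] ..
      also have "\<dots> = const_mat E' * const_mat E * (T * const_mat F)"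
        by (rule assoc_mult_mat[OF e(4,3) mult_carrier_mat[OF T f(3)], symmetric])
      also have "\<dots> = T * const_mat F" unfolding e by (rule left_mult_one_mat[OF mult_carrier_mat[OF T f(3)]])
      finally show ?thesis .
    qed
    then have "U * const_mat E' * T' = U * T * const_mat F"
      using assoc_mult_mat[OF Uc e(4) T'c] assoc_mult_mat[OF Uc T f(3)] by simp
    then have "U * const_mat E' * T' * (const_mat F' * V) = U * T * (const_mat F * (const_mat F' * V))"
      using assoc_mult_mat[OF mult_carrier_mat[OF Uc T] f(3) mult_carrier_mat[OF f(4) Vc]] by simp
    also have "const_mat F * (const_mat F' * V) = V"
      using assoc_mult_mat[OF f(3,4) Vc] f left_mult_one_mat[OF Vc] by simp
    finally show ?thesis .
  qed
  moreover have "unimodular r (U * const_mat E')" "unimodular c (const_mat F' * V)"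
    by (rule unimodular_mult[OF U unimodularI(2)[OF e(3,4,1)]], rule unimodular_mult[OF unimodularI(2)[OF f(3,4,1)] V])
  ultimately show ?thesis
    using T'c grade UTV unfolding linearization_def by auto
qed

text \<open>Kept general in the two dual systems, because it is used once for the pencil and once
  for its reversal.\<close>

lemma linearization_dual_systems:
  fixes M :: "'a::field poly mat"
  assumes 1: "dual_system \<epsilon> n K N \<Lambda> J" and 2: "dual_system \<eta> m K' N' \<Lambda>' J'"
    and M: "M \<in> carrier_mat ((\<eta> + 1) * m) ((\<epsilon> + 1) * n)" "has_grade 1 M" and g: "has_grade 1 K" "has_grade 1 K'"
  shows "linearization (four_block_mat M K'\<^sup>T K (0\<^sub>m (\<epsilon> * n) (\<eta> * m))) (\<Lambda>'\<^sup>T * M * \<Lambda>)"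
proof -
  interpret D: dual_blocks "\<epsilon> * n" "(\<eta> + 1) * m" "(\<epsilon> + 1) * n" "\<eta> * m" m n K N \<Lambda> J "K'\<^sup>T" "N'\<^sup>T" "\<Lambda>'\<^sup>T" "J'\<^sup>T"
    by (rule dual_blocks_of_systems[OF 1 2])
  have Q: "D.Q M = \<Lambda>'\<^sup>T * M * \<Lambda>"
    unfolding D.Q_def[OF M(1)] D.M\<Lambda>_def[OF M(1)] by (rule assoc_mult_mat[OF D.\<Lambda>2 M(1) D.\<Lambda>, symmetric])
  let ?T = "four_block_mat M K'\<^sup>T K (0\<^sub>m (\<epsilon> * n) (\<eta> * m))"
  have T: "D.pencil_L M = ?T" by (rule D.pencil_L_def[OF M(1)])
  have Tc: "?T \<in> carrier_mat ((\<eta> + 1) * m + \<epsilon> * n) ((\<epsilon> + 1) * n + \<eta> * m)" by (rule four_block_carrier_mat[OF M(1) zero_carrier_mat])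
  have "has_grade 1 ?T"
    unfolding has_grade_four_block[OF M(1) D.K2 D.K zero_carrier_mat] using M(2) g by simp
  moreover have "dim_row (D.Q M) = m" "dim_col (D.Q M) = n" using D.product_carriers(6)[OF M(1)] by auto
  ultimately show ?thesis
    unfolding linearization_def Q[symmetric]
    using D.unimodular_UV[OF M(1)] D.block_diagonalization[OF M(1)] Tc unfolding T
    by (intro conjI exI[of _ "\<eta> * m + \<epsilon> * n"] exI[of _ "D.U M"] exI[of _ "D.V M"]) (simp_all only: carrier_matD)
qed

lemma strictly_equivalent_rev:
  fixes T :: "'a::idom poly mat"
  assumes "strictly_equivalent T' T" "has_grade 1 T"
  shows "strictly_equivalent (rev_mat 1 T') (rev_mat 1 T)"
proof -
  define r c where "r = dim_row T" and "c = dim_col T"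
  have T: "T \<in> carrier_mat r c" by (simp add: r_def c_def)
  obtain E E' F F' where E: "inverse_pair r E E'" and F: "inverse_pair c F F'" and T': "T' = const_mat E * T * const_mat F"
    using assms unfolding strictly_equivalent_def r_def c_def by blast
  note e = const_mat_inverse[OF E] and f = const_mat_inverse[OF F]
  have ET: "const_mat E * T \<in> carrier_mat r c" by (rule mult_carrier_mat[OF e(3) T])
  have g: "has_grade 1 (const_mat E * T)" using has_grade_const_mult[of E r r T c 1] T assms(2) E by (simp add: inverse_pair_def)
  have "rev_mat 1 T' = rev_mat 1 (const_mat E * T) * const_mat F"
    using rev_mat_mult[OF ET g f(3) has_grade_const, of 0] by (simp add: T' rev_mat_const)
  also have "rev_mat 1 (const_mat E * T) = const_mat E * rev_mat 1 T"
    using rev_mat_mult[OF e(3) has_grade_const T assms(2), of 0] by (simp add: rev_mat_const)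
  finally show ?thesis using strictly_equivalentI[OF E F, of "rev_mat 1 T"] T by simp
qed

text \<open>Reversal acts block by block, so the reversed pencil is assembled from the reversed dual
  systems. On the product it acts factor by factor, because the grades \<open>\<eta>\<close>, 1 and
  \<open>\<epsilon>\<close> add up to the grade of the polynomial.\<close>

lemma strong_linearization_block_kronecker:
  fixes M :: "'a::field poly mat"
  assumes M: "M \<in> carrier_mat ((\<eta> + 1) * m) ((\<epsilon> + 1) * n)" "has_grade 1 M"
    and eq: "strictly_equivalent T' (four_block_mat M (L_pencil \<eta> \<otimes>\<^sub>m 1\<^sub>m m)\<^sup>T (L_pencil \<epsilon> \<otimes>\<^sub>m 1\<^sub>m n) (0\<^sub>m (\<epsilon> * n) (\<eta> * m)))"
  shows "strong_linearization (\<epsilon> + \<eta> + 1) T' ((Lambda_col \<eta> \<otimes>\<^sub>m 1\<^sub>m m)\<^sup>T * M * (Lambda_col \<epsilon> \<otimes>\<^sub>m 1\<^sub>m n))"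
proof -
  let ?K = "L_pencil \<epsilon> \<otimes>\<^sub>m 1\<^sub>m n :: 'a poly mat" and ?K' = "L_pencil \<eta> \<otimes>\<^sub>m 1\<^sub>m m :: 'a poly mat"
  let ?\<Lambda> = "Lambda_col \<epsilon> \<otimes>\<^sub>m 1\<^sub>m n :: 'a poly mat" and ?\<Lambda>' = "Lambda_col \<eta> \<otimes>\<^sub>m 1\<^sub>m m :: 'a poly mat"
  let ?T = "four_block_mat M ?K'\<^sup>T ?K (0\<^sub>m (\<epsilon> * n) (\<eta> * m))"
  note s1 = dual_system_kron[OF dual_system_L_pencil[where ?'a = 'a]]
  note s2 = dual_system_kron[OF dual_system_rev_L_pencil[where ?'a = 'a]]
  have c: "?K \<in> carrier_mat (\<epsilon> * n) ((\<epsilon> + 1) * n)" "?K'\<^sup>T \<in> carrier_mat ((\<eta> + 1) * m) (\<eta> * m)"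
    "?\<Lambda> \<in> carrier_mat ((\<epsilon> + 1) * n) n" "?\<Lambda>'\<^sup>T \<in> carrier_mat m ((\<eta> + 1) * m)"
    using s1[of \<epsilon> n] s1[of \<eta> m] unfolding dual_system_def by simp_all
  have gK: "has_grade 1 ?K" "has_grade 1 ?K'" by (intro has_grade_kron_one has_grade_L_pencil)+
  have gL: "has_grade \<epsilon> ?\<Lambda>" "has_grade \<eta> ?\<Lambda>'\<^sup>T"
    by (simp_all add: has_grade_kron_one has_grade_Lambda_col)
  have gM: "has_grade (\<eta> + 1) (?\<Lambda>'\<^sup>T * M)" by (rule has_grade_mult[OF c(4) M(1) gL(2) M(2)])
  have cM: "?\<Lambda>'\<^sup>T * M \<in> carrier_mat m ((\<epsilon> + 1) * n)" by (rule mult_carrier_mat[OF c(4) M(1)])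
  have d: "\<epsilon> + \<eta> + 1 = \<eta> + 1 + \<epsilon>" by simp
  have 1: "has_grade (\<epsilon> + \<eta> + 1) (?\<Lambda>'\<^sup>T * M * ?\<Lambda>)" unfolding d by (rule has_grade_mult[OF cM c(3) gM gL(1)])
  have 2: "linearization ?T (?\<Lambda>'\<^sup>T * M * ?\<Lambda>)" by (rule linearization_dual_systems[OF s1 s1 M gK])
  have gT: "has_grade 1 ?T" using 2 by (simp add: linearization_def)
  have revT: "rev_mat 1 ?T = four_block_mat (rev_mat 1 M) (rev_mat 1 (L_pencil \<eta>) \<otimes>\<^sub>m 1\<^sub>m m)\<^sup>T
      (rev_mat 1 (L_pencil \<epsilon>) \<otimes>\<^sub>m 1\<^sub>m n) (0\<^sub>m (\<epsilon> * n) (\<eta> * m))"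
    unfolding rev_mat_kron_one[symmetric] rev_mat_transpose[symmetric]
    unfolding rev_mat_def map_four_block_mat[OF M(1) c(2) c(1) zero_carrier_mat]
    by (simp only: rev_mat_def[symmetric] rev_mat_zero)
  have "rev_mat (\<epsilon> + \<eta> + 1) (?\<Lambda>'\<^sup>T * M * ?\<Lambda>) = rev_mat \<eta> ?\<Lambda>'\<^sup>T * rev_mat 1 M * rev_mat \<epsilon> ?\<Lambda>"
    unfolding d rev_mat_mult[OF cM gM c(3) gL(1)] rev_mat_mult[OF c(4) gL(2) M] ..
  then have revQ: "rev_mat (\<epsilon> + \<eta> + 1) (?\<Lambda>'\<^sup>T * M * ?\<Lambda>) =
      (rev_mat \<eta> (Lambda_col \<eta>) \<otimes>\<^sub>m 1\<^sub>m m)\<^sup>T * rev_mat 1 M * (rev_mat \<epsilon> (Lambda_col \<epsilon>) \<otimes>\<^sub>m 1\<^sub>m n)"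
    by (simp only: rev_mat_transpose rev_mat_kron_one)
  have 3: "linearization (rev_mat 1 ?T) (rev_mat (\<epsilon> + \<eta> + 1) (?\<Lambda>'\<^sup>T * M * ?\<Lambda>))"
    unfolding revT revQ using M(1)
    by (intro linearization_dual_systems[OF s2 s2] has_grade_kron_one has_grade_rev_mat) simp
  show ?thesis
    unfolding strong_linearization_def
    using 1 linearization_strictly_equivalent[OF eq 2] linearization_strictly_equivalent[OF strictly_equivalent_rev[OF eq gT] 3]
    by blast
qed

section \<open>Minimal indices\<close>

text \<open>The kernel vectors of \<open>A\<close> that \<open>F\<close> sends into the span of the
  image form a subspace \<open>N\<close> containing \<open>S\<close>, hence all of the kernel; and
  every kernel vector \<open>v\<close> of \<open>A'\<close> is \<open>F\<close> applied to
  \<open>G v\<close>.\<close>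

lemma kernel_gen_set_image:
  fixes A A' F G :: "'a::field mat"
  assumes A: "A \<in> carrier_mat r c" and A': "A' \<in> carrier_mat r' c'" and F: "F \<in> carrier_mat c' c"
    and FK: "\<And>v. v \<in> mat_kernel A \<Longrightarrow> F *\<^sub>v v \<in> mat_kernel A'"
    and GK: "\<And>v. v \<in> mat_kernel A' \<Longrightarrow> G *\<^sub>v v \<in> mat_kernel A"
    and FG: "\<And>v. v \<in> mat_kernel A' \<Longrightarrow> F *\<^sub>v (G *\<^sub>v v) = v"
    and S: "S \<subseteq> mat_kernel A" "kernel.span c A S = mat_kernel A"
  shows "kernel.span c' A' ((*\<^sub>v) F ` S) = mat_kernel A'"
proof -
  interpret K: kernel r c A by unfold_locales (rule A)
  interpret K': kernel r' c' A' by unfold_locales (rule A')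
  have T: "(*\<^sub>v) F ` S \<subseteq> mat_kernel A'" using S(1) FK by auto
  have sub: "submodule class_ring (K'.span ((*\<^sub>v) F ` S)) K'.VK" using K'.Ker.span_is_submodule T by simp
  define N where "N = {v \<in> mat_kernel A. F *\<^sub>v v \<in> K'.span ((*\<^sub>v) F ` S)}"
  have kc: "v \<in> carrier_vec c" if "v \<in> mat_kernel A" for v using mat_kernelD(1)[OF A that] .
  have "submodule class_ring N K.VK"
  proof (unfold_locales)
    show "N \<subseteq> carrier K.VK" by (auto simp: N_def)
    show "v \<oplus>\<^bsub>K.VK\<^esub> w \<in> N" if "v \<in> N" "w \<in> N" for v w
    proof -
      have vw: "v \<in> mat_kernel A" "w \<in> mat_kernel A" using that by (auto simp: N_def)
      then have "v + w \<in> mat_kernel A" using K.Ker.M.add.m_closed[of v w] by (simp add: module_vec_simps)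
      moreover have "F *\<^sub>v (v + w) = F *\<^sub>v v + F *\<^sub>v w"
        by (rule mult_add_distrib_mat_vec[OF F kc[OF vw(1)] kc[OF vw(2)]])
      moreover have "F *\<^sub>v v + F *\<^sub>v w \<in> K'.span ((*\<^sub>v) F ` S)"
        using submodule.m_closed[OF sub, of "F *\<^sub>v v" "F *\<^sub>v w"] that by (simp add: N_def module_vec_simps)
      ultimately show ?thesis by (simp add: N_def module_vec_simps)
    qed
    show "\<zero>\<^bsub>K.VK\<^esub> \<in> N"
    proof -
      have "F *\<^sub>v 0\<^sub>v c = 0\<^sub>v c'" using F by (intro eq_vecI) auto
      moreover have "0\<^sub>v c' \<in> K'.span ((*\<^sub>v) F ` S)"
        using submodule.zero_closed[OF sub] by (simp add: module_vec_simps)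
      moreover have "0\<^sub>v c \<in> mat_kernel A" using K.Ker.M.zero_closed by (simp add: module_vec_simps)
      ultimately show ?thesis by (simp add: N_def module_vec_simps)
    qed
    show "x \<odot>\<^bsub>K.VK\<^esub> v \<in> N" if "x \<in> carrier class_ring" "v \<in> N" for x v
    proof -
      have v: "v \<in> mat_kernel A" using that by (auto simp: N_def)
      then have "x \<cdot>\<^sub>v v \<in> mat_kernel A" by (rule mat_kernel_smult[OF A])
      moreover have "F *\<^sub>v (x \<cdot>\<^sub>v v) = x \<cdot>\<^sub>v (F *\<^sub>v v)" by (rule mult_mat_vec[OF F kc[OF v]])
      moreover have "x \<cdot>\<^sub>v (F *\<^sub>v v) \<in> K'.span ((*\<^sub>v) F ` S)"
        using submodule.smult_closed[OF sub that(1), of "F *\<^sub>v v"] that by (simp add: N_def module_vec_simps)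
      ultimately show ?thesis by (simp add: N_def module_vec_simps)
    qed
  qed
  moreover have "S \<subseteq> N" using S(1) K'.Ker.in_own_span T by (auto simp: N_def)
  ultimately have "K.span S \<subseteq> N" by (intro K.Ker.span_is_subset) auto
  then have N: "mat_kernel A \<subseteq> N" using S(2) by simp
  have "v \<in> K'.span ((*\<^sub>v) F ` S)" if "v \<in> mat_kernel A'" for v
    using N GK[OF that] FG[OF that] by (auto simp: N_def)
  moreover have "K'.span ((*\<^sub>v) F ` S) \<subseteq> mat_kernel A'" using K'.Ker.span_is_subset2 T by simp
  ultimately show ?thesis by auto
qed

text \<open>Transporting generating sets in both directions shows that the dimensions agree. A
  generating set with no more elements than the dimension is a basis, so independence of the image
  follows by counting.\<close>

lemma kernel_basis_image:
  fixes A A' F G :: "'a::field mat"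
  assumes A: "A \<in> carrier_mat r c" and A': "A' \<in> carrier_mat r' c'"
    and F: "F \<in> carrier_mat c' c" and G: "G \<in> carrier_mat c c'"
    and FK: "\<And>v. v \<in> mat_kernel A \<Longrightarrow> F *\<^sub>v v \<in> mat_kernel A'"
    and GK: "\<And>v. v \<in> mat_kernel A' \<Longrightarrow> G *\<^sub>v v \<in> mat_kernel A"
    and FG: "\<And>v. v \<in> mat_kernel A' \<Longrightarrow> F *\<^sub>v (G *\<^sub>v v) = v"
    and GF: "\<And>v. v \<in> mat_kernel A \<Longrightarrow> G *\<^sub>v (F *\<^sub>v v) = v"
    and S: "finite S" "kernel.basis c A S"
  shows "kernel.basis c' A' ((*\<^sub>v) F ` S)" "kernel.dim c A = kernel.dim c' A'"
proof -
  interpret K: kernel r c A by unfold_locales (rule A)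
  interpret K': kernel r' c' A' by unfold_locales (rule A')
  have Sb: "S \<subseteq> mat_kernel A" "K.span S = mat_kernel A" using S(2) by (auto simp: K.Ker.basis_def)
  have T: "(*\<^sub>v) F ` S \<subseteq> mat_kernel A'" using Sb FK by auto
  have span: "K'.span ((*\<^sub>v) F ` S) = mat_kernel A'" by (rule kernel_gen_set_image[OF A A' F FK GK FG Sb])
  obtain S' where S': "finite S'" "K'.basis S'" using kernel_basis_exists[OF A'] by auto
  have Sb': "S' \<subseteq> mat_kernel A'" "K'.span S' = mat_kernel A'" using S'(2) by (auto simp: K'.Ker.basis_def)
  have span': "K.span ((*\<^sub>v) G ` S') = mat_kernel A" by (rule kernel_gen_set_image[OF A' A G GK FK GF Sb'])
  have T': "(*\<^sub>v) G ` S' \<subseteq> mat_kernel A" using Sb' GK by auto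
  have dS: "card S = K.dim" "card S' = K'.dim" using K.Ker.dim_basis[OF S] K'.Ker.dim_basis[OF S'] by auto
  have "K.dim \<le> card ((*\<^sub>v) G ` S')" using K.Ker.gen_ge_dim[of "(*\<^sub>v) G ` S'"] S'(1) T' span' by simp
  also have "\<dots> \<le> K'.dim" using card_image_le[OF S'(1)] dS by simp
  finally have le: "K.dim \<le> K'.dim" .
  have "K'.dim \<le> card ((*\<^sub>v) F ` S)" using K'.Ker.gen_ge_dim[of "(*\<^sub>v) F ` S"] S(1) T span by simp
  also have "card ((*\<^sub>v) F ` S) \<le> K.dim" using card_image_le[OF S(1)] dS by simp
  finally show dim: "K.dim = K'.dim" using le by simp
  have "card ((*\<^sub>v) F ` S) \<le> K'.dim" using card_image_le[OF S(1)] dS dim by simp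
  then show "K'.basis ((*\<^sub>v) F ` S)"
    using K'.Ker.dim_gen_is_basis[of "(*\<^sub>v) F ` S"] S(1) T span by simp
qed

lemma sorted_list_of_multiset_image_add:
  "sorted_list_of_multiset (image_mset (\<lambda>x. x + k) M) = map (\<lambda>x. x + k) (sorted_list_of_multiset M)" for k :: nat
proof -
  have "sorted (sorted_list_of_multiset M)" by simp
  then have "sorted (map (\<lambda>x. x + k) (sorted_list_of_multiset M))"
    by (simp add: sorted_iff_nth_mono)
  then have "sort (sorted_list_of_multiset (image_mset (\<lambda>x. x + k) M)) = map (\<lambda>x. x + k) (sorted_list_of_multiset M)"
    by (intro properties_for_sort) simp_all
  then show ?thesis by (simp add: sorted_sort_id)
qed

text \<open>\<open>\<Phi>\<close> and \<open>\<Psi>\<close> are inverse to each other between the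
  null spaces, and both are polynomial, so they exchange polynomial bases. Every basis gains the
  same total degree, \<open>k\<close> times the dimension, so a basis of least total degree is
  mapped to one.\<close>

lemma right_minimal_indices_shift:
  fixes A A' \<Phi> \<Psi> X X' Y :: "'a::field poly mat"
  assumes A: "A \<in> carrier_mat r c" and A': "A' \<in> carrier_mat r' c'"
    and \<Phi>: "\<Phi> \<in> carrier_mat c' c" and \<Psi>: "\<Psi> \<in> carrier_mat c c'"
    and X: "X \<in> carrier_mat r' r" and X': "X' \<in> carrier_mat r r'" and Y: "Y \<in> carrier_mat c' r'"
    and \<Psi>\<Phi>: "\<Psi> * \<Phi> = 1\<^sub>m c" and A'\<Phi>: "A' * \<Phi> = X * A" and A\<Psi>: "A * \<Psi> = X' * A'"
    and \<Phi>\<Psi>: "\<Phi> * \<Psi> + Y * A' = 1\<^sub>m c'"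
    and deg: "\<And>w. w \<in> carrier_vec c \<Longrightarrow> A *\<^sub>v w = 0\<^sub>v r \<Longrightarrow> w \<noteq> 0\<^sub>v c \<Longrightarrow> vec_degree (\<Phi> *\<^sub>v w) = vec_degree w + k"
  shows "right_minimal_indices A' = map (\<lambda>\<alpha>. \<alpha> + k) (right_minimal_indices A)"
proof -
  let ?h = "to_fract :: 'a poly \<Rightarrow> _"
  interpret h: inj_comm_ring_hom ?h by unfold_locales auto
  let ?H = "map_mat ?h" and ?f = "map_vec ?h"
  have inj: "inj ?f"
  proof (rule injI)
    fix v w assume "?f v = ?f w"
    then show "v = w" by (metis eq_vecI index_map_vec to_fract_eq_iff)
  qed
  have c: "?H A \<in> carrier_mat r c" "?H A' \<in> carrier_mat r' c'" "?H \<Phi> \<in> carrier_mat c' c" "?H \<Psi> \<in> carrier_mat c c'"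
    "?H X \<in> carrier_mat r' r" "?H X' \<in> carrier_mat r r'" "?H Y \<in> carrier_mat c' r'"
    using A A' \<Phi> \<Psi> X X' Y by auto
  have e1: "?H \<Psi> * ?H \<Phi> = 1\<^sub>m c" using h.mat_hom_mult[OF \<Psi> \<Phi>] \<Psi>\<Phi> h.mat_hom_one by simp
  have e2: "?H A' * ?H \<Phi> = ?H X * ?H A" using h.mat_hom_mult[OF A' \<Phi>] h.mat_hom_mult[OF X A] A'\<Phi> by simp
  have e3: "?H A * ?H \<Psi> = ?H X' * ?H A'" using h.mat_hom_mult[OF A \<Psi>] h.mat_hom_mult[OF X' A'] A\<Psi> by simp
  have e4: "?H \<Phi> * ?H \<Psi> + ?H Y * ?H A' = 1\<^sub>m c'"
  proof -
    have "?H (\<Phi> * \<Psi> + Y * A') = ?H (\<Phi> * \<Psi>) + ?H (Y * A')"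
      using \<Phi> \<Psi> Y A' by (intro eq_matI) (auto simp: h.hom_add simp del: index_mult_mat(1))
    then show ?thesis using h.mat_hom_mult[OF \<Phi> \<Psi>] h.mat_hom_mult[OF Y A'] \<Phi>\<Psi> h.mat_hom_one by simp
  qed
  have FK: "?H \<Phi> *\<^sub>v v \<in> mat_kernel (?H A')" if "v \<in> mat_kernel (?H A)" for v
  proof -
    have v: "v \<in> carrier_vec c" "?H A *\<^sub>v v = 0\<^sub>v r" using mat_kernelD[OF c(1) that] by auto
    have "?H A' *\<^sub>v (?H \<Phi> *\<^sub>v v) = ?H X *\<^sub>v (?H A *\<^sub>v v)"
      using assoc_mult_mat_vec[OF c(2,3) v(1)] assoc_mult_mat_vec[OF c(5,1) v(1)] e2 by simp
    also have "\<dots> = 0\<^sub>v r'" using v c by (intro eq_vecI) auto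
    finally show ?thesis using c v by (intro mat_kernelI[OF c(2)]) auto
  qed
  have GK: "?H \<Psi> *\<^sub>v v \<in> mat_kernel (?H A)" if "v \<in> mat_kernel (?H A')" for v
  proof -
    have v: "v \<in> carrier_vec c'" "?H A' *\<^sub>v v = 0\<^sub>v r'" using mat_kernelD[OF c(2) that] by auto
    have "?H A *\<^sub>v (?H \<Psi> *\<^sub>v v) = ?H X' *\<^sub>v (?H A' *\<^sub>v v)"
      using assoc_mult_mat_vec[OF c(1,4) v(1)] assoc_mult_mat_vec[OF c(6,2) v(1)] e3 by simp
    also have "\<dots> = 0\<^sub>v r" using v c by (intro eq_vecI) auto
    finally show ?thesis using c v by (intro mat_kernelI[OF c(1)]) auto
  qed
  have GF: "?H \<Psi> *\<^sub>v (?H \<Phi> *\<^sub>v v) = v" if "v \<in> mat_kernel (?H A)" for v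
    using mat_kernelD[OF c(1) that] assoc_mult_mat_vec[OF c(4,3), of v] e1 by simp
  have FG: "?H \<Phi> *\<^sub>v (?H \<Psi> *\<^sub>v v) = v" if "v \<in> mat_kernel (?H A')" for v
  proof -
    have v: "v \<in> carrier_vec c'" "?H A' *\<^sub>v v = 0\<^sub>v r'" using mat_kernelD[OF c(2) that] by auto
    have p: "?H \<Phi> * ?H \<Psi> \<in> carrier_mat c' c'" "?H Y * ?H A' \<in> carrier_mat c' c'"
      using mult_carrier_mat[OF c(3,4)] mult_carrier_mat[OF c(7,2)] by auto
    have "v = (?H \<Phi> * ?H \<Psi> + ?H Y * ?H A') *\<^sub>v v" using e4 v by simp
    also have "\<dots> = ?H \<Phi> * ?H \<Psi> *\<^sub>v v + ?H Y * ?H A' *\<^sub>v v" by (rule add_mult_distrib_mat_vec[OF p v(1)])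
    also have "?H Y * ?H A' *\<^sub>v v = 0\<^sub>v c'"
      unfolding assoc_mult_mat_vec[OF c(7,2) v(1)] v(2) using c by (intro eq_vecI) auto
    also have "?H \<Phi> * ?H \<Psi> *\<^sub>v v + 0\<^sub>v c' = ?H \<Phi> *\<^sub>v (?H \<Psi> *\<^sub>v v)"
      unfolding assoc_mult_mat_vec[OF c(3,4) v(1)]
      by (rule right_zero_vec[OF mult_mat_vec_carrier[OF c(3) mult_mat_vec_carrier[OF c(4) v(1)]]])
    finally show ?thesis by simp
  qed
  interpret K: kernel r c "?H A" by unfold_locales (rule c(1))
  interpret K': kernel r' c' "?H A'" by unfold_locales (rule c(2))
  have npb: "null_poly_basis A B \<longleftrightarrow> finite B \<and> K.basis (?f ` B)" for B
    using A by (simp add: null_poly_basis_def)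
  have npb': "null_poly_basis A' B \<longleftrightarrow> finite B \<and> K'.basis (?f ` B)" for B
    using A' by (simp add: null_poly_basis_def)
  have ker: "w \<in> carrier_vec c" "A *\<^sub>v w = 0\<^sub>v r" "w \<noteq> 0\<^sub>v c" if "null_poly_basis A B" "w \<in> B" for B w
  proof -
    have b: "K.basis (?f ` B)" "?f w \<in> ?f ` B" using that by (auto simp: npb)
    then have k: "?f w \<in> mat_kernel (?H A)" by (auto simp: K.Ker.basis_def)
    note k' = mat_kernelD[OF c(1) k]
    show w: "w \<in> carrier_vec c" using k'(1) by simp
    have "?f (A *\<^sub>v w) = ?f (0\<^sub>v r)"
      using k'(2) h.mult_mat_vec_hom[OF A w] by (intro eq_vecI) auto
    then show "A *\<^sub>v w = 0\<^sub>v r" using inj by (simp add: inj_eq)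
    \<comment> \<open>The zero vector has \<open>vec_degree\<close> 0 and stays zero under
      \<open>\<Phi>\<close>; the degree shift can be asked of nonzero vectors only.\<close>
    show "w \<noteq> 0\<^sub>v c"
    proof
      assume w0: "w = 0\<^sub>v c"
      have f0: "?f (0\<^sub>v c) = 0\<^sub>v c" by (intro eq_vecI) auto
      have "\<zero>\<^bsub>K.VK\<^esub> \<in> ?f ` B" using b(2) unfolding w0 f0 by (simp add: module_vec_simps)
      then have "K.lin_dep (?f ` B)" using K.Ker.vs_zero_lin_dep[of "?f ` B"] b(1) by (auto simp: K.Ker.basis_def)
      then show False using b(1) by (simp add: K.Ker.basis_def)
    qed
  qed
  have ker': "w \<in> carrier_vec c'" "?f w \<in> mat_kernel (?H A')" if "null_poly_basis A' C" "w \<in> C" for C w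
  proof -
    show k: "?f w \<in> mat_kernel (?H A')" using that by (auto simp: npb' K'.Ker.basis_def)
    show "w \<in> carrier_vec c'" using mat_kernelD(1)[OF c(2) k] by simp
  qed
  have img: "?f ` ((*\<^sub>v) \<Phi> ` B) = (*\<^sub>v) (?H \<Phi>) ` (?f ` B)" if "null_poly_basis A B" for B
    unfolding image_image using ker(1)[OF that] h.mult_mat_vec_hom[OF \<Phi>] by (intro image_cong) auto
  have img': "?f ` ((*\<^sub>v) \<Psi> ` C) = (*\<^sub>v) (?H \<Psi>) ` (?f ` C)" if "null_poly_basis A' C" for C
    unfolding image_image using ker'(1)[OF that] h.mult_mat_vec_hom[OF \<Psi>] by (intro image_cong) auto
  have to: "null_poly_basis A' ((*\<^sub>v) \<Phi> ` B)" if "null_poly_basis A B" for B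
    using kernel_basis_image(1)[OF c(1,2,3,4) FK GK FG GF, of "?f ` B"] that img[OF that] by (simp add: npb npb')
  have bk: "null_poly_basis A ((*\<^sub>v) \<Psi> ` C)" if "null_poly_basis A' C" for C
    using kernel_basis_image(1)[OF c(2,1,4,3) GK FK GF FG, of "?f ` C"] that img'[OF that] by (simp add: npb npb')
  have injB: "inj_on ((*\<^sub>v) \<Phi>) B" if "null_poly_basis A B" for B
  proof (rule inj_on_inverseI[of _ "(*\<^sub>v) \<Psi>"])
    fix w assume "w \<in> B"
    then show "\<Psi> *\<^sub>v (\<Phi> *\<^sub>v w) = w" using assoc_mult_mat_vec[OF \<Psi> \<Phi>, of w] ker(1)[OF that] \<Psi>\<Phi> by simp
  qed
  have cardB: "card B = K.dim" if "null_poly_basis A B" for B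
    using K.Ker.dim_basis[of "?f ` B"] that card_image[OF inj_on_subset[OF inj subset_UNIV], of B] by (simp add: npb)
  have degB: "vec_degree (\<Phi> *\<^sub>v w) = vec_degree w + k" if "null_poly_basis A B" "w \<in> B" for B w
    by (rule deg) (rule ker[OF that])+
  have sumB: "(\<Sum>v\<in>(*\<^sub>v) \<Phi> ` B. vec_degree v) = (\<Sum>w\<in>B. vec_degree w) + k * K.dim" if "null_poly_basis A B" for B
  proof -
    have "(\<Sum>v\<in>(*\<^sub>v) \<Phi> ` B. vec_degree v) = (\<Sum>w\<in>B. vec_degree w + k)"
      using degB[OF that] by (simp add: sum.reindex[OF injB[OF that]])
    then show ?thesis by (simp add: sum.distrib cardB[OF that])
  qed
  obtain B where B: "minimal_basis A B" using minimal_basis_exists by blast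
  then have Bn: "null_poly_basis A B" by (simp add: minimal_basis_def)
  have "minimal_basis A' ((*\<^sub>v) \<Phi> ` B)"
    unfolding minimal_basis_def
  proof (intro conjI allI impI)
    show "null_poly_basis A' ((*\<^sub>v) \<Phi> ` B)" by (rule to[OF Bn])
    \<comment> \<open>A competitor \<open>C\<close> is the image under \<open>\<Phi>\<close> of the
      polynomial basis that \<open>\<Psi>\<close> makes of it, and minimality of \<open>B\<close>
      applies to that basis.\<close>
    fix C assume C: "null_poly_basis A' C"
    have "\<Phi> *\<^sub>v (\<Psi> *\<^sub>v w) = w" if w: "w \<in> C" for w
    proof -
      have "?f (\<Phi> *\<^sub>v (\<Psi> *\<^sub>v w)) = ?H \<Phi> *\<^sub>v (?H \<Psi> *\<^sub>v ?f w)"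
        using h.mult_mat_vec_hom[OF \<Psi> ker'(1)[OF C w]] h.mult_mat_vec_hom[OF \<Phi> mult_mat_vec_carrier[OF \<Psi> ker'(1)[OF C w]]] by simp
      also have "\<dots> = ?f w" by (rule FG[OF ker'(2)[OF C w]])
      finally show ?thesis using inj by (simp add: inj_eq)
    qed
    then have "(*\<^sub>v) \<Phi> ` ((*\<^sub>v) \<Psi> ` C) = C" by (auto simp: image_image)
    then have "(\<Sum>v\<in>C. vec_degree v) = (\<Sum>w\<in>(*\<^sub>v) \<Psi> ` C. vec_degree w) + k * K.dim"
      using sumB[OF bk[OF C]] by simp
    moreover have "(\<Sum>v\<in>B. vec_degree v) \<le> (\<Sum>w\<in>(*\<^sub>v) \<Psi> ` C. vec_degree w)"
      using B bk[OF C] by (simp add: minimal_basis_def)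
    ultimately show "(\<Sum>v\<in>(*\<^sub>v) \<Phi> ` B. vec_degree v) \<le> (\<Sum>v\<in>C. vec_degree v)"
      using sumB[OF Bn] by simp
  qed
  then have "right_minimal_indices A' = sorted_list_of_multiset (image_mset vec_degree (mset_set ((*\<^sub>v) \<Phi> ` B)))"
    by (rule right_minimal_indices_eq)
  also have "image_mset vec_degree (mset_set ((*\<^sub>v) \<Phi> ` B)) = image_mset (\<lambda>w. vec_degree (\<Phi> *\<^sub>v w)) (mset_set B)"
    by (simp add: image_mset_mset_set[OF injB[OF Bn], symmetric] multiset.map_comp comp_def)
  also have "\<dots> = image_mset (\<lambda>x. x + k) (image_mset vec_degree (mset_set B))"
    using degB[OF Bn] Bn by (auto simp: multiset.map_comp comp_def npb intro!: image_mset_cong)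
  also have "sorted_list_of_multiset \<dots> = map (\<lambda>\<alpha>. \<alpha> + k) (right_minimal_indices A)"
    unfolding sorted_list_of_multiset_image_add right_minimal_indices_eq[OF B] ..
  finally show ?thesis .
qed

section \<open>Degrees of polynomial vectors and the shift of the minimal indices\<close>

lemma vec_degree_le_iff: "vec_degree v \<le> k \<longleftrightarrow> (\<forall>i<dim_vec v. degree (v $ i) \<le> k)"
proof -
  have "set\<^sub>v v = (\<lambda>i. v $ i) ` {..<dim_vec v}" by (auto simp: vec_set_def)
  then show ?thesis by (auto simp: vec_degree_def)
qed

lemma degree_le_vec_degree: "i < dim_vec v \<Longrightarrow> degree (v $ i) \<le> vec_degree v"
  using vec_degree_le_iff[of v "vec_degree v"] by simp

text \<open>Degree 0 is a separate case: the zero polynomial has degree 0 too, and the entry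
  returned must be nonzero.\<close>

lemma vec_degree_attained:
  assumes "v \<in> carrier_vec c" "v \<noteq> 0\<^sub>v c"
  obtains i where "i < c" "v $ i \<noteq> 0" "degree (v $ i) = vec_degree v"
proof (cases "vec_degree v = 0")
  case True
  obtain i where i: "i < c" "v $ i \<noteq> 0" using assms by (metis carrier_vecD eq_vecI index_zero_vec)
  then show ?thesis using that[of i] degree_le_vec_degree[of i v] True assms by auto
next
  case False
  have "\<not> vec_degree v \<le> vec_degree v - 1" using False by simp
  then obtain i where i: "i < c" "\<not> degree (v $ i) \<le> vec_degree v - 1" using assms(1) by (auto simp: vec_degree_le_iff)
  then have "degree (v $ i) = vec_degree v" using degree_le_vec_degree[of i v] assms(1) by auto
  then show ?thesis using that[of i] i False by (metis degree_0)
qed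

lemma degree_mult_mat_vec_le:
  fixes A :: "'a::comm_semiring_0 poly mat"
  assumes "A \<in> carrier_mat r c" "has_grade a A" "v \<in> carrier_vec c" "i < r"
  shows "degree ((A *\<^sub>v v) $ i) \<le> a + vec_degree v"
proof -
  have "degree (A $$ (i, l) * v $ l) \<le> a + vec_degree v" if "l < c" for l
  proof -
    have "degree (A $$ (i, l)) \<le> a" "degree (v $ l) \<le> vec_degree v"
      using assms that degree_le_vec_degree[of l v] by (auto simp: has_grade_iff)
    then show ?thesis using degree_mult_le[of "A $$ (i, l)" "v $ l"] by simp
  qed
  then show ?thesis using assms by (auto simp: scalar_prod_def intro!: degree_sum_le)
qed

text \<open>A constant matrix cannot raise the degree, and neither can its inverse.\<close>

lemma vec_degree_const_mat:
  fixes w :: "'a::comm_ring_1 poly vec"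
  assumes F: "inverse_pair c F F'" and w: "w \<in> carrier_vec c"
  shows "vec_degree (const_mat F *\<^sub>v w) = vec_degree w"
proof -
  have le: "vec_degree (const_mat G *\<^sub>v v) \<le> vec_degree v" if "G \<in> carrier_mat c c" "v \<in> carrier_vec c" for G and v :: "'a poly vec"
    using degree_mult_mat_vec_le[of "const_mat G" c c 0 v] that by (auto simp: vec_degree_le_iff)
  note f = const_mat_inverse[OF F]
  have "const_mat F' *\<^sub>v (const_mat F *\<^sub>v w) = w" using assoc_mult_mat_vec[OF f(4,3) w] f(2) w by simp
  then have "vec_degree w \<le> vec_degree (const_mat F *\<^sub>v w)"
    using le[of F' "const_mat F *\<^sub>v w"] F mult_mat_vec_carrier[OF f(3) w] by (simp add: inverse_pair_def)
  then show ?thesis using le[of F w] F w by (simp add: inverse_pair_def)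
qed

text \<open>The constant matrix \<open>F'\<close> maps the null space of \<open>T\<close> onto that
  of \<open>T'\<close> without changing degrees: the shift lemma with shift 0.\<close>

lemma right_minimal_indices_strictly_equivalent:
  fixes T :: "'a::field poly mat"
  assumes "strictly_equivalent T' T"
  shows "right_minimal_indices T' = right_minimal_indices T"
proof -
  define r c where "r = dim_row T" and "c = dim_col T"
  have T: "T \<in> carrier_mat r c" by (simp add: r_def c_def)
  obtain E E' F F' where E: "inverse_pair r E E'" and F: "inverse_pair c F F'" and T': "T' = const_mat E * T * const_mat F"
    using assms unfolding strictly_equivalent_def r_def c_def by blast
  note e = const_mat_inverse[OF E] and f = const_mat_inverse[OF F]
  have ET: "const_mat E * T \<in> carrier_mat r c" by (rule mult_carrier_mat[OF e(3) T])
  have TF: "T * const_mat F \<in> carrier_mat r c" by (rule mult_carrier_mat[OF T f(3)])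
  have T'c: "T' \<in> carrier_mat r c" unfolding T' by (rule mult_carrier_mat[OF ET f(3)])
  have 1: "T' * const_mat F' = const_mat E * T"
    unfolding T' assoc_mult_mat[OF ET f(3,4)] f(1) by (rule right_mult_one_mat[OF ET])
  have 2: "T * const_mat F = const_mat E' * T'"
    unfolding T' assoc_mult_mat[OF e(3) T f(3)] assoc_mult_mat[OF e(4,3) TF, symmetric] e(2)
    by (rule left_mult_one_mat[OF TF, symmetric])
  have 3: "const_mat F' * const_mat F + 0\<^sub>m c r * T' = 1\<^sub>m c"
    unfolding f(2) left_mult_zero_mat[OF T'c] by simp
  have "right_minimal_indices T' = map (\<lambda>\<alpha>. \<alpha> + 0) (right_minimal_indices T)"
    by (rule right_minimal_indices_shift[OF T T'c f(4) f(3) e(3) e(4) zero_carrier_mat f(1) 1 2 3])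
      (simp add: vec_degree_const_mat[OF inverse_pair_sym[OF F]])
  then show ?thesis by simp
qed

lemma vcat_mult_vec:
  assumes "A \<in> carrier_mat r1 c" "B \<in> carrier_mat r2 c" "v \<in> carrier_vec c"
  shows "vcat A B *\<^sub>v v = (A *\<^sub>v v) @\<^sub>v (B *\<^sub>v v)"
proof (rule eq_vecI)
  fix i assume "i < dim_vec ((A *\<^sub>v v) @\<^sub>v (B *\<^sub>v v))"
  then have i: "i < r1 + r2" using assms by auto
  show "(vcat A B *\<^sub>v v) $ i = ((A *\<^sub>v v) @\<^sub>v (B *\<^sub>v v)) $ i"
  proof (cases "i < r1")
    case True
    then have "row (vcat A B) i = row A i" using assms by (intro eq_vecI) (auto simp: vcat_def)
    then show ?thesis using True i assms by (simp add: vcat_def)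
  next
    case False
    then have "row (vcat A B) i = row B (i - r1)" using assms i by (intro eq_vecI) (auto simp: vcat_def)
    then show ?thesis using False i assms by (simp add: vcat_def)
  qed
qed (use assms in \<open>auto simp: vcat_def\<close>)

lemma Lambda_kron_mult_vec_index:
  fixes w :: "'a::comm_ring_1 poly vec"
  assumes w: "w \<in> carrier_vec n" and i: "i < (k + 1) * n"
  shows "((Lambda_col k \<otimes>\<^sub>m 1\<^sub>m n) *\<^sub>v w) $ i = monom 1 (k - i div n) * w $ (i mod n)"
proof -
  have n: "n > 0" using i by (cases n) auto
  have "i div n < k + 1" using i by (simp add: less_mult_imp_div_less)
  then have e: "(Lambda_col k \<otimes>\<^sub>m 1\<^sub>m n) $$ (i, l) * w $ l = (if l = i mod n then monom 1 (k - i div n) * w $ l else 0)"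
    if "l < n" for l
    using that i by (auto simp: kron_one_index Lambda_col_def)
  have "((Lambda_col k \<otimes>\<^sub>m 1\<^sub>m n) *\<^sub>v w) $ i = (\<Sum>l<n. (Lambda_col k \<otimes>\<^sub>m 1\<^sub>m n) $$ (i, l) * w $ l)"
    using assms by (simp add: scalar_prod_def atLeast0LessThan Lambda_col_def)
  also have "\<dots> = (\<Sum>l<n. if l = i mod n then monom 1 (k - i div n) * w $ l else 0)"
    by (intro sum.cong refl e) simp
  finally show ?thesis using n by simp
qed

lemma kron_L_transpose_mult_vec_index:
  fixes y :: "'a::comm_ring_1 poly vec"
  assumes y: "y \<in> carrier_vec (k * m)" and j: "j < k * m"
  shows "((kron_L k m)\<^sup>T *\<^sub>v y) $ (j + m) = monom 1 1 * y $ j - (if j + m < k * m then y $ (j + m) else 0)"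
proof -
  have m: "m > 0" using j by (cases m) auto
  have jm: "j + m < (k + 1) * m" using j by simp
  have "((kron_L k m)\<^sup>T *\<^sub>v y) $ (j + m) = (\<Sum>l<k * m. (kron_L k m)\<^sup>T $$ (j + m, l) * y $ l)"
    using assms jm by (simp add: scalar_prod_def atLeast0LessThan)
  also have "\<dots> = (\<Sum>l<k * m. (if l = j then monom 1 1 * y $ l else 0) + (if l = j + m then - y $ l else 0))"
    using m jm by (intro sum.cong refl) (auto simp: kron_L_def)
  also have "\<dots> = monom 1 1 * y $ j - (if j + m < k * m then y $ (j + m) else 0)"
    unfolding sum.distrib using j by auto
  finally show ?thesis .
qed

text \<open>The component \<open>\<Lambda> w\<close> of \<open>col3 w\<close> has degree exactly
  \<open>vec_degree w + \<epsilon>\<close>, attained in its first block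
  \<open>\<lambda>^\<epsilon> w\<close>. What remains is that \<open>- X w\<close> does not exceed
  this degree; the degrees of the factors of \<open>X\<close> alone give a bound that is in general
  too weak.\<close>

lemma right_minimal_indices_block_kronecker:
  fixes M :: "'a::field poly mat"
  assumes M: "M \<in> carrier_mat ((\<eta> + 1) * m) ((\<epsilon> + 1) * n)" "has_grade 1 M"
  shows "right_minimal_indices (four_block_mat M (L_pencil \<eta> \<otimes>\<^sub>m 1\<^sub>m m)\<^sup>T (L_pencil \<epsilon> \<otimes>\<^sub>m 1\<^sub>m n) (0\<^sub>m (\<epsilon> * n) (\<eta> * m)))
    = map (\<lambda>\<alpha>. \<alpha> + \<epsilon>) (right_minimal_indices ((Lambda_col \<eta> \<otimes>\<^sub>m 1\<^sub>m m)\<^sup>T * M * (Lambda_col \<epsilon> \<otimes>\<^sub>m 1\<^sub>m n)))"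
proof -
  define K where "K = (L_pencil \<epsilon> \<otimes>\<^sub>m 1\<^sub>m n :: 'a poly mat)"
  define K' where "K' = (L_pencil \<eta> \<otimes>\<^sub>m 1\<^sub>m m :: 'a poly mat)"
  define \<Lambda> where "\<Lambda> = (Lambda_col \<epsilon> \<otimes>\<^sub>m 1\<^sub>m n :: 'a poly mat)"
  define \<Lambda>' where "\<Lambda>' = (Lambda_col \<eta> \<otimes>\<^sub>m 1\<^sub>m m :: 'a poly mat)"
  define a b c e where "a = \<epsilon> * n" and "b = (\<eta> + 1) * m" and "c = (\<epsilon> + 1) * n" and "e = \<eta> * m"
  obtain N J N' J' where s: "dual_system \<epsilon> n K N \<Lambda> J" "dual_system \<eta> m K' N' \<Lambda>' J'"
    using dual_system_kron[OF dual_system_L_pencil] unfolding K_def \<Lambda>_def K'_def \<Lambda>'_def by blast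
  interpret D: dual_blocks a b c e m n K N \<Lambda> J "K'\<^sup>T" "N'\<^sup>T" "\<Lambda>'\<^sup>T" "J'\<^sup>T"
    unfolding a_def b_def c_def e_def by (rule dual_blocks_of_systems[OF s])
  have M: "M \<in> carrier_mat b c" "has_grade 1 M" using M by (simp_all only: b_def c_def)
  define Q where "Q = D.Q M"
  have Q: "Q = \<Lambda>'\<^sup>T * M * \<Lambda>"
    unfolding Q_def D.Q_def[OF M(1)] D.M\<Lambda>_def[OF M(1)] by (rule assoc_mult_mat[OF D.\<Lambda>2 M(1) D.\<Lambda>, symmetric])
  have T: "D.pencil_L M = four_block_mat M K'\<^sup>T K (0\<^sub>m a e)" by (rule D.pencil_L_def[OF M(1)])
  note cs = D.product_carriers[OF M(1)] and bc = D.block_carriers[OF M(1)]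
  have "right_minimal_indices (D.pencil_L M) = map (\<lambda>\<alpha>. \<alpha> + \<epsilon>) (right_minimal_indices Q)"
  proof (rule right_minimal_indices_shift[OF _ bc(7) bc(6) hcat_carrier[OF D.J zero_carrier_mat] vcat_carrier[OF D.J2 zero_carrier_mat] bc(3) _
        D.left_inverse_col3[OF M(1)] _ _ D.col3_resolution[OF M(1)]])
    show "Q \<in> carrier_mat m n" unfolding Q_def by (rule cs)
    show "four_block_mat (0\<^sub>m c b) N N'\<^sup>T (- D.W M) \<in> carrier_mat (c + e) (b + a)"
      by (rule four_block_carrier_mat[OF zero_carrier_mat uminus_carrier_mat[OF cs(3)]])
    show "D.pencil_L M * D.col3 M = vcat J'\<^sup>T (0\<^sub>m a m) * Q" unfolding Q_def by (rule D.pencil_L_col3[OF M(1)])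
    show "Q * hcat J (0\<^sub>m n e) = D.row3 M * D.pencil_L M" unfolding Q_def by (rule D.Q_left_inverse[OF M(1)])
    fix w assume w: "w \<in> carrier_vec n" "Q *\<^sub>v w = 0\<^sub>v m" "w \<noteq> 0\<^sub>v n"
    define u where "u = \<Lambda> *\<^sub>v w"
    define y where "y = - D.X M *\<^sub>v w"
    have X: "- D.X M \<in> carrier_mat e n" using cs(4) by simp
    have u: "u \<in> carrier_vec c" unfolding u_def by (rule mult_mat_vec_carrier[OF D.\<Lambda> w(1)])
    have y: "y \<in> carrier_vec e" unfolding y_def by (rule mult_mat_vec_carrier[OF X w(1)])
    have \<Phi>w: "D.col3 M *\<^sub>v w = u @\<^sub>v y"
      unfolding u_def y_def D.col3_def[OF M(1)] by (rule vcat_mult_vec[OF D.\<Lambda> X w(1)])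
    have J0: "vcat J'\<^sup>T (0\<^sub>m a m) \<in> carrier_mat (b + a) m" by (rule vcat_carrier[OF D.J2 zero_carrier_mat])
    have "D.pencil_L M *\<^sub>v (D.col3 M *\<^sub>v w) = vcat J'\<^sup>T (0\<^sub>m a m) *\<^sub>v (Q *\<^sub>v w)"
      using assoc_mult_mat_vec[OF bc(7) bc(6) w(1)] assoc_mult_mat_vec[OF J0 cs(6)[folded Q_def] w(1)]
        D.pencil_L_col3[OF M(1), folded Q_def] by simp
    also have "\<dots> = 0\<^sub>v (b + a)" unfolding w(2) using J0 by (intro eq_vecI) auto
    finally have "(M *\<^sub>v u + K'\<^sup>T *\<^sub>v y) @\<^sub>v (K *\<^sub>v u + 0\<^sub>m a e *\<^sub>v y) = 0\<^sub>v (b + a)"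
      unfolding \<Phi>w T four_block_mat_mult_vec[OF M(1) D.K2 D.K zero_carrier_mat u y] .
    \<comment> \<open>The first block row of the null vector equation,
      \<open>M u + K'^T y = 0\<close>; it ties the degree of \<open>y\<close> to that of
      \<open>u\<close>.\<close>
    then have top: "(M *\<^sub>v u) $ i + (K'\<^sup>T *\<^sub>v y) $ i = 0" if "i < b" for i
    proof -
      assume z: "(M *\<^sub>v u + K'\<^sup>T *\<^sub>v y) @\<^sub>v (K *\<^sub>v u + 0\<^sub>m a e *\<^sub>v y) = 0\<^sub>v (b + a)"
      have "((M *\<^sub>v u + K'\<^sup>T *\<^sub>v y) @\<^sub>v (K *\<^sub>v u + 0\<^sub>m a e *\<^sub>v y)) $ i = (M *\<^sub>v u) $ i + (K'\<^sup>T *\<^sub>v y) $ i"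
        using that M(1) D.K2 D.K by (subst index_append_vec) auto
      then show ?thesis using that unfolding z by simp
    qed
    have ui: "u $ i = monom 1 (\<epsilon> - i div n) * w $ (i mod n)" if "i < c" for i
      unfolding u_def \<Lambda>_def by (rule Lambda_kron_mult_vec_index[OF w(1)]) (use that in \<open>simp only: c_def\<close>)
    let ?s = "vec_degree w + \<epsilon>"
    have ud: "vec_degree u \<le> ?s"
      unfolding vec_degree_le_iff
    proof (intro allI impI)
      fix i assume "i < dim_vec u"
      then have i: "i < c" using u by simp
      then have n: "n > 0" by (cases n) (auto simp: c_def)
      have "degree (u $ i) \<le> degree (monom (1::'a) (\<epsilon> - i div n)) + degree (w $ (i mod n))"
        unfolding ui[OF i] by (rule degree_mult_le)
      also have "\<dots> \<le> \<epsilon> + vec_degree w"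
        using degree_le_vec_degree[of "i mod n" w] w(1) n by (intro add_mono) (auto simp: degree_monom_eq)
      finally show "degree (u $ i) \<le> ?s" by simp
    qed
    \<comment> \<open>An entry \<open>y_j\<close> of top degree contributes
      \<open>\<lambda> y_j\<close> to row \<open>j + m\<close> of \<open>K'^T y\<close>, so that
      this row has a nonzero coefficient at \<open>vec_degree y + 1\<close>. The entries of
      \<open>M u\<close> have degree at most \<open>1 + ?s\<close>; if \<open>y\<close> were of
      degree above \<open>?s\<close>, they could not cancel it.\<close>
    have yd: "vec_degree y \<le> ?s"
    proof (rule ccontr)
      assume big: "\<not> vec_degree y \<le> ?s"
      then have "y \<noteq> 0\<^sub>v e" by (auto simp: vec_degree_le_iff)
      then obtain j where j: "j < e" "y $ j \<noteq> 0" "degree (y $ j) = vec_degree y" using vec_degree_attained[OF y] by metis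
      let ?D = "vec_degree y"
      have jb: "j + m < b" using j(1) by (simp add: b_def e_def)
      have "(K'\<^sup>T *\<^sub>v y) $ (j + m) = monom 1 1 * y $ j - (if j + m < \<eta> * m then y $ (j + m) else 0)"
        unfolding K'_def L_pencil_kron_one by (rule kron_L_transpose_mult_vec_index) (use y j in \<open>simp_all only: e_def\<close>)
      then have "coeff ((K'\<^sup>T *\<^sub>v y) $ (j + m)) (Suc ?D) = coeff (y $ j) ?D - (if j + m < \<eta> * m then coeff (y $ (j + m)) (Suc ?D) else 0)"
        by (simp add: coeff_monom_mult)
      moreover have "coeff (y $ (j + m)) (Suc ?D) = 0" if "j + m < \<eta> * m"
        using degree_le_vec_degree[of "j + m" y] that y by (intro coeff_eq_0) (simp add: e_def le_imp_less_Suc)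
      moreover have "coeff (y $ j) ?D \<noteq> 0" using j(2,3) by (metis leading_coeff_neq_0)
      ultimately have "coeff ((K'\<^sup>T *\<^sub>v y) $ (j + m)) (Suc ?D) \<noteq> 0" by auto
      moreover have "coeff ((M *\<^sub>v u) $ (j + m)) (Suc ?D) = 0"
        using degree_mult_mat_vec_le[OF M u jb] ud big by (intro coeff_eq_0) linarith
      moreover have "coeff ((M *\<^sub>v u) $ (j + m)) (Suc ?D) + coeff ((K'\<^sup>T *\<^sub>v y) $ (j + m)) (Suc ?D) = 0"
        using top[OF jb] by (metis coeff_0 coeff_add)
      ultimately show False by simp
    qed
    show "vec_degree (D.col3 M *\<^sub>v w) = ?s"
    proof (rule antisym)
      show "vec_degree (D.col3 M *\<^sub>v w) \<le> ?s"
        unfolding \<Phi>w vec_degree_le_iff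
      proof (intro allI impI)
        fix i assume i: "i < dim_vec (u @\<^sub>v y)"
        show "degree ((u @\<^sub>v y) $ i) \<le> ?s"
        proof (cases "i < c")
          case True
          then show ?thesis using i u ud degree_le_vec_degree[of i u] by simp
        next
          case False
          then have "i - c < e" using i u y by auto
          then show ?thesis using False i u y yd degree_le_vec_degree[of "i - c" y] by simp
        qed
      qed
      obtain j where j: "j < n" "w $ j \<noteq> 0" "degree (w $ j) = vec_degree w" using vec_degree_attained[OF w(1,3)] by metis
      have jc: "j < c" using j(1) by (simp add: c_def)
      have "degree (u $ j) = ?s" unfolding ui[OF jc] using j by (simp add: degree_mult_eq degree_monom_eq)
      then show "?s \<le> vec_degree (D.col3 M *\<^sub>v w)"
        unfolding \<Phi>w using degree_le_vec_degree[of j "u @\<^sub>v y"] u jc by simp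
    qed
  qed
  then have "right_minimal_indices (four_block_mat M K'\<^sup>T K (0\<^sub>m a e)) = map (\<lambda>\<alpha>. \<alpha> + \<epsilon>) (right_minimal_indices (\<Lambda>'\<^sup>T * M * \<Lambda>))"
    unfolding T Q .
  then show ?thesis unfolding K_def K'_def \<Lambda>_def \<Lambda>'_def a_def e_def .
qed

lemma strictly_equivalent_transpose:
  fixes T :: "'a::comm_ring_1 poly mat"
  assumes "strictly_equivalent T' T"
  shows "strictly_equivalent T'\<^sup>T T\<^sup>T"
proof -
  define r c where "r = dim_row T" and "c = dim_col T"
  have T: "T \<in> carrier_mat r c" by (simp add: r_def c_def)
  obtain E E' F F' where E: "inverse_pair r E E'" and F: "inverse_pair c F F'" and T': "T' = const_mat E * T * const_mat F"
    using assms unfolding strictly_equivalent_def r_def c_def by blast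
  note e = const_mat_inverse[OF E] and f = const_mat_inverse[OF F]
  have ET: "const_mat E * T \<in> carrier_mat r c" by (rule mult_carrier_mat[OF e(3) T])
  have "T'\<^sup>T = (const_mat F)\<^sup>T * (T\<^sup>T * (const_mat E)\<^sup>T)"
    unfolding T' transpose_mult[OF ET f(3)] transpose_mult[OF e(3) T] ..
  also have "\<dots> = const_mat F\<^sup>T * T\<^sup>T * const_mat E\<^sup>T"
    unfolding const_mat_transpose using T e f by (intro assoc_mult_mat[symmetric]) auto
  finally show ?thesis
    using strictly_equivalentI[OF inverse_pair_transpose[OF F] inverse_pair_transpose[OF E], of "T\<^sup>T"] T by simp
qed

text \<open>Transposition turns the pencil into one of the same form with
  \<open>(\<epsilon>, n)\<close> and \<open>(\<eta>, m)\<close> exchanged, so the left indices are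
  right indices of the transposed pencil.\<close>

lemma minimal_indices_block_kronecker:
  fixes M :: "'a::field poly mat"
  assumes M: "M \<in> carrier_mat ((\<eta> + 1) * m) ((\<epsilon> + 1) * n)" "has_grade 1 M"
    and eq: "strictly_equivalent T' (four_block_mat M (L_pencil \<eta> \<otimes>\<^sub>m 1\<^sub>m m)\<^sup>T (L_pencil \<epsilon> \<otimes>\<^sub>m 1\<^sub>m n) (0\<^sub>m (\<epsilon> * n) (\<eta> * m)))"
  defines "Q \<equiv> (Lambda_col \<eta> \<otimes>\<^sub>m 1\<^sub>m m)\<^sup>T * M * (Lambda_col \<epsilon> \<otimes>\<^sub>m 1\<^sub>m n)"
  shows "right_minimal_indices T' = map (\<lambda>\<alpha>. \<alpha> + \<epsilon>) (right_minimal_indices Q)"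
    and "left_minimal_indices T' = map (\<lambda>\<alpha>. \<alpha> + \<eta>) (left_minimal_indices Q)"
proof -
  show "right_minimal_indices T' = map (\<lambda>\<alpha>. \<alpha> + \<epsilon>) (right_minimal_indices Q)"
    unfolding right_minimal_indices_strictly_equivalent[OF eq] Q_def by (rule right_minimal_indices_block_kronecker[OF M])
  let ?K = "L_pencil \<epsilon> \<otimes>\<^sub>m 1\<^sub>m n :: 'a poly mat" and ?K' = "L_pencil \<eta> \<otimes>\<^sub>m 1\<^sub>m m :: 'a poly mat"
  let ?\<Lambda> = "Lambda_col \<epsilon> \<otimes>\<^sub>m 1\<^sub>m n :: 'a poly mat" and ?\<Lambda>' = "Lambda_col \<eta> \<otimes>\<^sub>m 1\<^sub>m m :: 'a poly mat"
  note s1 = dual_system_kron[OF dual_system_L_pencil[where ?'a = 'a]]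
  have c: "?K \<in> carrier_mat (\<epsilon> * n) ((\<epsilon> + 1) * n)" "?K' \<in> carrier_mat (\<eta> * m) ((\<eta> + 1) * m)"
    "?\<Lambda> \<in> carrier_mat ((\<epsilon> + 1) * n) n" "?\<Lambda>' \<in> carrier_mat ((\<eta> + 1) * m) m"
    using s1[of \<epsilon> n] s1[of \<eta> m] unfolding dual_system_def by simp_all
  have ct: "?K'\<^sup>T \<in> carrier_mat ((\<eta> + 1) * m) (\<eta> * m)" "?\<Lambda>'\<^sup>T \<in> carrier_mat m ((\<eta> + 1) * m)" "M\<^sup>T \<in> carrier_mat ((\<epsilon> + 1) * n) ((\<eta> + 1) * m)"
    "?\<Lambda>\<^sup>T \<in> carrier_mat n ((\<epsilon> + 1) * n)"
    using c M by (simp_all only: transpose_carrier_mat)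
  have "(four_block_mat M ?K'\<^sup>T ?K (0\<^sub>m (\<epsilon> * n) (\<eta> * m)))\<^sup>T = four_block_mat M\<^sup>T ?K\<^sup>T ?K' (0\<^sub>m (\<eta> * m) (\<epsilon> * n))"
    unfolding transpose_four_block_mat[OF M(1) ct(1) c(1) zero_carrier_mat] by (simp add: zero_transpose_mat)
  then have "right_minimal_indices T'\<^sup>T = map (\<lambda>\<alpha>. \<alpha> + \<eta>) (right_minimal_indices (?\<Lambda>\<^sup>T * M\<^sup>T * ?\<Lambda>'))"
    using right_minimal_indices_strictly_equivalent[OF strictly_equivalent_transpose[OF eq]]
      right_minimal_indices_block_kronecker[OF ct(3)] M(2) by simp
  also have "?\<Lambda>\<^sup>T * M\<^sup>T * ?\<Lambda>' = Q\<^sup>T"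
    unfolding Q_def transpose_mult[OF mult_carrier_mat[OF ct(2) M(1)] c(3)] transpose_mult[OF ct(2) M(1)]
    by (simp only: Matrix.transpose_transpose) (rule assoc_mult_mat[OF ct(4,3) c(4)])
  finally show "left_minimal_indices T' = map (\<lambda>\<alpha>. \<alpha> + \<eta>) (left_minimal_indices Q)"
    unfolding left_minimal_indices_def .
qed

section \<open>The backward error\<close>

lemma sum_blocks:
  fixes f :: "nat \<Rightarrow> 'a::comm_monoid_add"
  shows "(\<Sum>l<q * n. f l) = (\<Sum>s<q. \<Sum>t<n. f (s * n + t))"
proof (induction q)
  case (Suc q)
  have "(\<Sum>l<a + n. f l) = (\<Sum>l<a. f l) + (\<Sum>t<n. f (a + t))" for a
    by (induction n) (simp_all add: add.assoc)
  then show ?case using Suc by (simp add: add.commute[of n])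
qed simp

lemma block_index_less:
  fixes s q t n :: nat
  assumes "s < q" "t < n"
  shows "s * n + t < q * n"
proof -
  have "s * n + t < (s + 1) * n" using assms by simp
  also have "\<dots> \<le> q * n" using assms by (intro mult_right_mono) auto
  finally show ?thesis .
qed

lemma mult_Lambda_kron_index:
  fixes X :: "'a::comm_ring_1 poly mat"
  assumes X: "X \<in> carrier_mat r ((k + 1) * n)" and ij: "i < r" "j < n"
  shows "(X * (Lambda_col k \<otimes>\<^sub>m 1\<^sub>m n)) $$ (i, j) = (\<Sum>s<k + 1. monom 1 (k - s) * X $$ (i, s * n + j))"
proof -
  note b = block_index_less[of _ "k + 1" _ n]
  have "(X * (Lambda_col k \<otimes>\<^sub>m 1\<^sub>m n)) $$ (i, j) = (\<Sum>l<(k + 1) * n. X $$ (i, l) * (Lambda_col k \<otimes>\<^sub>m 1\<^sub>m n) $$ (l, j))"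
    using X ij by (simp add: scalar_prod_def atLeast0LessThan Lambda_col_def)
  also have "\<dots> = (\<Sum>s<k + 1. \<Sum>t<n. X $$ (i, s * n + t) * (Lambda_col k \<otimes>\<^sub>m 1\<^sub>m n) $$ (s * n + t, j))"
    by (rule sum_blocks)
  also have "\<dots> = (\<Sum>s<k + 1. \<Sum>t<n. if t = j then monom 1 (k - s) * X $$ (i, s * n + t) else 0)"
  proof (intro sum.cong refl)
    fix s t assume "s \<in> {..<k + 1}" "t \<in> {..<n}"
    then have st: "s < k + 1" "t < n" by auto
    have "(Lambda_col k \<otimes>\<^sub>m 1\<^sub>m n) $$ (s * n + t, j) = (if t = j then monom 1 (k - s) else (0 :: 'a poly))"
      using st ij b[OF st] by (subst kron_one_index) (auto simp: Lambda_col_def)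
    then show "X $$ (i, s * n + t) * (Lambda_col k \<otimes>\<^sub>m 1\<^sub>m n) $$ (s * n + t, j) =
        (if t = j then monom 1 (k - s) * X $$ (i, s * n + t) else 0)" by (simp add: mult.commute)
  qed
  also have "\<dots> = (\<Sum>s<k + 1. monom 1 (k - s) * X $$ (i, s * n + j))" using ij by simp
  finally show ?thesis .
qed

lemma sum_sq_coeff_monom_mult_le:
  fixes p :: "'a::real_normed_field poly"
  assumes "degree p \<le> D'"
  shows "(\<Sum>k\<le>D. (norm (coeff (monom 1 s * p) k))\<^sup>2) \<le> (\<Sum>k\<le>D'. (norm (coeff p k))\<^sup>2)"
proof -
  have "(\<Sum>k\<le>D. (norm (coeff (monom 1 s * p) k))\<^sup>2) = (\<Sum>k\<in>{s..D}. (norm (coeff p (k - s)))\<^sup>2)"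
    by (intro sum.mono_neutral_cong_right) (auto simp: coeff_monom_mult)
  also have "\<dots> = (\<Sum>k\<in>(\<lambda>k. k - s) ` {s..D}. (norm (coeff p k))\<^sup>2)"
    by (subst sum.reindex) (auto simp: inj_on_def)
  also have "\<dots> = (\<Sum>k\<in>(\<lambda>k. k - s) ` {s..D} \<inter> {..D'}. (norm (coeff p k))\<^sup>2)"
    using assms by (intro sum.mono_neutral_right) (auto intro!: coeff_eq_0)
  also have "\<dots> \<le> (\<Sum>k\<le>D'. (norm (coeff p k))\<^sup>2)" by (intro sum_mono2) auto
  finally show ?thesis .
qed

lemma sq_norm_sum_le:
  fixes f :: "'b \<Rightarrow> 'a::real_normed_vector"
  shows "(norm (\<Sum>r\<in>I. f r))\<^sup>2 \<le> real (card I) * (\<Sum>r\<in>I. (norm (f r))\<^sup>2)"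
proof -
  have "(norm (\<Sum>r\<in>I. f r))\<^sup>2 \<le> (\<Sum>r\<in>I. norm (f r))\<^sup>2" by (intro power_mono norm_sum) simp
  also have "\<dots> \<le> real (card I) * (\<Sum>r\<in>I. (norm (f r))\<^sup>2)"
    using sum_squared_le_sum_of_squares[of "\<lambda>r. norm (f r)" I] by (simp add: mult.commute)
  finally show ?thesis .
qed

text \<open>The powers \<open>\<lambda>\<^sup>k, \<dots>, \<lambda>, 1\<close> move the constant (and the linear) coefficients of the blocks to distinct
  degrees, so only the two families can interfere.\<close>

lemma frob_norm_poly_pencil_mult_Lambda:
  fixes X :: "'a::real_normed_field poly mat"
  assumes X: "X \<in> carrier_mat r ((k + 1) * n)" "has_grade 1 X"
  shows "(frob_norm_poly (X * (Lambda_col k \<otimes>\<^sub>m 1\<^sub>m n)))\<^sup>2 \<le> 2 * (frob_norm_poly X)\<^sup>2"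
proof -
  let ?\<Lambda> = "Lambda_col k \<otimes>\<^sub>m 1\<^sub>m n :: 'a poly mat"
  have \<Lambda>: "?\<Lambda> \<in> carrier_mat ((k + 1) * n) n" by (auto simp: Lambda_col_def intro!: carrier_matI)
  have XL: "X * ?\<Lambda> \<in> carrier_mat r n" by (rule mult_carrier_mat[OF X(1) \<Lambda>])
  have g: "has_grade (1 + k) (X * ?\<Lambda>)"
    by (rule has_grade_mult[OF X(1) \<Lambda> X(2) has_grade_kron_one[OF has_grade_Lambda_col]])
  note b = block_index_less[of _ "k + 1" _ n]
  have key: "(\<Sum>e\<le>1 + k. (norm (coeff ((X * ?\<Lambda>) $$ (i, j)) e))\<^sup>2) \<le>
      2 * (\<Sum>s<k + 1. \<Sum>e\<le>1. (norm (coeff (X $$ (i, s * n + j)) e))\<^sup>2)" if ij: "i < r" "j < n" for i j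
  proof -
    let ?c = "\<lambda>s e. coeff (X $$ (i, s * n + j)) e"
    \<comment> \<open>Degree \<open>e\<close> receives the constant coefficient of block
      \<open>k - e\<close> and the linear coefficient of block \<open>k - (e - 1)\<close>. The
      guards exclude \<open>e = k + 1\<close> and \<open>e = 0\<close>, where truncated subtraction
      would name a block that does not contribute.\<close>
    let ?x = "\<lambda>e. if e \<le> k then ?c (k - e) 0 else 0"
    let ?y = "\<lambda>e. if 1 \<le> e \<and> e \<le> 1 + k then ?c (k - (e - 1)) 1 else 0"
    have co: "coeff ((X * ?\<Lambda>) $$ (i, j)) e = ?x e + ?y e" for e
    proof -
      have "coeff ((X * ?\<Lambda>) $$ (i, j)) e = (\<Sum>s<k + 1. if e < k - s then 0 else ?c s (e - (k - s)))"
        unfolding mult_Lambda_kron_index[OF X(1) ij] coeff_sum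
        by (intro sum.cong refl) (simp add: coeff_monom_mult)
      also have "\<dots> = (\<Sum>s<k + 1. (if s = k - e then (if e \<le> k then ?c s 0 else 0) else 0) +
          (if s = k - (e - 1) then (if 1 \<le> e \<and> e \<le> 1 + k then ?c s 1 else 0) else 0))"
      proof (intro sum.cong refl)
        fix s assume "s \<in> {..<k + 1}"
        then have s: "s < k + 1" by simp
        have z: "?c s e' = 0" if "1 < e'" for e'
          using has_grade_coeff[OF X(2), of i "s * n + j" e'] b[OF s ij(2)] X(1) ij that by auto
        consider "e < k - s" | "e = k - s" | "e = k - s + 1" | "k - s + 1 < e" by linarith
        then show "(if e < k - s then 0 else ?c s (e - (k - s))) =
          (if s = k - e then (if e \<le> k then ?c s 0 else 0) else 0) +
          (if s = k - (e - 1) then (if 1 \<le> e \<and> e \<le> 1 + k then ?c s 1 else 0) else 0)"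
        proof cases
          case 4
          then have "?c s (e - (k - s)) = 0" by (intro z) linarith
          then show ?thesis using 4 s by auto
        qed (use s in auto)
      qed
      also have "\<dots> = ?x e + ?y e" by (simp only: sum.distrib sum.delta finite_lessThan) auto
      finally show ?thesis .
    qed
    have "(\<Sum>e\<le>1 + k. (norm (coeff ((X * ?\<Lambda>) $$ (i, j)) e))\<^sup>2) \<le> (\<Sum>e\<le>1 + k. 2 * ((norm (?x e))\<^sup>2 + (norm (?y e))\<^sup>2))"
    proof (intro sum_mono)
      fix e
      have "(norm (?x e + ?y e))\<^sup>2 \<le> (norm (?x e) + norm (?y e))\<^sup>2" by (intro power_mono norm_triangle_ineq) simp
      also have "\<dots> \<le> 2 * ((norm (?x e))\<^sup>2 + (norm (?y e))\<^sup>2)"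
        using zero_le_power2[of "norm (?x e) - norm (?y e)"] by (simp add: power2_eq_square algebra_simps)
      finally show "(norm (coeff ((X * ?\<Lambda>) $$ (i, j)) e))\<^sup>2 \<le> 2 * ((norm (?x e))\<^sup>2 + (norm (?y e))\<^sup>2)" unfolding co .
    qed
    also have "\<dots> = 2 * ((\<Sum>e\<le>1 + k. (norm (?x e))\<^sup>2) + (\<Sum>e\<le>1 + k. (norm (?y e))\<^sup>2))"
      by (simp only: sum_distrib_left[symmetric] sum.distrib)
    also have "(\<Sum>e\<le>1 + k. (norm (?x e))\<^sup>2) = (\<Sum>s<k + 1. (norm (?c s 0))\<^sup>2)"
    proof -
      have "(\<Sum>e\<le>1 + k. (norm (?x e))\<^sup>2) = (\<Sum>e\<in>{..<k + 1}. (norm (?c (k - e) 0))\<^sup>2)"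
        by (intro sum.mono_neutral_cong_right) auto
      also have "\<dots> = (\<Sum>s<k + 1. (norm (?c s 0))\<^sup>2)"
        by (rule sum.reindex_bij_witness[of _ "\<lambda>s. k - s" "\<lambda>s. k - s"]) auto
      finally show ?thesis .
    qed
    also have "(\<Sum>e\<le>1 + k. (norm (?y e))\<^sup>2) = (\<Sum>s<k + 1. (norm (?c s 1))\<^sup>2)"
    proof -
      have "(\<Sum>e\<le>1 + k. (norm (?y e))\<^sup>2) = (\<Sum>e\<in>{1..1 + k}. (norm (?c (k - (e - 1)) 1))\<^sup>2)"
        by (intro sum.mono_neutral_cong_right) auto
      also have "\<dots> = (\<Sum>s<k + 1. (norm (?c s 1))\<^sup>2)"
        by (rule sum.reindex_bij_witness[of _ "\<lambda>s. k - s + 1" "\<lambda>e. k - (e - 1)"]) auto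
      finally show ?thesis .
    qed
    finally show ?thesis by (simp add: sum.distrib)
  qed
  have "(frob_norm_poly (X * ?\<Lambda>))\<^sup>2 = (\<Sum>i<r. \<Sum>j<n. \<Sum>e\<le>1 + k. (norm (coeff ((X * ?\<Lambda>) $$ (i, j)) e))\<^sup>2)"
    unfolding sq_frob_norm_poly_eq_sum[OF XL g] by (subst sum.swap) (intro sum.cong refl sum.swap)
  also have "\<dots> \<le> (\<Sum>i<r. \<Sum>j<n. 2 * (\<Sum>s<k + 1. \<Sum>e\<le>1. (norm (coeff (X $$ (i, s * n + j)) e))\<^sup>2))"
    by (intro sum_mono key) auto
  also have "\<dots> = 2 * (\<Sum>i<r. \<Sum>j<n. \<Sum>s<k + 1. \<Sum>e\<le>1. (norm (coeff (X $$ (i, s * n + j)) e))\<^sup>2)"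
    by (simp only: sum_distrib_left)
  also have "(\<Sum>i<r. \<Sum>j<n. \<Sum>s<k + 1. \<Sum>e\<le>1. (norm (coeff (X $$ (i, s * n + j)) e))\<^sup>2) =
      (\<Sum>i<r. \<Sum>l<(k + 1) * n. \<Sum>e\<le>1. (norm (coeff (X $$ (i, l)) e))\<^sup>2)"
    unfolding sum_blocks by (intro sum.cong refl sum.swap)
  also have "\<dots> = (frob_norm_poly X)\<^sup>2"
    unfolding sq_frob_norm_poly_eq_sum[OF X] by (subst (2) sum.swap) (intro sum.cong refl sum.swap)
  finally show ?thesis .
qed

text \<open>At an arbitrary grade all \<open>k + 1\<close> blocks can meet in one coefficient;
  Cauchy-Schwarz then costs the factor \<open>k + 1\<close> where a pencil costs 2.\<close>

lemma frob_norm_poly_mult_Lambda: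
  fixes X :: "'a::real_normed_field poly mat"
  assumes X: "X \<in> carrier_mat r ((k + 1) * n)" "has_grade d X"
  shows "(frob_norm_poly (X * (Lambda_col k \<otimes>\<^sub>m 1\<^sub>m n)))\<^sup>2 \<le> real (k + 1) * (frob_norm_poly X)\<^sup>2"
proof -
  let ?\<Lambda> = "Lambda_col k \<otimes>\<^sub>m 1\<^sub>m n :: 'a poly mat"
  have \<Lambda>: "?\<Lambda> \<in> carrier_mat ((k + 1) * n) n" by (auto simp: Lambda_col_def intro!: carrier_matI)
  have XL: "X * ?\<Lambda> \<in> carrier_mat r n" by (rule mult_carrier_mat[OF X(1) \<Lambda>])
  have g: "has_grade (d + k) (X * ?\<Lambda>)"
    by (rule has_grade_mult[OF X(1) \<Lambda> X(2) has_grade_kron_one[OF has_grade_Lambda_col]])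
  note b = block_index_less[of _ "k + 1" _ n]
  have key: "(\<Sum>e\<le>d + k. (norm (coeff ((X * ?\<Lambda>) $$ (i, j)) e))\<^sup>2) \<le>
      real (k + 1) * (\<Sum>s<k + 1. \<Sum>e\<le>d. (norm (coeff (X $$ (i, s * n + j)) e))\<^sup>2)" if ij: "i < r" "j < n" for i j
  proof -
    have "(\<Sum>e\<le>d + k. (norm (coeff ((X * ?\<Lambda>) $$ (i, j)) e))\<^sup>2) \<le>
        (\<Sum>e\<le>d + k. real (k + 1) * (\<Sum>s<k + 1. (norm (coeff (monom 1 (k - s) * X $$ (i, s * n + j)) e))\<^sup>2))"
    proof (intro sum_mono)
      fix e
      show "(norm (coeff ((X * ?\<Lambda>) $$ (i, j)) e))\<^sup>2 \<le>
          real (k + 1) * (\<Sum>s<k + 1. (norm (coeff (monom 1 (k - s) * X $$ (i, s * n + j)) e))\<^sup>2)"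
        using sq_norm_sum_le[of "\<lambda>s. coeff (monom 1 (k - s) * X $$ (i, s * n + j)) e" "{..<k + 1}"]
        unfolding mult_Lambda_kron_index[OF X(1) ij] coeff_sum card_lessThan .
    qed
    also have "\<dots> = real (k + 1) * (\<Sum>s<k + 1. \<Sum>e\<le>d + k. (norm (coeff (monom 1 (k - s) * X $$ (i, s * n + j)) e))\<^sup>2)"
      unfolding sum_distrib_left[symmetric] by (subst sum.swap) simp
    also have "\<dots> \<le> real (k + 1) * (\<Sum>s<k + 1. \<Sum>e\<le>d. (norm (coeff (X $$ (i, s * n + j)) e))\<^sup>2)"
      using b ij X by (intro mult_left_mono sum_mono sum_sq_coeff_monom_mult_le) (auto simp: has_grade_iff)
    finally show ?thesis .
  qed
  have "(frob_norm_poly (X * ?\<Lambda>))\<^sup>2 = (\<Sum>i<r. \<Sum>j<n. \<Sum>e\<le>d + k. (norm (coeff ((X * ?\<Lambda>) $$ (i, j)) e))\<^sup>2)"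
    unfolding sq_frob_norm_poly_eq_sum[OF XL g] by (subst sum.swap) (intro sum.cong refl sum.swap)
  also have "\<dots> \<le> (\<Sum>i<r. \<Sum>j<n. real (k + 1) * (\<Sum>s<k + 1. \<Sum>e\<le>d. (norm (coeff (X $$ (i, s * n + j)) e))\<^sup>2))"
    by (intro sum_mono key) auto
  also have "\<dots> = real (k + 1) * (\<Sum>i<r. \<Sum>j<n. \<Sum>s<k + 1. \<Sum>e\<le>d. (norm (coeff (X $$ (i, s * n + j)) e))\<^sup>2)"
    by (simp only: sum_distrib_left)
  also have "(\<Sum>i<r. \<Sum>j<n. \<Sum>s<k + 1. \<Sum>e\<le>d. (norm (coeff (X $$ (i, s * n + j)) e))\<^sup>2) =
      (\<Sum>i<r. \<Sum>l<(k + 1) * n. \<Sum>e\<le>d. (norm (coeff (X $$ (i, l)) e))\<^sup>2)"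
    unfolding sum_blocks by (intro sum.cong refl sum.swap)
  also have "\<dots> = (frob_norm_poly X)\<^sup>2"
    unfolding sq_frob_norm_poly_eq_sum[OF X] by (subst (2) sum.swap) (intro sum.cong refl sum.swap)
  finally show ?thesis .
qed

text \<open>The factor 2 applies on the side that is multiplied first, while the matrix is still a
  pencil; the other side costs \<open>\<eta> + 1\<close>. One multiplication thus contributes no
  power of \<open>d\<close>, and the two together only its square root.\<close>

lemma frob_norm_poly_Lambda_pencil_Lambda:
  fixes X :: "'a::real_normed_field poly mat"
  assumes X: "X \<in> carrier_mat ((\<eta> + 1) * m) ((\<epsilon> + 1) * n)" "has_grade 1 X"
  shows "frob_norm_poly ((Lambda_col \<eta> \<otimes>\<^sub>m 1\<^sub>m m)\<^sup>T * X * (Lambda_col \<epsilon> \<otimes>\<^sub>m 1\<^sub>m n)) \<le> sqrt (2 * real (\<epsilon> + \<eta> + 1)) * frob_norm_poly X"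
proof -
  let ?\<Lambda> = "Lambda_col \<epsilon> \<otimes>\<^sub>m 1\<^sub>m n :: 'a poly mat" and ?\<Lambda>' = "Lambda_col \<eta> \<otimes>\<^sub>m 1\<^sub>m m :: 'a poly mat"
  have \<Lambda>: "?\<Lambda> \<in> carrier_mat ((\<epsilon> + 1) * n) n" "?\<Lambda>' \<in> carrier_mat ((\<eta> + 1) * m) m"
    by (auto simp: Lambda_col_def intro!: carrier_matI)
  have \<Lambda>T: "?\<Lambda>'\<^sup>T \<in> carrier_mat m ((\<eta> + 1) * m)" using \<Lambda>(2) by (simp only: transpose_carrier_mat)
  define R where "R = X * ?\<Lambda>"
  have R: "R \<in> carrier_mat ((\<eta> + 1) * m) n" unfolding R_def by (rule mult_carrier_mat[OF X(1) \<Lambda>(1)])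
  have RT: "R\<^sup>T \<in> carrier_mat n ((\<eta> + 1) * m)" using R by (simp only: transpose_carrier_mat)
  have g: "has_grade (1 + \<epsilon>) R\<^sup>T"
    unfolding R_def has_grade_transpose by (rule has_grade_mult[OF X(1) \<Lambda>(1) X(2) has_grade_kron_one[OF has_grade_Lambda_col]])
  have "?\<Lambda>'\<^sup>T * X * ?\<Lambda> = ?\<Lambda>'\<^sup>T * R" unfolding R_def by (rule assoc_mult_mat[OF \<Lambda>T X(1) \<Lambda>(1)])
  also have "\<dots> = (R\<^sup>T * ?\<Lambda>')\<^sup>T" unfolding transpose_mult[OF RT \<Lambda>(2)] by simp
  finally have "(frob_norm_poly (?\<Lambda>'\<^sup>T * X * ?\<Lambda>))\<^sup>2 = (frob_norm_poly (R\<^sup>T * ?\<Lambda>'))\<^sup>2" by simp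
  also have "\<dots> \<le> real (\<eta> + 1) * (frob_norm_poly R)\<^sup>2" using frob_norm_poly_mult_Lambda[OF RT g] by simp
  also have "\<dots> \<le> real (\<epsilon> + \<eta> + 1) * (2 * (frob_norm_poly X)\<^sup>2)"
    unfolding R_def by (intro mult_mono frob_norm_poly_pencil_mult_Lambda[OF X]) auto
  also have "\<dots> = (sqrt (2 * real (\<epsilon> + \<eta> + 1)) * frob_norm_poly X)\<^sup>2"
    by (simp add: power_mult_distrib)
  finally show ?thesis by (rule power2_le_imp_le) simp
qed

section \<open>The reduction with explicit constants\<close>

text \<open>The lower bound turns \<open>(sqrt 2 - 1)^2 = 3 - 2 sqrt 2\<close> into 43/250; the
  upper one keeps \<open>sqrt 2 * 43/250\<close> below 1/4, the contraction limit of
  \<open>kron_L_perturbed\<close>.\<close>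

lemma sqrt_2_bounds: "707 / 500 \<le> sqrt 2" "sqrt 2 \<le> 14143 / 10000"
  by (rule real_le_rsqrt, simp add: power2_eq_square) (rule real_le_lsqrt, simp_all add: power2_eq_square)

text \<open>In \<open>small\<close>, one factor \<open>D\<close> and \<open>1 + \<mu>\<close> come
  from the bound \<open>g\<close> for the off-diagonal perturbations after the (2,2) block has been
  cleared, the other \<open>D\<close> from the right inverse in
  \<open>kron_L_perturbed\<close>.\<close>

lemma perturbed_block_kronecker:
  fixes M dL :: "'a::{real_normed_field,euclidean_space} poly mat"
  assumes M: "M \<in> carrier_mat ((\<eta> + 1) * m) ((\<epsilon> + 1) * n)" "has_grade 1 M"
    and dL: "dL \<in> carrier_mat ((\<eta> + 1) * m + \<epsilon> * n) ((\<epsilon> + 1) * n + \<eta> * m)" "has_grade 1 dL"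
  defines "D \<equiv> real (\<epsilon> + \<eta> + 1)" and "\<delta> \<equiv> frob_norm_poly dL" and "\<mu> \<equiv> frob_norm_poly M"
    and "T \<equiv> (\<lambda>M. four_block_mat M (kron_L \<eta> m)\<^sup>T (kron_L \<epsilon> n) (0\<^sub>m (\<epsilon> * n) (\<eta> * m)))"
  assumes small: "\<delta> * D\<^sup>2 * (1 + \<mu>) \<le> 43 / 250"
  shows "\<exists>M'. M' \<in> carrier_mat ((\<eta> + 1) * m) ((\<epsilon> + 1) * n) \<and> has_grade 1 M' \<and>
    strictly_equivalent (T M + dL) (T M') \<and>
    frob_norm_poly (M' - M) \<le> \<delta> * (1 + 9 / 2 * D\<^sup>2 * (\<mu> + \<delta>) * (1 + \<mu>))"
proof -
  define a b c e where "a = \<epsilon> * n" and "b = (\<eta> + 1) * m" and "c = (\<epsilon> + 1) * n" and "e = \<eta> * m"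
  define Kb Kg where "Kb = ((kron_L \<eta> m)\<^sup>T :: 'a poly mat)" and "Kg = (kron_L \<epsilon> n :: 'a poly mat)"
  have Kb: "Kb \<in> carrier_mat b e" and Kg: "Kg \<in> carrier_mat a c"
    unfolding Kb_def Kg_def a_def b_def c_def e_def by (simp_all only: transpose_carrier_mat kron_L_carrier)
  have M: "M \<in> carrier_mat b c" "has_grade 1 M" using M by (simp_all only: b_def c_def)
  have T: "T X = four_block_mat X Kb Kg (0\<^sub>m a e)" for X by (simp add: T_def Kb_def Kg_def a_def e_def)
  have dL: "dL \<in> carrier_mat (b + a) (c + e)" "has_grade 1 dL" using dL by (simp_all only: a_def b_def c_def e_def)
  obtain dA dB dG H where sp: "split_block dL b c = (dA, dB, dG, H)" by (metis prod_cases4)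
  note blk = split_block[OF sp, of a e]
  have dA: "dA \<in> carrier_mat b c" and dB: "dB \<in> carrier_mat b e" and dG: "dG \<in> carrier_mat a c" and H: "H \<in> carrier_mat a e"
    and dLe: "dL = four_block_mat dA dB dG H"
    using blk dL(1) by auto
  have gr: "has_grade 1 dA" "has_grade 1 dB" "has_grade 1 dG" "has_grade 1 H"
    using dL(2) unfolding dLe has_grade_four_block[OF dA dB dG H] by auto
  have nm: "frob_norm_poly dA \<le> \<delta>" "frob_norm_poly dB \<le> \<delta>" "frob_norm_poly dG \<le> \<delta>" "frob_norm_poly H \<le> \<delta>"
    unfolding \<delta>_def dLe by (rule frob_norm_poly_four_block_le[OF dA dB dG H])+
  have \<delta>0: "0 \<le> \<delta>" and \<mu>0: "0 \<le> \<mu>" by (simp_all add: \<delta>_def \<mu>_def)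
  have D1: "1 \<le> D" by (simp add: D_def)
  define A where "A = M + dA"
  have A: "A \<in> carrier_mat b c" "has_grade 1 A" "frob_norm_poly A \<le> \<mu> + \<delta>"
    unfolding A_def using M dA gr(1) nm(1) frob_norm_poly_triangle[OF M(1) dA]
    by (auto intro: has_grade_add simp: \<mu>_def)
  define \<kappa> where "\<kappa> = sqrt 2 * real (min \<epsilon> \<eta>)"
  have h: "real (min \<epsilon> \<eta>) \<le> (D - 1) / 2" by (simp add: D_def min_def)
  have \<kappa>0: "0 \<le> \<kappa>" by (simp add: \<kappa>_def)
  have \<kappa>: "\<kappa> \<le> 14143 / 10000 * ((D - 1) / 2)"
    unfolding \<kappa>_def using h sqrt_2_bounds(2) by (intro mult_mono) auto
  have \<delta>D2: "\<delta> * D\<^sup>2 \<le> 43 / 250"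
    using small mult_left_mono[of 1 "1 + \<mu>" "\<delta> * D\<^sup>2"] \<delta>0 \<mu>0 by simp
  \<comment> \<open>The middle inequality is \<open>(D - 2)^2 \<ge> 0\<close>; it trades the factor
    \<open>D - 1\<close> in the bound for \<open>\<kappa>\<close> for a quarter of
    \<open>D^2\<close>.\<close>
  have D2: "1 \<le> D\<^sup>2" "4 * (D - 1) \<le> D\<^sup>2" "D \<le> D\<^sup>2"
    using one_le_power[OF D1, of 2] zero_le_power2[of "D - 2"] mult_left_mono[OF D1, of D] D1
    by (auto simp: power2_eq_square algebra_simps)
  have \<delta>1: "\<delta> \<le> 43 / 250" using \<delta>D2 mult_left_mono[OF D2(1) \<delta>0] by simp
  have s1: "\<kappa> * \<delta> \<le> 1 / 32"
  proof -
    have "\<kappa> \<le> 14143 / 80000 * D\<^sup>2" using \<kappa> D2(2) by linarith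
    then have "\<kappa> * \<delta> \<le> 14143 / 80000 * D\<^sup>2 * \<delta>" using \<delta>0 by (rule mult_right_mono)
    also have "\<dots> = 14143 / 80000 * (\<delta> * D\<^sup>2)" by simp
    finally show ?thesis using \<delta>D2 by linarith
  qed
  have s2: "\<kappa>\<^sup>2 * \<delta> * (\<mu> + \<delta>) \<le> 9 / 100"
  proof -
    have "(real (min \<epsilon> \<eta>))\<^sup>2 \<le> (D / 2)\<^sup>2" using h by (intro power_mono) auto
    then have "\<kappa>\<^sup>2 \<le> D\<^sup>2 / 2" by (simp add: \<kappa>_def power_mult_distrib power_divide)
    then have "\<kappa>\<^sup>2 * (\<delta> * (\<mu> + \<delta>)) \<le> D\<^sup>2 / 2 * (\<delta> * (1 + \<mu>))"
      using \<delta>0 \<mu>0 \<delta>1 by (intro mult_mono) auto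
    also have "\<dots> = 1 / 2 * (\<delta> * D\<^sup>2 * (1 + \<mu>))" by simp
    finally have "\<kappa>\<^sup>2 * \<delta> * (\<mu> + \<delta>) \<le> 1 / 2 * (\<delta> * D\<^sup>2 * (1 + \<mu>))" by (simp only: mult.assoc)
    then show ?thesis using small by linarith
  qed
  obtain C E where C: "C \<in> carrier_mat a b" and E: "E \<in> carrier_mat c e"
    and Cn: "frob_norm C \<le> 5 / 4 * \<kappa> * \<delta>" and En: "frob_norm E \<le> 5 / 4 * \<kappa> * \<delta>"
    and zero: "const_mat C * (Kb + dB) + (Kg + dG) * const_mat E + H + const_mat C * A * const_mat E = 0\<^sub>m a e"
    using riccati_solution[OF A[unfolded b_def c_def] dB[unfolded b_def e_def] gr(2) nm(2) dG[unfolded a_def c_def] gr(3) nm(3)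
        H[unfolded a_def e_def] gr(4) nm(4), folded \<kappa>_def, OF s1 s2]
    unfolding a_def b_def c_def e_def Kb_def Kg_def by blast
  \<comment> \<open>A common bound for \<open>dG + C A\<close> and \<open>dB + A E\<close>, the
    off-diagonal perturbations left by the elimination. In the estimate 9/10 exceeds
    \<open>5/4 * 14143/20000\<close>, and \<open>9/10 (\<mu> + \<delta>) \<le> 1 + \<mu>\<close>
    since \<open>\<delta>\<close> is small.\<close>
  define g where "g = D * \<delta> * (1 + \<mu>)"
  have gb: "\<delta> + 5 / 4 * \<kappa> * \<delta> * (\<mu> + \<delta>) \<le> g"
  proof -
    have "5 / 4 * \<kappa> \<le> 5 / 4 * (14143 / 10000 * ((D - 1) / 2))" using \<kappa> by (rule mult_left_mono) simp
    also have "\<dots> \<le> 9 / 10 * (D - 1)" using D1 by (simp add: field_simps)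
    finally have "5 / 4 * \<kappa> \<le> 9 / 10 * (D - 1)" .
    then have "5 / 4 * \<kappa> * (\<mu> + \<delta>) \<le> 9 / 10 * (D - 1) * (\<mu> + \<delta>)" using \<mu>0 \<delta>0 by (intro mult_right_mono) auto
    also have "\<dots> = (D - 1) * (9 / 10 * (\<mu> + \<delta>))" by (simp add: algebra_simps)
    also have "\<dots> \<le> (D - 1) * (1 + \<mu>)" using D1 \<delta>1 \<mu>0 by (intro mult_left_mono) auto
    finally have "1 + 5 / 4 * \<kappa> * (\<mu> + \<delta>) \<le> 1 + (D - 1) * (1 + \<mu>)" by simp
    also have "\<dots> \<le> D * (1 + \<mu>)" using \<mu>0 by (simp add: algebra_simps)
    finally have "\<delta> * (1 + 5 / 4 * \<kappa> * (\<mu> + \<delta>)) \<le> \<delta> * (D * (1 + \<mu>))" using \<delta>0 by (rule mult_left_mono)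
    then show ?thesis by (simp add: g_def algebra_simps)
  qed
  have g0: "0 \<le> g" using D1 \<delta>0 \<mu>0 by (simp add: g_def)
  have Dg: "D * g \<le> 43 / 250" using small by (simp add: g_def power2_eq_square mult_ac)
  have g5: "g \<le> 1 / 5" using Dg mult_right_mono[OF D1 g0] by simp
  have kg: "sqrt 2 * real k * g \<le> 14143 / 10000 * (D * g)" if "real k \<le> D" for k
  proof -
    have "sqrt 2 * real k \<le> 14143 / 10000 * D" using that sqrt_2_bounds(2) by (intro mult_mono) auto
    then have "sqrt 2 * real k * g \<le> 14143 / 10000 * D * g" using g0 by (rule mult_right_mono)
    then show ?thesis by simp
  qed
  have kg4: "sqrt 2 * real k * g \<le> 1 / 4" if "real k \<le> D" for k using kg[OF that] Dg by linarith
  have kD: "real \<epsilon> \<le> D" "real \<eta> \<le> D" by (simp_all add: D_def)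
  define CA AE where "CA = const_mat C * A" and "AE = A * const_mat E"
  have CA: "CA \<in> carrier_mat a c" "has_grade 1 CA" and AE: "AE \<in> carrier_mat b e" "has_grade 1 AE"
    unfolding CA_def AE_def using mult_carrier_mat[of "const_mat C" a b A c] mult_carrier_mat[of A b c "const_mat E" e]
      has_grade_const_mult[OF C A(1,2)] has_grade_mult_const[OF A(1) E A(2)] A(1) C E by auto
  have CAn: "frob_norm_poly CA \<le> 5 / 4 * \<kappa> * \<delta> * (\<mu> + \<delta>)"
    unfolding CA_def using Cn A(3) \<kappa>0 \<delta>0 by (intro order.trans[OF frob_norm_poly_const_mult[OF C A(1)]] mult_mono) auto
  have AEn: "frob_norm_poly AE \<le> 5 / 4 * \<kappa> * \<delta> * (\<mu> + \<delta>)"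
  proof -
    have "frob_norm_poly AE \<le> frob_norm_poly A * frob_norm E" unfolding AE_def by (rule frob_norm_poly_mult_const[OF A(1) E])
    also have "\<dots> \<le> (\<mu> + \<delta>) * (5 / 4 * \<kappa> * \<delta>)" using En A(3) \<mu>0 \<delta>0 by (intro mult_mono) auto
    finally show ?thesis by (simp add: mult_ac)
  qed
  define G1 B1 where "G1 = dG + CA" and "B1 = dB + AE"
  have G1: "G1 \<in> carrier_mat a c" "has_grade 1 G1" "frob_norm_poly G1 \<le> g"
    unfolding G1_def using dG CA has_grade_add[OF dG CA(1) gr(3) CA(2)] frob_norm_poly_triangle[OF dG CA(1)] nm(3) CAn gb by auto
  have B1: "B1 \<in> carrier_mat b e" "has_grade 1 B1" "frob_norm_poly B1 \<le> g"
    unfolding B1_def using dB AE has_grade_add[OF dB AE(1) gr(2) AE(2)] frob_norm_poly_triangle[OF dB AE(1)] nm(2) AEn gb by auto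
  \<comment> \<open>The upper right block is the transposed case: the lemma is applied to
    \<open>Kb^T + B1^T\<close>, and \<open>eqB\<close> transposes the result back.\<close>
  have B1T: "B1\<^sup>T \<in> carrier_mat e b" "has_grade 1 B1\<^sup>T" "frob_norm_poly B1\<^sup>T \<le> g" using B1 by auto
  obtain Y1 Z1 where Y1: "Y1 \<in> carrier_mat c c" and Z1: "Z1 \<in> carrier_mat a a"
    and Y1n: "frob_norm Y1 \<le> 4 / 3 * (sqrt 2 * real \<epsilon> * g)" and Z1n: "frob_norm Z1 < 1"
    and eq1: "(Kg + G1) * const_mat (1\<^sub>m c + Y1) = const_mat (1\<^sub>m a + Z1) * Kg"
    using kron_L_perturbed[OF G1[unfolded a_def c_def] kg4[OF kD(1)] g5] unfolding a_def c_def Kg_def by blast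
  obtain Y2 Z2 where Y2: "Y2 \<in> carrier_mat b b" and Z2: "Z2 \<in> carrier_mat e e"
    and Y2n: "frob_norm Y2 \<le> 4 / 3 * (sqrt 2 * real \<eta> * g)" and Z2n: "frob_norm Z2 < 1"
    and eq2: "(Kb\<^sup>T + B1\<^sup>T) * const_mat (1\<^sub>m b + Y2) = const_mat (1\<^sub>m e + Z2) * Kb\<^sup>T"
    using kron_L_perturbed[OF B1T[unfolded b_def e_def] kg4[OF kD(2)] g5] unfolding b_def e_def Kb_def Matrix.transpose_transpose by blast
  \<comment> \<open>By \<open>Dg\<close> this is at most \<open>4/3 * 14143/10000 * 43/250\<close>,
    just below 1/3.\<close>
  define y where "y = 4 / 3 * (14143 / 10000 * (D * g))"
  have y: "frob_norm Y1 \<le> y" "frob_norm Y2 \<le> y" "0 \<le> y" "y \<le> 1 / 3"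
    using Y1n Y2n kg[OF kD(1)] kg[OF kD(2)] Dg D1 g0 unfolding y_def by (auto simp: field_simps)
  have inv: "\<exists>W'. inverse_pair r (1\<^sub>m r + W) W'" if "W \<in> carrier_mat r r" "frob_norm W < 1" for r and W :: "'a mat"
    using one_plus_invertible[OF that] that by (auto simp: inverse_pair_def)
  obtain R R2 S S2 where R: "inverse_pair c (1\<^sub>m c + Y1) R" and R2: "inverse_pair a (1\<^sub>m a + Z1) R2"
    and S: "inverse_pair b (1\<^sub>m b + Y2) S" and S2: "inverse_pair e (1\<^sub>m e + Z2) S2"
    using inv[OF Y1] inv[OF Z1 Z1n] inv[OF Y2] inv[OF Z2 Z2n] y by fastforce
  have YT: "(1\<^sub>m b + Y2)\<^sup>T = 1\<^sub>m b + Y2\<^sup>T" using Y2 by (simp add: transpose_add[of _ b b] transpose_one)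
  have eqB: "const_mat ((1\<^sub>m b + Y2)\<^sup>T) * ((Kb + dB) + A * const_mat E) = Kb * const_mat ((1\<^sub>m e + Z2)\<^sup>T)"
  proof -
    have c1: "const_mat (1\<^sub>m b + Y2) \<in> carrier_mat b b" "const_mat (1\<^sub>m e + Z2) \<in> carrier_mat e e" using Y2 Z2 by auto
    have c2: "Kb + B1 \<in> carrier_mat b e" "Kb\<^sup>T \<in> carrier_mat e b" "(Kb + B1)\<^sup>T \<in> carrier_mat e b" using Kb B1 by auto
    have "Kb + dB + A * const_mat E = Kb + B1"
      unfolding B1_def AE_def[symmetric] by (rule assoc_add_mat[OF Kb dB AE(1)])
    moreover have "const_mat ((1\<^sub>m b + Y2)\<^sup>T) * (Kb + B1) = ((Kb + B1)\<^sup>T * const_mat (1\<^sub>m b + Y2))\<^sup>T"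
      unfolding transpose_mult[OF c2(3) c1(1)] const_mat_transpose by simp
    moreover have "(Kb + B1)\<^sup>T = Kb\<^sup>T + B1\<^sup>T" by (rule transpose_add[OF Kb B1(1)])
    moreover have "(const_mat (1\<^sub>m e + Z2) * Kb\<^sup>T)\<^sup>T = Kb * const_mat ((1\<^sub>m e + Z2)\<^sup>T)"
      unfolding transpose_mult[OF c1(2) c2(2)] const_mat_transpose by simp
    ultimately show ?thesis by (simp only: eq2)
  qed
  have eqG: "((Kg + dG) + const_mat C * A) * const_mat (1\<^sub>m c + Y1) = const_mat (1\<^sub>m a + Z1) * Kg"
    using eq1 assoc_add_mat[OF Kg dG CA(1)] unfolding G1_def CA_def by simp
  define M' where "M' = const_mat ((1\<^sub>m b + Y2)\<^sup>T) * A * const_mat (1\<^sub>m c + Y1)"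
  have KdB: "Kb + dB \<in> carrier_mat b e" and KdG: "Kg + dG \<in> carrier_mat a c" using dB dG by auto
  have "strictly_equivalent (four_block_mat A (Kb + dB) (Kg + dG) H) (four_block_mat M' Kb Kg (0\<^sub>m a e))"
    unfolding M'_def
    by (rule strictly_equivalent_four_block[OF A(1) KdB KdG H Kb Kg C E zero
          inverse_pair_transpose[OF S] R inverse_pair_transpose[OF S2] R2 eqB eqG])
  moreover have "T M + dL = four_block_mat A (Kb + dB) (Kg + dG) H"
    unfolding T dLe add_four_block_mat[OF M(1) Kb Kg zero_carrier_mat dA dB dG H] A_def using H by simp
  ultimately have equiv: "strictly_equivalent (T M + dL) (T M')" by (simp add: T)
  define X where "X = Y2\<^sup>T"
  have X: "X \<in> carrier_mat b b" "frob_norm X \<le> y" using Y2 y by (auto simp: X_def)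
  define XA AY XAY where "XA = const_mat X * A" and "AY = A * const_mat Y1" and "XAY = const_mat X * A * const_mat Y1"
  have XA: "XA \<in> carrier_mat b c" "has_grade 1 XA" and AY: "AY \<in> carrier_mat b c" "has_grade 1 AY"
    unfolding XA_def AY_def using mult_carrier_mat[of "const_mat X" b b A c] mult_carrier_mat[of A b c "const_mat Y1" c]
      has_grade_const_mult[OF X(1) A(1,2)] has_grade_mult_const[OF A(1) Y1 A(2)] A(1) X Y1 by auto
  have XAY: "XAY \<in> carrier_mat b c" "has_grade 1 XAY"
    unfolding XAY_def XA_def[symmetric] using mult_carrier_mat[OF XA(1), of "const_mat Y1" c] has_grade_mult_const[OF XA(1) Y1 XA(2)] Y1 by auto
  have M'e: "M' = (A + XA) + (AY + XAY)"
  proof -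
    have Y1c: "const_mat Y1 \<in> carrier_mat c c" and Xc: "const_mat X \<in> carrier_mat b b" using Y1 X by auto
    have AXA: "A + XA \<in> carrier_mat b c" using XA by auto
    have "const_mat (1\<^sub>m b + X) * A = A + XA"
      unfolding const_mat_add[OF one_carrier_mat X(1)] const_mat_one add_mult_distrib_mat[OF one_carrier_mat Xc A(1)] XA_def
      using A(1) by simp
    then have "M' = (A + XA) * const_mat (1\<^sub>m c + Y1)" unfolding M'_def YT X_def[symmetric] by simp
    also have "\<dots> = (A + XA) + (A + XA) * const_mat Y1"
      unfolding const_mat_add[OF one_carrier_mat Y1] const_mat_one mult_add_distrib_mat[OF AXA one_carrier_mat Y1c]
      right_mult_one_mat[OF AXA] ..
    also have "(A + XA) * const_mat Y1 = AY + XAY"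
      using add_mult_distrib_mat[OF A(1) XA(1) Y1c] by (simp only: AY_def XAY_def XA_def)
    finally show ?thesis .
  qed
  have M'c: "M' \<in> carrier_mat b c" unfolding M'e using XA AY XAY by auto
  have M'g: "has_grade 1 M'"
    unfolding M'e by (intro has_grade_add[of _ b c] add_carrier_mat A XA AY XAY)
  \<comment> \<open>Here \<open>M'\<close> is \<open>(1 + X) (M + dA) (1 + Y1)\<close> with
    \<open>X\<close> the transpose of \<open>Y2\<close>; everything but \<open>M\<close> itself is
    small.\<close>
  have "M' - M = dA + (XA + (AY + XAY))"
    unfolding M'e A_def using M(1) dA XA(1) AY(1) XAY(1) by (intro eq_matI) auto
  then have "frob_norm_poly (M' - M) \<le> frob_norm_poly dA + (frob_norm_poly XA + (frob_norm_poly AY + frob_norm_poly XAY))"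
    using frob_norm_poly_triangle[OF dA, of "XA + (AY + XAY)"] frob_norm_poly_triangle[OF XA(1), of "AY + XAY"]
      frob_norm_poly_triangle[OF AY(1) XAY(1)] XA(1) AY(1) XAY(1) by auto
  also have "\<dots> \<le> \<delta> + (y * (\<mu> + \<delta>) + ((\<mu> + \<delta>) * y + y * (\<mu> + \<delta>) * y))"
  proof (intro add_mono nm(1))
    show xa: "frob_norm_poly XA \<le> y * (\<mu> + \<delta>)"
      unfolding XA_def using X A(3) y by (intro order.trans[OF frob_norm_poly_const_mult[OF X(1) A(1)]] mult_mono) auto
    show "frob_norm_poly AY \<le> (\<mu> + \<delta>) * y"
      unfolding AY_def using A(3) y \<mu>0 \<delta>0 by (intro order.trans[OF frob_norm_poly_mult_const[OF A(1) Y1]] mult_mono) auto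
    show "frob_norm_poly XAY \<le> y * (\<mu> + \<delta>) * y"
      unfolding XAY_def XA_def[symmetric] using xa y \<mu>0 \<delta>0
      by (intro order.trans[OF frob_norm_poly_mult_const[OF XA(1) Y1]] mult_mono) auto
  qed
  also have "\<dots> = \<delta> + (\<mu> + \<delta>) * (y * (2 + y))" by (simp add: algebra_simps)
  \<comment> \<open>\<open>2 + y \<le> 7/3\<close>, and \<open>7/3 * 4/3 * 14143/10000\<close> is
    about 4.4.\<close>
  also have "\<dots> \<le> \<delta> + (\<mu> + \<delta>) * (9 / 2 * (D * g))"
  proof -
    have "y * (2 + y) \<le> y * (7 / 3)" using y by (intro mult_left_mono) auto
    also have "\<dots> \<le> 9 / 2 * (D * g)" using D1 g0 unfolding y_def by simp
    finally show ?thesis using \<mu>0 \<delta>0 by (intro add_left_mono mult_left_mono) auto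
  qed
  also have "\<dots> = \<delta> * (1 + 9 / 2 * D\<^sup>2 * (\<mu> + \<delta>) * (1 + \<mu>))"
    by (simp add: g_def power2_eq_square field_simps)
  finally show ?thesis using equiv M'c M'g unfolding b_def c_def by blast
qed

theorem theorem5p21:
  fixes P M \<L> \<Delta>\<L> :: "'a::real_or_complex poly mat"
    and M0 M1 :: "'a mat"
    and m n d \<epsilon> \<eta> :: nat
  assumes P: "P \<in> carrier_mat m n" "has_grade d P" "P \<noteq> 0\<^sub>m m n"
    and M1: "M1 \<in> carrier_mat ((\<eta> + 1) * m) ((\<epsilon> + 1) * n)"
    and M0: "M0 \<in> carrier_mat ((\<eta> + 1) * m) ((\<epsilon> + 1) * n)"
    and M: "M = pencil M1 M0"
    and L: "\<L> = block_kronecker_pencil \<epsilon> n \<eta> m M1 M0"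
    and d: "d = \<epsilon> + \<eta> + 1"
    and PM: "P = ((Lambda_col \<eta>)\<^sup>T \<otimes>\<^sub>m 1\<^sub>m m) * M * (Lambda_col \<epsilon> \<otimes>\<^sub>m 1\<^sub>m n)"
    and \<Delta>L: "\<Delta>\<L> \<in> carrier_mat (dim_row \<L>) (dim_col \<L>)" "has_grade 1 \<Delta>\<L>"
    and small: "frob_norm_poly \<Delta>\<L> <
      (sqrt 2 - 1)\<^sup>2 * (1 / real d powr (5/2)) * (1 / (1 + frob_norm_poly M))"
  shows "\<exists>\<Delta>P \<in> carrier_mat m n.
      has_grade d \<Delta>P \<and>
      strong_linearization d (\<L> + \<Delta>\<L>) (P + \<Delta>P) \<and>
      frob_norm_poly \<Delta>P / frob_norm_poly P \<le>
        14 * real d powr (5/2) * (frob_norm_poly \<L> / frob_norm_poly P) *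
        (1 + frob_norm_poly M + (frob_norm_poly M)\<^sup>2) *
        (frob_norm_poly \<Delta>\<L> / frob_norm_poly \<L>) \<and>
      right_minimal_indices (\<L> + \<Delta>\<L>) = map (\<lambda>\<alpha>. \<alpha> + \<epsilon>) (right_minimal_indices (P + \<Delta>P)) \<and>
      left_minimal_indices (\<L> + \<Delta>\<L>) = map (\<lambda>\<alpha>. \<alpha> + \<eta>) (left_minimal_indices (P + \<Delta>P))"
proof -
  define a b c e where "a = \<epsilon> * n" and "b = (\<eta> + 1) * m" and "c = (\<epsilon> + 1) * n" and "e = \<eta> * m"
  \<comment> \<open>Positive sizes allow \<open>kron_transpose\<close> to pass from the transposed
    factor in the pencil to the transposed Kronecker product of the lemmas.\<close>
  have "m \<noteq> 0" "n \<noteq> 0" using P(1,3) by (metis carrier_matD eq_matI index_zero_mat(2,3) not_less_zero)+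
  then have mn: "m > 0" "n > 0" by auto
  define \<Lambda> where "\<Lambda> = (Lambda_col \<epsilon> \<otimes>\<^sub>m 1\<^sub>m n :: 'a poly mat)"
  define \<Lambda>' where "\<Lambda>' = (Lambda_col \<eta> \<otimes>\<^sub>m 1\<^sub>m m :: 'a poly mat)"
  have \<Lambda>: "\<Lambda> \<in> carrier_mat c n" unfolding \<Lambda>_def c_def by (auto simp: Lambda_col_def intro!: carrier_matI)
  have \<Lambda>': "\<Lambda>'\<^sup>T \<in> carrier_mat m b" unfolding \<Lambda>'_def b_def by (auto simp: Lambda_col_def intro!: carrier_matI)
  have Mc: "M \<in> carrier_mat b c" unfolding M pencil_def b_def c_def using M0 by auto
  have Mg: "has_grade 1 M"
    unfolding M pencil_def using M0 M1
    by (auto simp: has_grade_iff intro!: degree_add_le order.trans[OF degree_monom_le])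
  have kt: "(X :: 'a poly mat)\<^sup>T \<otimes>\<^sub>m 1\<^sub>m m = (X \<otimes>\<^sub>m 1\<^sub>m m)\<^sup>T" for X
    using mn kron_transpose[of "1\<^sub>m m" X] by (simp add: transpose_one)
  have PM: "P = \<Lambda>'\<^sup>T * M * \<Lambda>" unfolding PM \<Lambda>_def \<Lambda>'_def kt ..
  define T where "T = (\<lambda>M. four_block_mat M (kron_L \<eta> m)\<^sup>T (kron_L \<epsilon> n) (0\<^sub>m (\<epsilon> * n) (\<eta> * m)) :: 'a poly mat)"
  have LT: "\<L> = T M" unfolding L block_kronecker_pencil_def M[symmetric] T_def kt L_pencil_kron_one ..
  have Tc: "T X \<in> carrier_mat (b + a) (c + e)" if "X \<in> carrier_mat b c" for X
    unfolding T_def a_def e_def by (rule four_block_carrier_mat[OF that zero_carrier_mat])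
  have \<Delta>Lc: "\<Delta>\<L> \<in> carrier_mat (b + a) (c + e)" using \<Delta>L(1) Tc[OF Mc] unfolding LT by auto
  define D \<delta> \<mu> where "D = real d" and "\<delta> = frob_norm_poly \<Delta>\<L>" and "\<mu> = frob_norm_poly M"
  have D1: "1 \<le> D" by (simp add: D_def d)
  have \<delta>0: "0 \<le> \<delta>" and \<mu>0: "0 \<le> \<mu>" by (simp_all add: \<delta>_def \<mu>_def)
  \<comment> \<open>The square root will be matched by the norm of the multiplication with the two
    \<open>\<Lambda>\<close>, the square by the bound for \<open>M' - M\<close>.\<close>
  have pw: "real d powr (5/2) = sqrt D * D\<^sup>2"
  proof -
    have "real d powr (5/2) = D powr (1/2 + 2)" by (simp add: D_def)
    also have "\<dots> = D powr (1/2) * D powr 2" by (rule powr_add)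
    also have "\<dots> = sqrt D * D\<^sup>2" using D1 by (simp add: powr_half_sqrt)
    finally show ?thesis .
  qed
  have \<theta>: "(sqrt 2 - 1)\<^sup>2 \<le> 43 / 250"
    using sqrt_2_bounds(1) by (simp add: power2_diff)
  \<comment> \<open>Since \<open>sqrt D \<ge> 1\<close>, the assumed bound with exponent 5/2 implies
    the one with exponent 2 that the reduction asks for.\<close>
  have sm: "\<delta> * D\<^sup>2 * (1 + \<mu>) \<le> 43 / 250"
  proof -
    have "1 * D\<^sup>2 \<le> sqrt D * D\<^sup>2" using D1 by (intro mult_right_mono) auto
    then have "\<delta> * (D\<^sup>2 * (1 + \<mu>)) \<le> \<delta> * (sqrt D * D\<^sup>2 * (1 + \<mu>))" using \<delta>0 \<mu>0 by (intro mult_left_mono mult_right_mono) auto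
    also have "\<dots> \<le> (sqrt 2 - 1)\<^sup>2"
    proof -
      have pos: "0 < sqrt D * D\<^sup>2 * (1 + \<mu>)" using D1 \<mu>0 by simp
      have "\<delta> \<le> (sqrt 2 - 1)\<^sup>2 / (sqrt D * D\<^sup>2 * (1 + \<mu>))"
        using small unfolding pw \<delta>_def[symmetric] \<mu>_def[symmetric] by simp
      then show ?thesis using pos by (simp add: pos_le_divide_eq)
    qed
    finally have "\<delta> * D\<^sup>2 * (1 + \<mu>) \<le> (sqrt 2 - 1)\<^sup>2" by (simp only: mult.assoc)
    then show ?thesis using \<theta> by linarith
  qed
  have \<delta>1: "\<delta> \<le> 43 / 250"
  proof -
    have "1 \<le> D\<^sup>2 * (1 + \<mu>)" using mult_mono[of 1 "D\<^sup>2" 1 "1 + \<mu>"] one_le_power[OF D1, of 2] \<mu>0 by simp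
    then have "\<delta> * 1 \<le> \<delta> * (D\<^sup>2 * (1 + \<mu>))" using \<delta>0 by (rule mult_left_mono)
    then have "\<delta> \<le> \<delta> * D\<^sup>2 * (1 + \<mu>)" by (simp only: mult.assoc mult_1_right)
    then show ?thesis using sm by linarith
  qed
  obtain M' where M': "M' \<in> carrier_mat b c" "has_grade 1 M'" and eq: "strictly_equivalent (\<L> + \<Delta>\<L>) (T M')"
    and M'n: "frob_norm_poly (M' - M) \<le> \<delta> * (1 + 9 / 2 * D\<^sup>2 * (\<mu> + \<delta>) * (1 + \<mu>))"
  proof -
    have "\<exists>M'. M' \<in> carrier_mat ((\<eta> + 1) * m) ((\<epsilon> + 1) * n) \<and> has_grade 1 M' \<and> strictly_equivalent (T M + \<Delta>\<L>) (T M') \<and>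
        frob_norm_poly (M' - M) \<le> \<delta> * (1 + 9 / 2 * D\<^sup>2 * (\<mu> + \<delta>) * (1 + \<mu>))"
      using sm unfolding T_def D_def d \<delta>_def \<mu>_def
      by (intro perturbed_block_kronecker) (use Mc Mg \<Delta>Lc \<Delta>L(2) in \<open>simp_all only: a_def b_def c_def e_def\<close>)
    then show ?thesis using that unfolding LT b_def c_def by metis
  qed
  have eq': "strictly_equivalent (\<L> + \<Delta>\<L>) (four_block_mat M' (L_pencil \<eta> \<otimes>\<^sub>m 1\<^sub>m m)\<^sup>T (L_pencil \<epsilon> \<otimes>\<^sub>m 1\<^sub>m n) (0\<^sub>m (\<epsilon> * n) (\<eta> * m)))"
    using eq unfolding T_def L_pencil_kron_one .
  define X where "X = M' - M"
  have X: "X \<in> carrier_mat b c" "has_grade 1 X"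
    unfolding X_def using Mc M' Mg by (auto intro: minus_carrier_mat has_grade_minus)
  \<comment> \<open>The polynomial depends linearly on the (1,1) block, so
    \<open>P + \<Delta>P\<close> is the one that belongs to \<open>M'\<close>.\<close>
  define \<Delta>P where "\<Delta>P = \<Lambda>'\<^sup>T * X * \<Lambda>"
  have \<Lambda>X: "\<Lambda>'\<^sup>T * X \<in> carrier_mat m c" by (rule mult_carrier_mat[OF \<Lambda>' X(1)])
  have \<Delta>Pc: "\<Delta>P \<in> carrier_mat m n" unfolding \<Delta>P_def by (rule mult_carrier_mat[OF \<Lambda>X \<Lambda>])
  have \<Delta>Pg: "has_grade d \<Delta>P"
  proof -
    have "has_grade (\<eta> + 1 + \<epsilon>) \<Delta>P" unfolding \<Delta>P_def
      by (intro has_grade_mult[OF \<Lambda>X \<Lambda>] has_grade_mult[OF \<Lambda>' X(1)] X(2))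
        (simp_all add: \<Lambda>_def \<Lambda>'_def has_grade_kron_one has_grade_Lambda_col)
    then show ?thesis by (simp add: d add_ac)
  qed
  have Q: "P + \<Delta>P = \<Lambda>'\<^sup>T * M' * \<Lambda>"
  proof -
    have "M' = M + X" unfolding X_def using Mc M'(1) by (intro eq_matI) auto
    then show ?thesis
      unfolding PM \<Delta>P_def
      by (simp add: mult_add_distrib_mat[OF \<Lambda>' Mc X(1)] add_mult_distrib_mat[OF mult_carrier_mat[OF \<Lambda>' Mc] \<Lambda>X \<Lambda>])
  qed
  have "strong_linearization (\<epsilon> + \<eta> + 1) (\<L> + \<Delta>\<L>) (\<Lambda>'\<^sup>T * M' * \<Lambda>)"
    unfolding \<Lambda>_def \<Lambda>'_def
    by (rule strong_linearization_block_kronecker[OF _ M'(2) eq']) (use M'(1) in \<open>simp only: b_def c_def\<close>)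
  then have strong: "strong_linearization d (\<L> + \<Delta>\<L>) (P + \<Delta>P)" by (simp only: Q d)
  have ri: "right_minimal_indices (\<L> + \<Delta>\<L>) = map (\<lambda>\<alpha>. \<alpha> + \<epsilon>) (right_minimal_indices (P + \<Delta>P))"
    and li: "left_minimal_indices (\<L> + \<Delta>\<L>) = map (\<lambda>\<alpha>. \<alpha> + \<eta>) (left_minimal_indices (P + \<Delta>P))"
    unfolding Q \<Lambda>_def \<Lambda>'_def
    by (rule minimal_indices_block_kronecker[OF _ M'(2) eq'], use M'(1) in \<open>simp only: b_def c_def\<close>)+
  have Ppos: "0 < frob_norm_poly P" by (rule frob_norm_poly_pos[OF P(1,3)])
  \<comment> \<open>The norm of the pencil occurs once as numerator and once as denominator; it has
    to be nonzero to cancel.\<close>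
  have Lpos: "0 < frob_norm_poly \<L>"
  proof -
    have "M \<noteq> 0\<^sub>m b c" using P(3) PM \<Lambda> \<Lambda>' by auto
    then have "0 < frob_norm_poly M" by (rule frob_norm_poly_pos[OF Mc])
    also have "frob_norm_poly M \<le> frob_norm_poly \<L>"
      unfolding LT T_def using Mc
      by (intro frob_norm_poly_four_block_le(1)[OF _ _ kron_L_carrier zero_carrier_mat, of _ "(\<eta> + 1) * m"])
        (simp_all only: b_def c_def transpose_carrier_mat kron_L_carrier)
    finally show ?thesis .
  qed
  have bound: "frob_norm_poly \<Delta>P \<le> 14 * (sqrt D * D\<^sup>2) * (1 + \<mu> + \<mu>\<^sup>2) * \<delta>"
  proof -
    have "frob_norm_poly \<Delta>P \<le> sqrt (2 * D) * frob_norm_poly X"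
      unfolding \<Delta>P_def \<Lambda>_def \<Lambda>'_def D_def d
      by (rule frob_norm_poly_Lambda_pencil_Lambda) (use X in \<open>simp_all only: b_def c_def\<close>)
    also have "\<dots> \<le> sqrt (2 * D) * (\<delta> * (1 + 9 / 2 * D\<^sup>2 * (\<mu> + \<delta>) * (1 + \<mu>)))"
      using M'n D1 unfolding X_def by (intro mult_left_mono) auto
    also have "\<dots> = sqrt D * \<delta> * (sqrt 2 * (1 + 9 / 2 * D\<^sup>2 * (\<mu> + \<delta>) * (1 + \<mu>)))"
      by (simp add: real_sqrt_mult)
    also have "\<dots> \<le> sqrt D * \<delta> * (14 * D\<^sup>2 * (1 + \<mu> + \<mu>\<^sup>2))"
    proof (rule mult_left_mono)
      have D2: "1 \<le> D\<^sup>2" using one_le_power[OF D1, of 2] .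
      \<comment> \<open>Replacing \<open>\<delta>\<close> by 1/5 and \<open>sqrt 2\<close> by 2
        leads to the coefficients 19/5, 54/5 and 9 of \<open>1\<close>, \<open>\<mu>\<close> and
        \<open>\<mu>^2\<close>, all below 14.\<close>
      have "(\<mu> + \<delta>) * (1 + \<mu>) \<le> (\<mu> + 1 / 5) * (1 + \<mu>)" using \<delta>1 \<mu>0 by (intro mult_right_mono) auto
      also have "\<dots> = \<mu>\<^sup>2 + 6 / 5 * \<mu> + 1 / 5" by (simp add: power2_eq_square field_simps)
      finally have "D\<^sup>2 * ((\<mu> + \<delta>) * (1 + \<mu>)) \<le> D\<^sup>2 * (\<mu>\<^sup>2 + 6 / 5 * \<mu> + 1 / 5)" by (intro mult_left_mono) auto
      then have "1 + 9 / 2 * D\<^sup>2 * (\<mu> + \<delta>) * (1 + \<mu>) \<le> D\<^sup>2 + 9 / 2 * (D\<^sup>2 * (\<mu>\<^sup>2 + 6 / 5 * \<mu> + 1 / 5))"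
        using D2 by (simp only: mult.assoc)
      also have "\<dots> = D\<^sup>2 * (19 / 10 + 27 / 5 * \<mu> + 9 / 2 * \<mu>\<^sup>2)" by (simp add: algebra_simps)
      finally have "sqrt 2 * (1 + 9 / 2 * D\<^sup>2 * (\<mu> + \<delta>) * (1 + \<mu>)) \<le> 2 * (D\<^sup>2 * (19 / 10 + 27 / 5 * \<mu> + 9 / 2 * \<mu>\<^sup>2))"
        using sqrt_2_bounds(2) \<mu>0 \<delta>0 D1 by (intro mult_mono) auto
      also have "\<dots> = D\<^sup>2 * (19 / 5 + 54 / 5 * \<mu> + 9 * \<mu>\<^sup>2)" by (simp add: algebra_simps)
      also have "\<dots> \<le> D\<^sup>2 * (14 * (1 + \<mu> + \<mu>\<^sup>2))"
      proof (rule mult_left_mono)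
        have "19 / 5 + 54 / 5 * \<mu> + 9 * \<mu>\<^sup>2 \<le> 14 + 14 * \<mu> + 14 * \<mu>\<^sup>2"
          using \<mu>0 by (intro add_mono mult_right_mono) auto
        then show "19 / 5 + 54 / 5 * \<mu> + 9 * \<mu>\<^sup>2 \<le> 14 * (1 + \<mu> + \<mu>\<^sup>2)"
          by (simp only: distrib_left mult_1_right)
      qed simp
      also have "\<dots> = 14 * D\<^sup>2 * (1 + \<mu> + \<mu>\<^sup>2)" by (simp add: algebra_simps)
      finally show "sqrt 2 * (1 + 9 / 2 * D\<^sup>2 * (\<mu> + \<delta>) * (1 + \<mu>)) \<le> 14 * D\<^sup>2 * (1 + \<mu> + \<mu>\<^sup>2)" .
    qed (use D1 \<delta>0 in simp)
    finally show ?thesis by (simp add: mult_ac)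
  qed
  have "frob_norm_poly \<Delta>P / frob_norm_poly P \<le> 14 * real d powr (5/2) * (frob_norm_poly \<L> / frob_norm_poly P) *
        (1 + frob_norm_poly M + (frob_norm_poly M)\<^sup>2) * (frob_norm_poly \<Delta>\<L> / frob_norm_poly \<L>)"
  proof -
    have "frob_norm_poly \<Delta>P / frob_norm_poly P \<le> 14 * (sqrt D * D\<^sup>2) * (1 + \<mu> + \<mu>\<^sup>2) * \<delta> / frob_norm_poly P"
      using bound Ppos by (intro divide_right_mono) auto
    also have "\<dots> = 14 * (sqrt D * D\<^sup>2) * (frob_norm_poly \<L> / frob_norm_poly P) * (1 + \<mu> + \<mu>\<^sup>2) * (\<delta> / frob_norm_poly \<L>)"
    proof -
      have cancel: "x * y * z / p = x * (l / p) * y * (z / l)" if "l \<noteq> 0" for x y z p l :: real using that by simp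
      show ?thesis by (rule cancel) (use Lpos in simp)
    qed
    finally show ?thesis unfolding pw \<delta>_def \<mu>_def .
  qed
  then show ?thesis using \<Delta>Pc \<Delta>Pg strong ri li by blast
qed

end
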